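(* For each $m$-element subset $I\subset[1,mn]$ let $c_I=\sum_{J}\xi^I_J\otimes b_J\in\mathscr{F}_R(M(mn))\widetilde\otimes\mathcal B$, where $J$ runs over all $m$-element subsets of $[1,mn]$ and $\xi^I_J$ are the dynamical quantum minors of $\mathscr{F}_R(M(mn))$, and let $C=(c_I)$. Then in $\mathscr{F}_R(M(mn))\widetilde\otimes\mathcal B$ $$\mathrm{Pf}_m(C)=\det(T)\otimes\mathrm{Pf}_m(B).$$
   Context: Notation: $m,n$ are positive integers, $N=mn$, $[1,N]=\{1,\ldots,N\}$; $q\in\mathbb C^\times$ is generic; $\mathfrak h^*\cong\mathbb C^{N}$ with basis $e_1,\ldots,e_N$, $\omega(i)=e_i$; $M_{\mathfrak h^*}$ is the algebra of meromorphic functions $f(\underline\lambda)=f(\lambda_1,\ldots,\lambda_N)$ on $\mathfrak h^*$. Set $h(\lambda)=q\dfrac{q^{-2\lambda}-q^{-2}}{q^{-2\lambda}-1}$, $g(\lambda)=h(\lambda)h(-\lambda)$. $\mathscr{F}_R(M(N))$ is the associative algebra generated by $t_{ij}$ ($1\le i,j\le N$) and two copies of $M_{\mathfrak h^*}$ embedded as subalgebras, with elements $f(\underline\lambda)=\mu_l(f)$ and $f(\underline\mu)=\mu_r(f)$, subject to: $f_1(\underline\lambda)f_2(\underline\mu)=f_2(\underline\mu)f_1(\underline\lambda)$, $f(\underline\lambda)t_{ij}=t_{ij}f(\underline\lambda+\omega(i))$, $f(\underline\mu)t_{ij}=t_{ij}f(\underline\mu+\omega(j))$, and - $h(\mu_k-\mu_l)t_{ik}t_{il}=t_{il}t_{ik}$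 for $k<l$; - $h(\lambda_j-\lambda_i)t_{jk}t_{ik}=t_{ik}t_{jk}$ for $i<j$; - $t_{ik}t_{jl}=t_{jl}t_{ik}+(h(\lambda_j-\lambda_i)-h(\mu_k-\mu_l))t_{jk}t_{il}$ for $i<j$, $k<l$; - $g(\mu_k-\mu_l)t_{ik}t_{jl}=g(\lambda_i-\lambda_j)t_{jl}t_{ik}+(h(\mu_l-\mu_k)-h(\lambda_i-\lambda_j))t_{il}t_{jk}$ for $i<j$, $k<l$. For $I=\{i_1<\cdots<i_r\}\subset[1,N]$ and $\sigma\in S_r$, $S(\sigma,I)(\underline\lambda)=\prod_{k<l,\ \sigma(k)>\sigma(l)}(-h(\lambda_{i_{\sigma(k)}}-\lambda_{i_{\sigma(l)}}))$. For $J=\{j_1<\cdots<j_r\}$ the dynamical quantum minor is $\xi^I_J=\mu_r(S(\rho,J)^{-1})\sum_{\sigma\in S_r}\mu_l(S(\sigma,I))\,t_{i_{\sigma(1)}j_{\rho(1)}}\cdots t_{i_{\sigma(r)}j_{\rho(r)}}$, which is independent of $\rho\in S_r$ (one may take $\rho=\mathrm{id}$). $\det(T)=\xi^{[1,N]}_{[1,N]}$, where $T=(t_{ij})$. $\mathcal B$ is the algebra generated by $b_{i_1\cdots i_m}$, $1\le i_1<\cdots<i_m\le mn$, and a copy of $M_{\mathfrak h^*}$ embedded as a subalgebra, its elements denoted by $f(\underline\lambda)$ (no further relations are specified). For $I=\{i_1<\cdots<i_m\}$ write $b_I=b_{i_1\cdots i_m}$. $\mathscr{F}_R(M(mn))\widetilde\otimes\mathcal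 B$ denotes the usual tensor product (with factorwise products) modulo the relations $\mu_r(f)t\otimes b=t\otimes fb$ and $f(t\otimes b)=\mu_l(f)t\otimes b$ for $f\in M_{\mathfrak h^*}$; the second describes how $f$ acts on the left. For a family $X=(x_I)$ indexed by $m$-subsets $I=\{i_1<\cdots<i_m\}$ of $[1,mn]$, $x_I=x_{i_1\cdots i_m}$ (here $X=B=(b_I)$ or $X=C$), the dynamical quantum hyper-Pfaffian is $$\mathrm{Pf}_m(X)=\sum_{\sigma}S(\sigma,[1,mn])\,x_{\sigma(1)\cdots\sigma(m)}\cdots x_{\sigma(m(n-1)+1)\cdots\sigma(mn)},$$ the sum over all $\sigma\in S_{mn}$ with $\sigma((k-1)m+1)<\cdots<\sigma(km)$ for $k=1,\ldots,n$ (the order of the blocks is not restricted).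
   Formalization: Read as an algebra modulo a two-sided ideal, both sides are 0 (also proved). The substantive identity is modulo the span of the relations, with products of the c_I taken on representatives, and with rho-independence of 2×2 minors, which the listed relations do not imply, added as relations of F_R. *)

theory Defs
  imports
    "HOL-Analysis.Analysis"
    "HOL-Library.Poly_Mapping"
    "HOL-Combinatorics.Permutations"
    "HOL-Algebra.QuotRing"
    "HOL-Algebra.Module"
    "HOL-Algebra.Generated_Groups"
begin

section \<open>Meromorphic functions on a finite-dimensional complex vector space\<close>

definition holo_on :: "(complex^'N \<Rightarrow> complex) \<Rightarrow> (complex^'N::finite) set \<Rightarrow> bool" where
  "holo_on f U \<longleftrightarrow>
     (\<forall>z\<in>U. \<exists>D. (f has_derivative D) (at z) \<and> (\<forall>c v. D (c *s v) = c * D v))"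

definition nonvanishing_on :: "(complex^'N \<Rightarrow> complex) \<Rightarrow> (complex^'N::finite) set \<Rightarrow> bool" where
  "nonvanishing_on r U \<longleftrightarrow> (\<forall>V. open V \<and> V \<noteq> {} \<and> V \<subseteq> U \<longrightarrow> (\<exists>w\<in>V. r w \<noteq> 0))"

text \<open>A representative of a meromorphic function: locally a quotient of holomorphic functions.
  The values on the zero set of the denominator are irrelevant; the type \<open>mero\<close> below
  identifies representatives that agree on a dense open set.\<close>

definition mero_fun :: "(complex^'N \<Rightarrow> complex) \<Rightarrow> bool" where
  "mero_fun f \<longleftrightarrow>
     (\<forall>z::complex^'N::finite. \<exists>U p r. open U \<and> z \<in> U \<and> holo_on p U \<and> holo_on r U \<and>
        nonvanishing_on r U \<and> (\<forall>w\<in>U. r w \<noteq> 0 \<longrightarrow> f w = p w / r w))"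

definition mero_eq :: "(complex^'N \<Rightarrow> complex) \<Rightarrow> (complex^'N \<Rightarrow> complex) \<Rightarrow> bool" where
  "mero_eq f g \<longleftrightarrow> mero_fun f \<and> mero_fun g \<and>
     (\<exists>D::(complex^'N::finite) set. open D \<and> closure D = UNIV \<and> (\<forall>z\<in>D. f z = g z))"

lemma holo_on_const: "holo_on (\<lambda>_. c) U"
  unfolding holo_on_def by (intro ballI exI[of _ "\<lambda>_. 0"]) auto

lemma holo_on_subset: "holo_on f U \<Longrightarrow> V \<subseteq> U \<Longrightarrow> holo_on f V"
  unfolding holo_on_def by blast

lemma holo_on_add:
  assumes "holo_on f U" "holo_on g U" shows "holo_on (\<lambda>z. f z + g z) U"
  unfolding holo_on_def
proof
  fix z assume "z \<in> U"
  then obtain D E where D: "(f has_derivative D) (at z)" "\<forall>c v. D (c *s v) = c * D v"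
    and E: "(g has_derivative E) (at z)" "\<forall>c v. E (c *s v) = c * E v"
    using assms unfolding holo_on_def by blast
  show "\<exists>D. ((\<lambda>z. f z + g z) has_derivative D) (at z) \<and> (\<forall>c v. D (c *s v) = c * D v)"
    by (rule exI[of _ "\<lambda>v. D v + E v"])
       (use D E in \<open>auto intro: has_derivative_add simp: algebra_simps\<close>)
qed

lemma holo_on_mult:
  assumes "holo_on f U" "holo_on g U" shows "holo_on (\<lambda>z. f z * g z) U"
  unfolding holo_on_def
proof
  fix z assume "z \<in> U"
  then obtain D E where D: "(f has_derivative D) (at z)" "\<forall>c v. D (c *s v) = c * D v"
    and E: "(g has_derivative E) (at z)" "\<forall>c v. E (c *s v) = c * E v"
    using assms unfolding holo_on_def by blast
  show "\<exists>D. ((\<lambda>z. f z * g z) has_derivative D) (at z) \<and> (\<forall>c v. D (c *s v) = c * D v)"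
    by (intro exI[of _ "\<lambda>v. f z * E v + D v * g z"] conjI has_derivative_mult D(1) E(1))
       (use D E in \<open>auto simp: algebra_simps\<close>)
qed

lemma holo_on_shift:
  assumes "holo_on f U" shows "holo_on (\<lambda>z. f (z + a)) ((\<lambda>z. z - a) ` U)"
  unfolding holo_on_def
proof
  fix z assume "z \<in> (\<lambda>z. z - a) ` U"
  then have "z + a \<in> U" by auto
  then obtain D where D: "(f has_derivative D) (at (z + a))" "\<forall>c v. D (c *s v) = c * D v"
    using assms unfolding holo_on_def by blast
  have "((\<lambda>z. f (z + a)) has_derivative (\<lambda>v. D v)) (at z)"
    by (rule has_derivative_compose[where f = "\<lambda>z. z + a" and f' = "\<lambda>v. v", OF _ D(1)])
       (auto intro!: derivative_eq_intros)
  with D(2) show "\<exists>D. ((\<lambda>z. f (z + a)) has_derivative D) (at z) \<and> (\<forall>c v. D (c *s v) = c * D v)"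
    by blast
qed

lemma holo_on_imp_continuous_on: "holo_on f U \<Longrightarrow> continuous_on U f"
  unfolding holo_on_def
  by (meson has_derivative_continuous continuous_at_imp_continuous_on)

lemma nonvanishing_on_mult:
  assumes "open U" "holo_on r U" "nonvanishing_on r U" "nonvanishing_on s U"
  shows "nonvanishing_on (\<lambda>z. r z * s z) U"
  unfolding nonvanishing_on_def
proof (intro allI impI)
  fix V assume V: "open V \<and> V \<noteq> {} \<and> V \<subseteq> U"
  define W where "W = V \<inter> r -` (- {0})"
  have "continuous_on V r"
    using V assms(2) holo_on_subset holo_on_imp_continuous_on by blast
  then have "open W"
    unfolding W_def using V continuous_open_preimage by blast
  moreover have "W \<noteq> {}"
    using V assms(3) unfolding W_def nonvanishing_on_def by blast
  ultimately obtain w where "w \<in> W" "s w \<noteq> 0"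
    using V assms(4) unfolding nonvanishing_on_def W_def by blast
  then show "\<exists>w\<in>V. r w * s w \<noteq> 0" unfolding W_def by auto
qed

lemma nonvanishing_on_subset: "nonvanishing_on r U \<Longrightarrow> V \<subseteq> U \<Longrightarrow> nonvanishing_on r V"
  unfolding nonvanishing_on_def by blast

lemma mero_funE2:
  assumes "mero_fun f" "mero_fun g"
  obtains U p r p' r' where "open U" "z \<in> U" "holo_on p U" "holo_on r U" "holo_on p' U"
    "holo_on r' U" "nonvanishing_on (\<lambda>w. r w * r' w) U"
    "\<And>w. w \<in> U \<Longrightarrow> r w * r' w \<noteq> 0 \<Longrightarrow> f w = p w / r w \<and> g w = p' w / r' w"
proof -
  obtain U p r where 1: "open U" "z \<in> U" "holo_on p U" "holo_on r U" "nonvanishing_on r U"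
    "\<forall>w\<in>U. r w \<noteq> 0 \<longrightarrow> f w = p w / r w"
    using assms(1) unfolding mero_fun_def by meson
  obtain V p' r' where 2: "open V" "z \<in> V" "holo_on p' V" "holo_on r' V" "nonvanishing_on r' V"
    "\<forall>w\<in>V. r' w \<noteq> 0 \<longrightarrow> g w = p' w / r' w"
    using assms(2) unfolding mero_fun_def by meson
  show ?thesis
  proof (rule that[of "U \<inter> V" p r p' r'])
    show "nonvanishing_on (\<lambda>w. r w * r' w) (U \<inter> V)"
      by (rule nonvanishing_on_mult)
         (use 1 2 in \<open>auto intro: holo_on_subset nonvanishing_on_subset\<close>)
  qed (use 1 2 in \<open>auto intro: holo_on_subset\<close>)
qed

lemma mero_fun_holo: assumes "holo_on f UNIV" shows "mero_fun f"
  unfolding mero_fun_def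
  by (intro allI exI[of _ UNIV] exI[of _ f] exI[of _ "\<lambda>_. 1"])
     (use assms in \<open>auto simp: holo_on_const nonvanishing_on_def\<close>)

lemma mero_fun_const: "mero_fun (\<lambda>_. c)"
  by (rule mero_fun_holo[OF holo_on_const])

lemma mero_fun_add:
  assumes "mero_fun f" "mero_fun g" shows "mero_fun (\<lambda>z. f z + g z)"
  unfolding mero_fun_def
proof
  fix z
  obtain U p r p' r' where *: "open U" "z \<in> U" "holo_on p U" "holo_on r U" "holo_on p' U"
    "holo_on r' U" "nonvanishing_on (\<lambda>w. r w * r' w) U"
    "\<And>w. w \<in> U \<Longrightarrow> r w * r' w \<noteq> 0 \<Longrightarrow> f w = p w / r w \<and> g w = p' w / r' w"
    using mero_funE2[OF assms] by blast
  show "\<exists>U p r. open U \<and> z \<in> U \<and> holo_on p U \<and> holo_on r U \<and> nonvanishing_on r U \<and>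
      (\<forall>w\<in>U. r w \<noteq> 0 \<longrightarrow> f w + g w = p w / r w)"
    by (rule exI[of _ U], rule exI[of _ "\<lambda>w. p w * r' w + p' w * r w"],
        rule exI[of _ "\<lambda>w. r w * r' w"])
       (use * in \<open>auto intro!: holo_on_add holo_on_mult simp: field_simps\<close>)
qed

lemma mero_fun_mult:
  assumes "mero_fun f" "mero_fun g" shows "mero_fun (\<lambda>z. f z * g z)"
  unfolding mero_fun_def
proof
  fix z
  obtain U p r p' r' where *: "open U" "z \<in> U" "holo_on p U" "holo_on r U" "holo_on p' U"
    "holo_on r' U" "nonvanishing_on (\<lambda>w. r w * r' w) U"
    "\<And>w. w \<in> U \<Longrightarrow> r w * r' w \<noteq> 0 \<Longrightarrow> f w = p w / r w \<and> g w = p' w / r' w"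
    using mero_funE2[OF assms] by blast
  show "\<exists>U p r. open U \<and> z \<in> U \<and> holo_on p U \<and> holo_on r U \<and> nonvanishing_on r U \<and>
      (\<forall>w\<in>U. r w \<noteq> 0 \<longrightarrow> f w * g w = p w / r w)"
    by (rule exI[of _ U], rule exI[of _ "\<lambda>w. p w * p' w"], rule exI[of _ "\<lambda>w. r w * r' w"])
       (use * in \<open>auto intro!: holo_on_mult\<close>)
qed

lemma mero_fun_uminus: "mero_fun f \<Longrightarrow> mero_fun (\<lambda>z. - f z)"
  using mero_fun_mult[OF mero_fun_const[of "-1"], of f] by simp

lemma mero_fun_shift:
  assumes "mero_fun f" shows "mero_fun (\<lambda>z. f (z + a))"
  unfolding mero_fun_def
proof
  fix z
  obtain U p r where *: "open U" "z + a \<in> U" "holo_on p U" "holo_on r U" "nonvanishing_on r U"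
    "\<forall>w\<in>U. r w \<noteq> 0 \<longrightarrow> f w = p w / r w"
    using assms unfolding mero_fun_def by meson
  have "nonvanishing_on (\<lambda>z. r (z + a)) ((\<lambda>z. z - a) ` U)"
    unfolding nonvanishing_on_def
  proof (intro allI impI)
    fix V assume V: "open V \<and> V \<noteq> {} \<and> V \<subseteq> (\<lambda>z. z - a) ` U"
    then have "open ((\<lambda>z. a + z) ` V)" "(\<lambda>z. a + z) ` V \<noteq> {}" "(\<lambda>z. a + z) ` V \<subseteq> U"
      by (auto intro: open_translation)
    then obtain w where "w \<in> (\<lambda>z. a + z) ` V" "r w \<noteq> 0"
      using *(5) unfolding nonvanishing_on_def by blast
    then show "\<exists>w\<in>V. r (w + a) \<noteq> 0" by (auto simp: add.commute)
  qed
  moreover have "open ((\<lambda>z. z - a) ` U)"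
    using open_translation[OF *(1), of "- a"] by simp
  moreover have "z \<in> (\<lambda>z. z - a) ` U" using *(2) by (metis add_diff_cancel_right' image_eqI)
  ultimately show "\<exists>U p r. open U \<and> z \<in> U \<and> holo_on p U \<and> holo_on r U \<and> nonvanishing_on r U \<and>
      (\<forall>w\<in>U. r w \<noteq> 0 \<longrightarrow> f (w + a) = p w / r w)"
    by (intro exI[of _ "(\<lambda>z. z - a) ` U"] exI[of _ "\<lambda>w. p (w + a)"] exI[of _ "\<lambda>w. r (w + a)"])
       (use * in \<open>auto intro!: holo_on_shift\<close>)
qed

lemma open_dense_Int:
  assumes "open S" "closure S = UNIV" "closure T = UNIV"
  shows "closure (S \<inter> T) = UNIV"
  using assms open_Int_closure_subset[of S T] closure_mono[of S "closure (S \<inter> T)"] by auto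

lemma mero_eq_lift2:
  fixes f f' g g' :: "complex^'N::finite \<Rightarrow> complex"
  assumes "mero_eq f f'" "mero_eq g g'"
    and "\<And>(f :: complex^'N \<Rightarrow> complex) g.
      mero_fun f \<Longrightarrow> mero_fun g \<Longrightarrow> mero_fun (\<lambda>z. F (f z) (g z))"
  shows "mero_eq (\<lambda>z. F (f z) (g z)) (\<lambda>z. F (f' z) (g' z))"
proof -
  obtain D where D: "open D" "closure D = UNIV" "\<forall>z\<in>D. f z = f' z"
    using assms(1) unfolding mero_eq_def by blast
  obtain E where E: "open E" "closure E = UNIV" "\<forall>z\<in>E. g z = g' z"
    using assms(2) unfolding mero_eq_def by blast
  have "\<exists>D. open D \<and> closure D = UNIV \<and> (\<forall>z\<in>D. F (f z) (g z) = F (f' z) (g' z))"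
    by (rule exI[of _ "D \<inter> E"]) (use D E open_dense_Int[of D E] in auto)
  moreover have "mero_fun (\<lambda>z. F (f z) (g z))" "mero_fun (\<lambda>z. F (f' z) (g' z))"
    using assms(1,2)[unfolded mero_eq_def] assms(3)[of f g] assms(3)[of f' g'] by blast+
  ultimately show ?thesis unfolding mero_eq_def by blast
qed

lemma mero_eq_refl: "mero_fun f \<Longrightarrow> mero_eq f f"
  unfolding mero_eq_def using open_UNIV closure_UNIV by blast

lemma mero_eq_part_equivp: "part_equivp (mero_eq :: (complex^'N::finite \<Rightarrow> complex) \<Rightarrow> _)"
proof (rule part_equivpI)
  show "\<exists>f :: complex^'N \<Rightarrow> complex. mero_eq f f"
    using mero_eq_refl[OF mero_fun_const] by blast
  show "symp (mero_eq :: (complex^'N \<Rightarrow> complex) \<Rightarrow> _)"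
    by (rule sympI) (auto simp: mero_eq_def eq_commute)
  show "transp (mero_eq :: (complex^'N \<Rightarrow> complex) \<Rightarrow> _)"
  proof (rule transpI)
    fix f g h :: "complex^'N \<Rightarrow> complex"
    assume fg: "mero_eq f g" and gh: "mero_eq g h"
    obtain D where D: "open D" "closure D = UNIV" "\<forall>z\<in>D. f z = g z"
      using fg unfolding mero_eq_def by blast
    obtain E where E: "open E" "closure E = UNIV" "\<forall>z\<in>E. g z = h z"
      using gh unfolding mero_eq_def by blast
    have "\<exists>D. open D \<and> closure D = UNIV \<and> (\<forall>z\<in>D. f z = h z)"
      by (rule exI[of _ "D \<inter> E"]) (use D E open_dense_Int[of D E] in auto)
    then show "mero_eq f h" using fg gh unfolding mero_eq_def by blast
  qed
qed

quotient_type 'N mero = "complex^'N::finite \<Rightarrow> complex" / partial: mero_eq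
  by (rule mero_eq_part_equivp)

instantiation mero :: (finite) comm_ring_1
begin

lift_definition zero_mero :: "'a mero" is "\<lambda>_. 0"
  by (rule mero_eq_refl[OF mero_fun_const])
lift_definition one_mero :: "'a mero" is "\<lambda>_. 1"
  by (rule mero_eq_refl[OF mero_fun_const])
lift_definition plus_mero :: "'a mero \<Rightarrow> 'a mero \<Rightarrow> 'a mero" is "\<lambda>f g z. f z + g z"
  by (erule (1) mero_eq_lift2) (rule mero_fun_add)
lift_definition times_mero :: "'a mero \<Rightarrow> 'a mero \<Rightarrow> 'a mero" is "\<lambda>f g z. f z * g z"
  by (erule (1) mero_eq_lift2) (rule mero_fun_mult)
lift_definition uminus_mero :: "'a mero \<Rightarrow> 'a mero" is "\<lambda>f z. - f z"
  using mero_eq_lift2[where F = "\<lambda>x _. - x"] mero_fun_uminus by blast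
definition minus_mero :: "'a mero \<Rightarrow> 'a mero \<Rightarrow> 'a mero" where
  "minus_mero f g = f + - g"

instance
proof
  fix a b c :: "'a mero"
  show "a + b + c = a + (b + c)"
    by transfer (auto simp: mero_eq_def mero_fun_add add.assoc intro!: exI[of _ UNIV])
  show "a + b = b + a"
    by transfer (auto simp: mero_eq_def mero_fun_add add.commute intro!: exI[of _ UNIV])
  show "0 + a = a"
    by transfer (auto simp: mero_eq_def intro!: exI[of _ UNIV])
  show "- a + a = 0"
    by transfer (auto simp: mero_eq_def mero_fun_const intro!: exI[of _ UNIV])
  show "a - b = a + - b" by (rule minus_mero_def)
  show "a * b * c = a * (b * c)"
    by transfer (auto simp: mero_eq_def mero_fun_mult mult.assoc intro!: exI[of _ UNIV])
  show "a * b = b * a"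
    by transfer (auto simp: mero_eq_def mero_fun_mult mult.commute intro!: exI[of _ UNIV])
  show "1 * a = a"
    by transfer (auto simp: mero_eq_def intro!: exI[of _ UNIV])
  show "(a + b) * c = a * c + b * c"
    by transfer (auto simp: mero_eq_def mero_fun_add mero_fun_mult distrib_right
        intro!: exI[of _ UNIV])
  show "(0::'a mero) \<noteq> 1"
  proof (transfer, rule notI)
    assume "mero_eq (\<lambda>_::complex^'a. 0) (\<lambda>_. 1)"
    then obtain D :: "(complex^'a) set" where "closure D = UNIV" "\<forall>z\<in>D. (0::complex) = 1"
      unfolding mero_eq_def by blast
    then show False using closure_empty by (cases "D = {}") auto
  qed
qed

end

lift_definition mero_const :: "complex \<Rightarrow> 'N::finite mero" is "\<lambda>c _. c"
  by (rule mero_eq_refl[OF mero_fun_const])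

text \<open>\<open>mero_shift a f\<close> is \<open>f(\<lambda> + a)\<close>.\<close>

lift_definition mero_shift :: "complex^'N::finite \<Rightarrow> 'N mero \<Rightarrow> 'N mero" is
  "\<lambda>a f z. f (z + a)"
proof -
  fix a :: "complex^'N" and f g :: "complex^'N \<Rightarrow> complex" assume fg: "mero_eq f g"
  then obtain D where D: "open D" "closure D = UNIV" "\<forall>z\<in>D. f z = g z"
    unfolding mero_eq_def by blast
  have "\<exists>D. open D \<and> closure D = UNIV \<and> (\<forall>z\<in>D. f (z + a) = g (z + a))"
  proof (intro exI[of _ "(\<lambda>z. - a + z) ` D"] conjI)
    show "closure ((\<lambda>z. - a + z) ` D) = UNIV"
      unfolding closure_translation D(2) by (rule surj_plus)
    show "open ((\<lambda>z. - a + z) ` D)" by (rule open_translation[OF D(1)])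
  qed (use D in auto)
  with fg show "mero_eq (\<lambda>z. f (z + a)) (\<lambda>z. g (z + a))"
    unfolding mero_eq_def using mero_fun_shift by blast
qed

section \<open>Coordinates and the functions \<open>h\<close>, \<open>g\<close>\<close>

text \<open>The space \<open>h*\<close> is \<open>complex^'N\<close> with \<open>N = CARD('N)\<close>; \<open>coord\<close> is an enumeration of its
  coordinates by \<open>{1..N}\<close>, so that \<open>\<lambda>\<^sub>i\<close> is \<open>\<lambda> $ coord i\<close>.\<close>

definition coord :: "nat \<Rightarrow> 'N::finite" where
  "coord i = from_nat_into UNIV (i - 1)"

lemma bij_betw_coord: "bij_betw (coord :: nat \<Rightarrow> 'N::finite) {1..CARD('N)} UNIV"
proof -
  have 1: "bij_betw (\<lambda>i::nat. i - 1) {1..CARD('N)} {..<CARD('N)}"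
    by (rule bij_betw_byWitness[where f' = Suc]) auto
  have 2: "bij_betw (from_nat_into (UNIV :: 'N set)) {..<CARD('N)} UNIV"
    by (rule bij_betw_from_nat_into_finite) simp
  show ?thesis
    using bij_betw_trans[OF 1 2] by (simp add: coord_def[abs_def] comp_def)
qed

definition omega :: "nat \<Rightarrow> complex^'N::finite" where
  "omega i = axis (coord i) 1"

text \<open>\<open>q\<^sup>z\<close> is \<open>exp (\<eta> z)\<close> for a logarithm \<open>\<eta>\<close> of \<open>q\<close>, which is kept as a parameter.\<close>

definition hfun :: "complex \<Rightarrow> complex \<Rightarrow> complex" where
  "hfun \<eta> z = exp \<eta> * (exp (\<eta> * (- 2 * z)) - exp (\<eta> * (- 2))) / (exp (\<eta> * (- 2 * z)) - 1)"

definition gfun :: "complex \<Rightarrow> complex \<Rightarrow> complex" where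
  "gfun \<eta> z = hfun \<eta> z * hfun \<eta> (- z)"

lemma holo_on_exp_coord:
  fixes a b :: "'N::finite"
  shows "holo_on (\<lambda>x. exp (c * (x $ a - x $ b))) U"
  unfolding holo_on_def
proof
  fix z :: "complex^'N"
  let ?D = "\<lambda>v. exp (c * (z $ a - z $ b)) * (c * (v $ a - v $ b))"
  have vec: "((\<lambda>x. x $ i) has_derivative (\<lambda>v. v $ i)) (at z)" for i :: 'N
    by (rule bounded_linear_imp_has_derivative) (rule bounded_linear_vec_nth)
  have "((\<lambda>x. exp (c * (x $ a - x $ b))) has_derivative ?D) (at z)"
    by (rule has_derivative_compose[OF _ DERIV_exp[unfolded has_field_derivative_def]])
       (intro has_derivative_mult_right has_derivative_diff vec)
  then show "\<exists>D. ((\<lambda>x. exp (c * (x $ a - x $ b))) has_derivative D) (at z) \<and>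
      (\<forall>k v. D (k *s v) = k * D v)"
    by (intro exI[of _ ?D]) (auto simp: algebra_simps)
qed

lemma nonvanishing_on_exp_coord:
  fixes a b :: "'N::finite"
  assumes "c \<noteq> 0" "a \<noteq> b"
  shows "nonvanishing_on (\<lambda>x. exp (c * (x $ a - x $ b)) - 1) U"
  unfolding nonvanishing_on_def
proof (intro allI impI, rule ccontr)
  fix V assume V: "open V \<and> V \<noteq> {} \<and> V \<subseteq> U"
    and no: "\<not> (\<exists>w\<in>V. exp (c * (w $ a - w $ b)) - 1 \<noteq> 0)"
  then obtain z where z: "z \<in> V" by blast
  let ?s = "\<lambda>t::real. z + axis a (of_real t / c)"
  have "((\<lambda>t. axis a (complex_of_real t / c)) \<longlongrightarrow> 0) (at 0)"
  proof (rule vec_tendstoI)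
    fix i
    have "((\<lambda>t. complex_of_real t / c) \<longlongrightarrow> of_real 0 / c) (at 0)"
      by (intro tendsto_divide tendsto_of_real tendsto_ident_at tendsto_const assms(1))
    then show "((\<lambda>t. axis a (complex_of_real t / c) $ i) \<longlongrightarrow> 0 $ i) (at 0)"
      by (cases "i = a") (auto simp: axis_def)
  qed
  then have "(?s \<longlongrightarrow> z) (at 0)"
    using tendsto_add[OF tendsto_const[of z]] by fastforce
  then have "eventually (\<lambda>t. ?s t \<in> V) (at 0)"
    using V z topological_tendstoD by blast
  then obtain d where d: "d > 0" "\<And>t. t \<noteq> 0 \<Longrightarrow> \<bar>t\<bar> < d \<Longrightarrow> ?s t \<in> V"
    unfolding eventually_at by (auto simp: dist_real_def)
  have "?s (d / 2) \<in> V" using d(2)[of "d / 2"] d(1) by simp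
  then have "exp (c * (z $ a - z $ b) + of_real (d / 2)) = 1"
    using no assms by (auto simp: axis_def algebra_simps)
  moreover have "exp (c * (z $ a - z $ b)) = 1" using no z by auto
  ultimately have "exp (complex_of_real (d / 2)) = 1" by (simp add: exp_add)
  then have "exp (d / 2) = 1" by (metis exp_of_real of_real_eq_1_iff)
  then show False using d(1) by simp
qed

lemma mero_fun_hfun:
  fixes a b :: "'N::finite"
  assumes "\<eta> \<noteq> 0" "a \<noteq> b"
  shows "mero_fun (\<lambda>x. hfun \<eta> (x $ a - x $ b))"
  unfolding mero_fun_def
proof (intro allI)
  fix z :: "complex^'N"
  let ?e = "\<lambda>x::complex^'N. exp (- 2 * \<eta> * (x $ a - x $ b))"
  let ?p = "\<lambda>x. exp \<eta> * (?e x + - exp (- 2 * \<eta>))" and ?r = "\<lambda>x. ?e x + - 1"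
  have "holo_on ?p UNIV" "holo_on ?r UNIV"
    by (intro holo_on_mult holo_on_add holo_on_const holo_on_exp_coord)+
  moreover have "nonvanishing_on ?r UNIV"
    using nonvanishing_on_exp_coord[of "- 2 * \<eta>" a b UNIV] assms by simp
  moreover have "hfun \<eta> (x $ a - x $ b) = ?p x / ?r x" for x :: "complex^'N"
    by (simp add: hfun_def algebra_simps)
  ultimately show "\<exists>U p r. open U \<and> z \<in> U \<and> holo_on p U \<and> holo_on r U \<and>
      nonvanishing_on r U \<and> (\<forall>x\<in>U. r x \<noteq> 0 \<longrightarrow> hfun \<eta> (x $ a - x $ b) = p x / r x)"
    by (intro exI[of _ UNIV] exI[of _ ?p] exI[of _ ?r]) auto
qed

text \<open>\<open>h(\<lambda>\<^sub>i - \<lambda>\<^sub>j)\<close> and \<open>g(\<lambda>\<^sub>i - \<lambda>\<^sub>j)\<close> as meromorphic functions; only used for \<open>i \<noteq> j\<close>.\<close>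

definition hmero :: "complex \<Rightarrow> nat \<Rightarrow> nat \<Rightarrow> 'N::finite mero" where
  "hmero \<eta> i j = abs_mero (\<lambda>x. hfun \<eta> (x $ coord i - x $ coord j))"

definition gmero :: "complex \<Rightarrow> nat \<Rightarrow> nat \<Rightarrow> 'N::finite mero" where
  "gmero \<eta> i j = abs_mero (\<lambda>x. gfun \<eta> (x $ coord i - x $ coord j))"

section \<open>Algebras given by generators and relations\<close>

instantiation list :: (type) monoid_add
begin
definition zero_list :: "'a list" where "zero_list = []"
definition plus_list :: "'a list \<Rightarrow> 'a list \<Rightarrow> 'a list" where "plus_list = (@)"
instance by standard (auto simp: zero_list_def plus_list_def)
end

text \<open>Noncommutative polynomials: finitely supported complex functions on words; since addition
  of words is concatenation, the ring structure of \<open>\<Rightarrow>\<^sub>0\<close> is that of the free algebra.\<close>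

type_synonym 'g free_alg = "'g list \<Rightarrow>\<^sub>0 complex"

definition gen :: "'g \<Rightarrow> 'g free_alg" where
  "gen g = Poly_Mapping.single [g] 1"

definition scal :: "complex \<Rightarrow> 'g free_alg" where
  "scal c = Poly_Mapping.single [] c"

definition free_algebra :: "'g set \<Rightarrow> 'g free_alg ring" where
  "free_algebra G = \<lparr>carrier = {x. \<forall>w\<in>Poly_Mapping.keys x. set w \<subseteq> G},
     mult = (*), one = 1, zero = 0, add = (+)\<rparr>"

text \<open>\<open>rel x y\<close> is the relation \<open>x = y\<close>.\<close>

definition rel_ideal :: "'g set \<Rightarrow> ('g free_alg \<Rightarrow> 'g free_alg \<Rightarrow> bool) \<Rightarrow> 'g free_alg set" where
  "rel_ideal G rel = genideal (free_algebra G) {x - y | x y. rel x y}"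

definition pclass ::
  "'g set \<Rightarrow> ('g free_alg \<Rightarrow> 'g free_alg \<Rightarrow> bool) \<Rightarrow> 'g free_alg \<Rightarrow> 'g free_alg set" where
  "pclass G rel x = rel_ideal G rel +>\<^bsub>free_algebra G\<^esub> x"

definition presented ::
  "'g set \<Rightarrow> ('g free_alg \<Rightarrow> 'g free_alg \<Rightarrow> bool) \<Rightarrow> (complex, 'g free_alg set) module" where
  "presented G rel =
     (let A = free_algebra G Quot rel_ideal G rel in
      ring.extend A (module.fields (\<lambda>c x. pclass G rel (scal c) \<otimes>\<^bsub>A\<^esub> x)))"

section \<open>Tensor product of complex algebras\<close>

text \<open>The linear span of the symbols \<open>(a, b)\<close>, with product \<open>(a, b) (a', b') = (a a', b b')\<close>.\<close>

definition pair_algebra ::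
  "(complex, 'a) module \<Rightarrow> (complex, 'b) module \<Rightarrow> (('a \<times> 'b) \<Rightarrow>\<^sub>0 complex) ring" where
  "pair_algebra A B =
     \<lparr>carrier = {x. Poly_Mapping.keys x \<subseteq> carrier A \<times> carrier B},
      mult = (\<lambda>x y. \<Sum>(a, b)\<in>Poly_Mapping.keys x. \<Sum>(a', b')\<in>Poly_Mapping.keys y.
        Poly_Mapping.single (a \<otimes>\<^bsub>A\<^esub> a', b \<otimes>\<^bsub>B\<^esub> b')
          (Poly_Mapping.lookup x (a, b) * Poly_Mapping.lookup y (a', b'))),
      one = Poly_Mapping.single (\<one>\<^bsub>A\<^esub>, \<one>\<^bsub>B\<^esub>) 1, zero = 0, add = (+)\<rparr>"

definition bilinear_rels ::
  "(complex, 'a) module \<Rightarrow> (complex, 'b) module \<Rightarrow> (('a \<times> 'b) \<Rightarrow>\<^sub>0 complex) set" where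
  "bilinear_rels A B =
     (let s = Poly_Mapping.single in
       {s (a \<oplus>\<^bsub>A\<^esub> a', b) 1 - s (a, b) 1 - s (a', b) 1 | a a' b.
          a \<in> carrier A \<and> a' \<in> carrier A \<and> b \<in> carrier B}
     \<union> {s (a, b \<oplus>\<^bsub>B\<^esub> b') 1 - s (a, b) 1 - s (a, b') 1 | a b b'.
          a \<in> carrier A \<and> b \<in> carrier B \<and> b' \<in> carrier B}
     \<union> {s (c \<odot>\<^bsub>A\<^esub> a, b) 1 - s (a, b) c | c a b. a \<in> carrier A \<and> b \<in> carrier B}
     \<union> {s (a, c \<odot>\<^bsub>B\<^esub> b) 1 - s (a, b) c | c a b. a \<in> carrier A \<and> b \<in> carrier B})"

text \<open>The span of the bilinearity relations is already a two-sided ideal, so the quotient by the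
  ideal they generate is the usual tensor product with factorwise multiplication.\<close>

definition tensor ::
  "(complex, 'a) module \<Rightarrow> (complex, 'b) module \<Rightarrow> (('a \<times> 'b) \<Rightarrow>\<^sub>0 complex) set ring" where
  "tensor A B = pair_algebra A B Quot genideal (pair_algebra A B) (bilinear_rels A B)"

definition tens ::
  "(complex, 'a) module \<Rightarrow> (complex, 'b) module \<Rightarrow> 'a \<Rightarrow> 'b \<Rightarrow> (('a \<times> 'b) \<Rightarrow>\<^sub>0 complex) set" where
  "tens A B a b = genideal (pair_algebra A B) (bilinear_rels A B)
     +>\<^bsub>pair_algebra A B\<^esub> Poly_Mapping.single (a, b) 1"

section \<open>The dynamical quantum matrix algebra\<close>

text \<open>\<open>FL f\<close> and \<open>FR f\<close> stand for \<open>\<mu>\<^sub>l(f) = f(\<lambda>)\<close> and \<open>\<mu>\<^sub>r(f) = f(\<mu>)\<close>.\<close>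

datatype 'N fr_gen = FT 'N 'N | FL "'N mero" | FR "'N mero"

type_synonym 'N fr_rels = "'N fr_gen free_alg \<Rightarrow> 'N fr_gen free_alg \<Rightarrow> bool"

definition ft :: "nat \<Rightarrow> nat \<Rightarrow> 'N::finite fr_gen free_alg" where
  "ft i j = gen (FT (coord i) (coord j))"

definition fl :: "'N::finite mero \<Rightarrow> 'N fr_gen free_alg" where "fl f = gen (FL f)"

definition fr :: "'N::finite mero \<Rightarrow> 'N fr_gen free_alg" where "fr f = gen (FR f)"

inductive fr_rel :: "complex \<Rightarrow> 'N::finite fr_gen free_alg \<Rightarrow> 'N fr_gen free_alg \<Rightarrow> bool"
  for \<eta> :: complex where
  l_add: "fr_rel \<eta> (fl (f + g)) (fl f + fl g)"
| l_mult: "fr_rel \<eta> (fl (f * g)) (fl f * fl g)"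
| l_const: "fr_rel \<eta> (fl (mero_const c)) (scal c)"
| r_add: "fr_rel \<eta> (fr (f + g)) (fr f + fr g)"
| r_mult: "fr_rel \<eta> (fr (f * g)) (fr f * fr g)"
| r_const: "fr_rel \<eta> (fr (mero_const c)) (scal c)"
| lr_comm: "fr_rel \<eta> (fl f * fr g) (fr g * fl f)"
| l_t: "fr_rel \<eta> (fl f * ft i j) (ft i j * fl (mero_shift (omega i) f))"
    if "i \<in> {1..CARD('N)}" "j \<in> {1..CARD('N)}"
| r_t: "fr_rel \<eta> (fr f * ft i j) (ft i j * fr (mero_shift (omega j) f))"
    if "i \<in> {1..CARD('N)}" "j \<in> {1..CARD('N)}"
| same_row: "fr_rel \<eta> (fr (hmero \<eta> k l) * ft i k * ft i l) (ft i l * ft i k)"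
    if "i \<in> {1..CARD('N)}" "k \<in> {1..CARD('N)}" "l \<in> {1..CARD('N)}" "k < l"
| same_column: "fr_rel \<eta> (fl (hmero \<eta> j i) * ft j k * ft i k) (ft i k * ft j k)"
    if "i \<in> {1..CARD('N)}" "j \<in> {1..CARD('N)}" "k \<in> {1..CARD('N)}" "i < j"
| cross_h: "fr_rel \<eta> (ft i k * ft j l)
      (ft j l * ft i k + (fl (hmero \<eta> j i) - fr (hmero \<eta> k l)) * ft j k * ft i l)"
    if "i \<in> {1..CARD('N)}" "j \<in> {1..CARD('N)}" "k \<in> {1..CARD('N)}" "l \<in> {1..CARD('N)}"
      "i < j" "k < l"
| cross_g: "fr_rel \<eta> (fr (gmero \<eta> k l) * ft i k * ft j l)
      (fl (gmero \<eta> i j) * ft j l * ft i k + (fr (hmero \<eta> l k) - fl (hmero \<eta> i j)) * ft i l * ft j k)"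
    if "i \<in> {1..CARD('N)}" "j \<in> {1..CARD('N)}" "k \<in> {1..CARD('N)}" "l \<in> {1..CARD('N)}"
      "i < j" "k < l"

text \<open>Independence of \<open>\<rho>\<close> of the 2 by 2 quantum minors, cleared of the denominator
  \<open>S(\<rho>, {k, l})\<close>. The relations \<open>fr_rel\<close> imply it only after multiplication by
  \<open>h(\<lambda>\<^sub>j - \<lambda>\<^sub>i) - h(\<mu>\<^sub>k - \<mu>\<^sub>l)\<close>, which is not a unit in the algebraic tensor product of the two
  copies of the meromorphic functions.\<close>

inductive minor_rel :: "complex \<Rightarrow> 'N::finite fr_gen free_alg \<Rightarrow> 'N fr_gen free_alg \<Rightarrow> bool"
  for \<eta> :: complex where
  "minor_rel \<eta> (ft i l * ft j k - fl (hmero \<eta> j i) * ft j l * ft i k)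
      (- fr (hmero \<eta> l k) * (ft i k * ft j l - fl (hmero \<eta> j i) * ft j k * ft i l))"
    if "i \<in> {1..CARD('N)}" "j \<in> {1..CARD('N)}" "k \<in> {1..CARD('N)}" "l \<in> {1..CARD('N)}"
      "i < j" "k < l"

definition fr_minor_rel ::
  "complex \<Rightarrow> 'N::finite fr_gen free_alg \<Rightarrow> 'N fr_gen free_alg \<Rightarrow> bool" where
  "fr_minor_rel \<eta> x y \<longleftrightarrow> fr_rel \<eta> x y \<or> minor_rel \<eta> x y"

definition FRalg :: "'N::finite fr_rels \<Rightarrow> (complex, 'N fr_gen free_alg set) module" where
  "FRalg rel = presented UNIV rel"

definition tF :: "'N::finite fr_rels \<Rightarrow> nat \<Rightarrow> nat \<Rightarrow> 'N fr_gen free_alg set" where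
  "tF rel i j = pclass UNIV rel (ft i j)"

definition mu_l :: "'N::finite fr_rels \<Rightarrow> 'N mero \<Rightarrow> 'N fr_gen free_alg set" where
  "mu_l rel f = pclass UNIV rel (fl f)"

definition mu_r :: "'N::finite fr_rels \<Rightarrow> 'N mero \<Rightarrow> 'N fr_gen free_alg set" where
  "mu_r rel f = pclass UNIV rel (fr f)"

section \<open>Dynamical quantum minors and hyper-Pfaffians\<close>

text \<open>\<open>elt I k\<close> is \<open>i\<^sub>k\<close> for \<open>I = {i\<^sub>1 < i\<^sub>2 < \<dots>}\<close>.\<close>

definition elt :: "nat set \<Rightarrow> nat \<Rightarrow> nat" where
  "elt I k = sorted_list_of_set I ! (k - 1)"

definition Sfun :: "complex \<Rightarrow> (nat \<Rightarrow> nat) \<Rightarrow> nat set \<Rightarrow> 'N::finite mero" where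
  "Sfun \<eta> \<sigma> I =
     (\<Prod>(k, l)\<in>{(k, l). 1 \<le> k \<and> k < l \<and> l \<le> card I \<and> \<sigma> k > \<sigma> l}.
        - hmero \<eta> (elt I (\<sigma> k)) (elt I (\<sigma> l)))"

definition lprod :: "('a, 'x) monoid_scheme \<Rightarrow> 'a list \<Rightarrow> 'a" where
  "lprod A xs = foldr (\<lambda>x y. x \<otimes>\<^bsub>A\<^esub> y) xs \<one>\<^bsub>A\<^esub>"

text \<open>The minor \<open>\<xi>\<^sup>I\<^sub>J\<close>, computed with \<open>\<rho> = id\<close>, for which \<open>S(\<rho>, J) = 1\<close>.\<close>

definition minor ::
  "complex \<Rightarrow> 'N::finite fr_rels \<Rightarrow> nat set \<Rightarrow> nat set \<Rightarrow> 'N fr_gen free_alg set" where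
  "minor \<eta> rel I J =
     (\<Oplus>\<^bsub>FRalg rel\<^esub> \<sigma>\<in>{\<sigma>. \<sigma> permutes {1..card I}}.
        mu_l rel (Sfun \<eta> \<sigma> I) \<otimes>\<^bsub>FRalg rel\<^esub>
        lprod (FRalg rel) (map (\<lambda>k. tF rel (elt I (\<sigma> k)) (elt J k)) [1..<Suc (card I)]))"

definition detT :: "complex \<Rightarrow> 'N::finite fr_rels \<Rightarrow> 'N fr_gen free_alg set" where
  "detT \<eta> rel = minor \<eta> rel {1..CARD('N)} {1..CARD('N)}"

text \<open>The hyper-Pfaffian of \<open>x\<close> in the algebra \<open>A\<close>, on which a meromorphic function \<open>f\<close> acts as
  left multiplication by \<open>\<iota> f\<close>.\<close>

definition blocks :: "nat \<Rightarrow> nat \<Rightarrow> nat set" where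
  "blocks m k = {(k - 1) * m + 1..k * m}"

definition Pf :: "('a, 'x) ring_scheme \<Rightarrow> ('N::finite mero \<Rightarrow> 'a) \<Rightarrow> complex \<Rightarrow> nat \<Rightarrow> nat \<Rightarrow>
    (nat set \<Rightarrow> 'a) \<Rightarrow> 'a" where
  "Pf A \<iota> \<eta> m n x =
     (\<Oplus>\<^bsub>A\<^esub> \<sigma>\<in>{\<sigma>. \<sigma> permutes {1..m * n} \<and> (\<forall>k\<in>{1..n}. strict_mono_on (blocks m k) \<sigma>)}.
        \<iota> (Sfun \<eta> \<sigma> {1..m * n}) \<otimes>\<^bsub>A\<^esub>
        lprod A (map (\<lambda>k. x (\<sigma> ` blocks m k)) [1..<Suc n]))"

section \<open>The algebra \<open>\<B>\<close> and the dynamical tensor product\<close>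

definition msubsets :: "nat \<Rightarrow> nat \<Rightarrow> nat set set" where
  "msubsets m n = {I. I \<subseteq> {1..m * n} \<and> card I = m}"

datatype 'N b_gen = Bgen "nat set" | Bfun "'N mero"

inductive b_rel :: "'N::finite b_gen free_alg \<Rightarrow> 'N b_gen free_alg \<Rightarrow> bool" where
  "b_rel (gen (Bfun (f + g))) (gen (Bfun f) + gen (Bfun g))"
| "b_rel (gen (Bfun (f * g))) (gen (Bfun f) * gen (Bfun g))"
| "b_rel (gen (Bfun (mero_const c))) (scal c)"

definition b_gens :: "nat \<Rightarrow> nat \<Rightarrow> 'N b_gen set" where
  "b_gens m n = Bgen ` msubsets m n \<union> range Bfun"

definition Balg :: "nat \<Rightarrow> nat \<Rightarrow> (complex, 'N::finite b_gen free_alg set) module" where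
  "Balg m n = presented (b_gens m n) b_rel"

definition bB :: "nat \<Rightarrow> nat \<Rightarrow> nat set \<Rightarrow> 'N::finite b_gen free_alg set" where
  "bB m n I = pclass (b_gens m n) b_rel (gen (Bgen I))"

definition fB :: "nat \<Rightarrow> nat \<Rightarrow> 'N::finite mero \<Rightarrow> 'N b_gen free_alg set" where
  "fB m n f = pclass (b_gens m n) b_rel (gen (Bfun f))"

definition PfB :: "complex \<Rightarrow> nat \<Rightarrow> nat \<Rightarrow> 'N::finite b_gen free_alg set" where
  "PfB \<eta> m n = Pf (Balg m n) (fB m n) \<eta> m n (bB m n)"

type_synonym 'N fob = "(('N fr_gen free_alg set \<times> 'N b_gen free_alg set) \<Rightarrow>\<^sub>0 complex) set"

definition FoB :: "'N::finite fr_rels \<Rightarrow> nat \<Rightarrow> nat \<Rightarrow> 'N fob ring" where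
  "FoB rel m n = tensor (FRalg rel) (Balg m n)"

definition pt :: "'N::finite fr_rels \<Rightarrow> nat \<Rightarrow> nat \<Rightarrow>
    'N fr_gen free_alg set \<Rightarrow> 'N b_gen free_alg set \<Rightarrow> 'N fob" where
  "pt rel m n t b = tens (FRalg rel) (Balg m n) t b"

text \<open>The differences \<open>\<mu>\<^sub>r(f) t \<otimes> b - t \<otimes> f b\<close>.\<close>

definition balance :: "'N::finite fr_rels \<Rightarrow> nat \<Rightarrow> nat \<Rightarrow> 'N fob set" where
  "balance rel m n =
     {pt rel m n (mu_r rel f \<otimes>\<^bsub>FRalg rel\<^esub> t) b \<ominus>\<^bsub>FoB rel m n\<^esub> pt rel m n t (fB m n f \<otimes>\<^bsub>Balg m n\<^esub> b)
        | f t b. t \<in> carrier (FRalg rel) \<and> b \<in> carrier (Balg m n)}"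

text \<open>As an algebra, the dynamical tensor product is the quotient by the two-sided ideal generated
  by these relations. This ideal is large: by the shift relations it contains
  \<open>t\<^sub>i\<^sub>j \<otimes> (f(\<lambda>) - f(\<lambda> - \<omega>(j)))\<close> for all \<open>f\<close>, hence every \<open>t\<^sub>i\<^sub>j \<otimes> 1\<close>.\<close>

definition alg_ideal :: "'N::finite fr_rels \<Rightarrow> nat \<Rightarrow> nat \<Rightarrow> 'N fob set" where
  "alg_ideal rel m n = genideal (FoB rel m n) (balance rel m n)"

definition FtB :: "'N::finite fr_rels \<Rightarrow> nat \<Rightarrow> nat \<Rightarrow> 'N fob set ring" where
  "FtB rel m n = FoB rel m n Quot alg_ideal rel m n"

definition FtB_class :: "'N::finite fr_rels \<Rightarrow> nat \<Rightarrow> nat \<Rightarrow> 'N fob \<Rightarrow> 'N fob set" where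
  "FtB_class rel m n x = alg_ideal rel m n +>\<^bsub>FoB rel m n\<^esub> x"

text \<open>As a vector space, the dynamical tensor product is the quotient by the span of these
  relations, that is, the tensor product over the meromorphic functions, which does not collapse.
  The span is the additive subgroup generated by \<open>balance\<close>, because \<open>balance\<close> is closed under
  scalar multiplication; it is a right ideal, stable under left multiplication by
  \<open>\<mu>\<^sub>l(f) \<otimes> 1\<close>. Products are formed factorwise on representatives.\<close>

definition span_rel :: "'N::finite fr_rels \<Rightarrow> nat \<Rightarrow> nat \<Rightarrow> 'N fob set" where
  "span_rel rel m n = generate (add_monoid (FoB rel m n)) (balance rel m n)"

definition span_class :: "'N::finite fr_rels \<Rightarrow> nat \<Rightarrow> nat \<Rightarrow> 'N fob \<Rightarrow> 'N fob set" where
  "span_class rel m n x = span_rel rel m n +>\<^bsub>FoB rel m n\<^esub> x"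

text \<open>\<open>f (t \<otimes> b) = \<mu>\<^sub>l(f) t \<otimes> b\<close>: the left action of \<open>f\<close> is left multiplication by \<open>\<mu>\<^sub>l(f) \<otimes> 1\<close>.\<close>

definition left_fun :: "'N::finite fr_rels \<Rightarrow> nat \<Rightarrow> nat \<Rightarrow> 'N mero \<Rightarrow> 'N fob" where
  "left_fun rel m n f = pt rel m n (mu_l rel f) \<one>\<^bsub>Balg m n\<^esub>"

definition cC :: "complex \<Rightarrow> 'N::finite fr_rels \<Rightarrow> nat \<Rightarrow> nat \<Rightarrow> nat set \<Rightarrow> 'N fob" where
  "cC \<eta> rel m n I = (\<Oplus>\<^bsub>FoB rel m n\<^esub> J\<in>msubsets m n. pt rel m n (minor \<eta> rel I J) (bB m n J))"

end

theory Submission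
  imports Defs "HOL-Combinatorics.Multiset_Permutations"
begin

text \<open>For a word \<open>js\<close> of column indices let \<open>\<xi>(I, js)\<close> be the alternating sum defining the quantum
  minor, columns taken in the order \<open>js\<close>. Pairing the row words that differ by exchanging two adjacent
  rows reduces an exchange of adjacent columns to the 2 by 2 minors: equal columns give \<open>0\<close>, and
  sorting distinct columns costs the factor \<open>\<mu>\<^sub>r(S(js))\<close>. The weight of a row word is fixed
  by the shifts \<open>\<omega>(i)\<close> in other rows, so weights move freely to the left and the
  Laplace expansion along blocks of rows holds. Hence the coefficient in \<open>Pf(C)\<close> of
  \<open>b(J\<^sub>1) \<dots> b(J\<^sub>n)\<close> is \<open>\<xi>([1, N], J\<^sub>1 \<dots> J\<^sub>n)\<close>, which is \<open>0\<close> or \<open>\<mu>\<^sub>r(S) det(T)\<close>, and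
  \<open>\<mu>\<^sub>r(S)\<close> passes through the tensor sign. Modulo the two-sided ideal every \<open>t\<^sub>i\<^sub>j \<otimes> 1\<close>
  vanishes, and both sides are \<open>0\<close>.\<close>

section \<open>Inversion weights and ordered block partitions\<close>

text \<open>The obstacle is that weights are not central: a function of \<open>\<lambda>\<close>
  that passes a generator \<open>t\<close> is shifted by the row index of \<open>t\<close>, a
  function of \<open>\<mu>\<close> by its column index. A weight moves freely only past words that
  avoid its indices, so all bookkeeping is done with explicit words (lists) and disjointness of
  their letters. Rows within one minor are always distinct, hence row weights cause no trouble.
  Columns may repeat once several blocks are concatenated; then the factor of an exchange is shifted
  in an uncontrolled way, but it multiplies something congruent to \<open>0\<close>. For distinct
  columns the factor is unshifted and is collected at the left end, which is the side where the
  balancing relation trades \<open>\<mu>\<^sub>r(f) t \<otimes> b\<close> for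
  \<open>t \<otimes> f b\<close>. The matrix computations take place in the free algebra, as
  congruences modulo the ideal of relations, because there ordinary sums and list products are
  available; classes are taken only afterwards.\<close>

definition cross :: "(nat \<Rightarrow> nat \<Rightarrow> 'f::comm_monoid_mult) \<Rightarrow> nat set \<Rightarrow> nat set \<Rightarrow> 'f" where
  "cross H A B = (\<Prod>a\<in>A. \<Prod>b | b \<in> B \<and> b < a. H a b)"

text \<open>For distinct letters this is the product of \<open>H\<close> over the inversions of the
  word; with \<open>H = -h\<close> it is the function \<open>S\<close> of the word.
  \<open>cross H A B\<close> collects the inversions between a word with letters \<open>A\<close>
  and a later word with letters \<open>B\<close>, so it depends on the two sets and not on the
  orders.\<close>

fun inv_weight :: "(nat \<Rightarrow> nat \<Rightarrow> 'f::comm_monoid_mult) \<Rightarrow> nat list \<Rightarrow> 'f" where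
  "inv_weight H [] = 1"
| "inv_weight H (x # xs) = cross H {x} (set xs) * inv_weight H xs"

lemma cross_Un_left:
  assumes "finite A" "finite A'" "A \<inter> A' = {}"
  shows "cross H (A \<union> A') B = cross H A B * cross H A' B"
  unfolding cross_def using assms by (rule prod.union_disjoint)

lemma cross_Un_right:
  assumes "finite B" "finite B'" "B \<inter> B' = {}"
  shows "cross H A (B \<union> B') = cross H A B * cross H A B'"
proof -
  have "(\<Prod>b | b \<in> B \<union> B' \<and> b < a. H a b) =
      (\<Prod>b | b \<in> B \<and> b < a. H a b) * (\<Prod>b | b \<in> B' \<and> b < a. H a b)" for a
  proof -
    have "{b. b \<in> B \<union> B' \<and> b < a} = {b. b \<in> B \<and> b < a} \<union> {b. b \<in> B' \<and> b < a}"
      by blast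
    then show ?thesis
      using assms by (simp only:) (subst prod.union_disjoint, auto)
  qed
  then show ?thesis
    by (simp add: cross_def prod.distrib)
qed

lemma cross_empty [simp]: "cross H {} B = 1" "cross H A {} = 1"
  by (simp_all add: cross_def)

lemma cross_eq_1: "(\<And>a b. a \<in> A \<Longrightarrow> b \<in> B \<Longrightarrow> a \<le> b) \<Longrightarrow> cross H A B = 1"
  unfolding cross_def by (intro prod.neutral ballI) (fastforce dest: leD)

lemma inv_weight_append:
  "distinct (xs @ ys) \<Longrightarrow>
    inv_weight H (xs @ ys) = inv_weight H xs * inv_weight H ys * cross H (set xs) (set ys)"
proof (induction xs)
  case (Cons x xs)
  have "cross H (insert x (set xs)) (set ys) = cross H {x} (set ys) * cross H (set xs) (set ys)"
    using Cons.prems cross_Un_left[of "{x}" "set xs" H "set ys"] by auto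
  moreover have "cross H {x} (set xs \<union> set ys) = cross H {x} (set xs) * cross H {x} (set ys)"
    using Cons.prems by (intro cross_Un_right) auto
  ultimately show ?case using Cons by (simp add: mult_ac)
qed simp

lemma inv_weight_sorted: "sorted xs \<Longrightarrow> inv_weight H xs = 1"
  by (induction xs) (auto intro: cross_eq_1)

text \<open>No third letter changes its position relative to \<open>x\<close> or \<open>y\<close>,
  so the only new inversion is \<open>y\<close> before \<open>x\<close>.\<close>

lemma inv_weight_swap:
  assumes "distinct (as @ x # y # bs)" "x < y"
  shows "inv_weight H (as @ y # x # bs) = H y x * inv_weight H (as @ x # y # bs)"
proof -
  have 1: "cross H {y} (insert x (set bs)) = H y x * cross H {y} (set bs)"
    using assms cross_Un_right[of "{x}" "set bs" H "{y}"]
    by (auto simp: cross_def cong: conj_cong)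
  have 2: "cross H {x} (insert y (set bs)) = cross H {x} (set bs)"
    using assms cross_Un_right[of "{y}" "set bs" H "{x}"] cross_eq_1[of "{x}" "{y}" H] by auto
  have "distinct (as @ y # x # bs)" using assms by auto
  then show ?thesis
    using assms(1) by (simp add: inv_weight_append 1 2 insert_commute mult_ac)
qed

text \<open>Bridge to \<open>Sfun\<close>, which is indexed by pairs of positions. The induction
  splits off the pairs whose first position is \<open>0\<close>.\<close>

lemma inv_weight_eq_prod:
  assumes "distinct xs"
  shows "inv_weight H xs =
    (\<Prod>(k, l) | k < l \<and> l < length xs \<and> xs ! l < xs ! k. H (xs ! k) (xs ! l))"
proof -
  have "inv_weight H xs =
    (\<Prod>k<length xs. \<Prod>l | k < l \<and> l < length xs \<and> xs ! l < xs ! k. H (xs ! k) (xs ! l))"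
    using assms
  proof (induction xs)
    case (Cons x xs)
    have 0: "cross H {x} (set xs) =
        (\<Prod>l | 0 < l \<and> l < Suc (length xs) \<and> (x # xs) ! l < x. H x ((x # xs) ! l))"
    proof -
      have "bij_betw (\<lambda>l. (x # xs) ! l)
          {l. 0 < l \<and> l < Suc (length xs) \<and> (x # xs) ! l < x} {b \<in> set xs. b < x}"
      proof (rule bij_betw_imageI)
        show "inj_on (\<lambda>l. (x # xs) ! l) {l. 0 < l \<and> l < Suc (length xs) \<and> (x # xs) ! l < x}"
          by (rule inj_on_nth[OF Cons.prems]) auto
        have "b \<in> (\<lambda>l. (x # xs) ! l) ` {l. 0 < l \<and> l < Suc (length xs) \<and> (x # xs) ! l < x}"
          if b: "b \<in> set xs" "b < x" for b
        proof -
          obtain l where "l < length xs" "b = xs ! l"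
            using b by (auto simp: in_set_conv_nth)
          then show ?thesis
            using b(2) by (intro image_eqI[of _ _ "Suc l"]) auto
        qed
        then show "(\<lambda>l. (x # xs) ! l) ` {l. 0 < l \<and> l < Suc (length xs) \<and> (x # xs) ! l < x} =
            {b \<in> set xs. b < x}"
          by (auto simp: nth_Cons')
      qed
      from prod.reindex_bij_betw[OF this, of "H x"] show ?thesis
        by (simp add: cross_def)
    qed
    have 1: "(\<Prod>l | Suc k < l \<and> l < Suc (length xs) \<and> (x # xs) ! l < (x # xs) ! Suc k.
        H ((x # xs) ! Suc k) ((x # xs) ! l)) =
      (\<Prod>l | k < l \<and> l < length xs \<and> xs ! l < xs ! k. H (xs ! k) (xs ! l))" for k
      by (rule prod.reindex_bij_witness[of _ Suc "\<lambda>l. l - 1"]) (auto simp: nth_Cons')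
    have "inv_weight H (x # xs) = cross H {x} (set xs) * (\<Prod>k<length xs.
        \<Prod>l | k < l \<and> l < length xs \<and> xs ! l < xs ! k. H (xs ! k) (xs ! l))"
      using Cons by simp
    then show ?case
      by (simp only: 0 1 list.size(4) add_0_right add_Suc_right prod.lessThan_Suc_shift nth_Cons_0
          comp_def)
  qed simp
  also have "\<dots> = (\<Prod>(k, l)\<in>(SIGMA k:{..<length xs}.
      {l. k < l \<and> l < length xs \<and> xs ! l < xs ! k}). H (xs ! k) (xs ! l))"
    by (subst prod.Sigma) auto
  finally show ?thesis by (simp add: Sigma_def) (rule arg_cong2[where f = prod], auto)
qed

section \<open>Sums over all orderings of a finite set\<close>

lemma sum_permutations_of_set_swap:
  fixes f :: "nat list \<Rightarrow> 'a::comm_monoid_add"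
  assumes "finite I" "Suc p < card I"
  shows "(\<Sum>xs\<in>permutations_of_set I. f xs) =
    (\<Sum>xs | xs \<in> permutations_of_set I \<and> xs ! p < xs ! Suc p.
       f xs + f (xs[p := xs ! Suc p, Suc p := xs ! p]))"
proof -
  let ?P = "permutations_of_set I" and ?s = "\<lambda>xs. xs[p := xs ! Suc p, Suc p := xs ! p]"
  have len: "length xs = card I" if "xs \<in> ?P" for xs
    using that by (rule length_finite_permutations_of_set)
  have perm: "?s xs \<in> ?P" if "xs \<in> ?P" for xs
    using that assms(2) len[OF that] unfolding permutations_of_set_def
    by (simp add: set_swap distinct_swap)
  have ss: "?s (?s xs) = xs" if "xs \<in> ?P" for xs
    by (rule nth_equalityI) (use len[OF that] assms(2) in \<open>auto simp: nth_list_update\<close>)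
  have nth: "?s xs ! p = xs ! Suc p" "?s xs ! Suc p = xs ! p" if "xs \<in> ?P" for xs
    using len[OF that] assms(2) by (auto simp: nth_list_update)
  have neq: "xs ! p \<noteq> xs ! Suc p" if "xs \<in> ?P" for xs
    using len[OF that] assms(2) that by (auto simp: permutations_of_set_def nth_eq_iff_index_eq)
  have "?P = {xs \<in> ?P. xs ! p < xs ! Suc p} \<union> {xs \<in> ?P. xs ! Suc p < xs ! p}"
    using neq by (auto simp: neq_iff)
  then have "(\<Sum>xs\<in>?P. f xs) = (\<Sum>xs | xs \<in> ?P \<and> xs ! p < xs ! Suc p. f xs) +
      (\<Sum>xs | xs \<in> ?P \<and> xs ! Suc p < xs ! p. f xs)"
    by (subst (1) \<open>?P = _\<close>, subst sum.union_disjoint) auto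
  \<comment> \<open>The exchange of the two positions is an involution that carries ascents at
    \<open>p\<close> to descents at \<open>p\<close>.\<close>
  also have "(\<Sum>xs | xs \<in> ?P \<and> xs ! Suc p < xs ! p. f xs) =
      (\<Sum>xs | xs \<in> ?P \<and> xs ! p < xs ! Suc p. f (?s xs))"
    by (rule sum.reindex_bij_witness[of _ ?s ?s]) (use perm ss nth in auto)
  finally show ?thesis by (simp add: sum.distrib)
qed

text \<open>An ordering of \<open>I\<close> amounts to the set \<open>A\<close> of its first
  \<open>a\<close> letters together with orderings of \<open>A\<close> and of the rest. This
  \<open>A\<close> becomes the summation index of the Laplace expansion.\<close>

lemma sum_permutations_of_set_split:
  fixes f :: "nat list \<Rightarrow> 'a::comm_monoid_add"
  assumes "finite I" "a \<le> card I"
  shows "(\<Sum>xs\<in>permutations_of_set I. f xs) =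
    (\<Sum>A | A \<subseteq> I \<and> card A = a. \<Sum>ys\<in>permutations_of_set A.
       \<Sum>zs\<in>permutations_of_set (I - A). f (ys @ zs))"
proof -
  have fin: "finite {A. A \<subseteq> I \<and> card A = a}" using assms(1) by simp
  have drop: "x \<in> set (drop a xs) \<longleftrightarrow> x \<in> set xs \<and> x \<notin> set (take a xs)"
    if "distinct xs" for x and xs :: "nat list"
    using set_take_disj_set_drop_if_distinct[OF that order_refl, of a] set_append[of "take a xs" "drop a xs"]
    unfolding append_take_drop_id by blast
  have "(\<Sum>A | A \<subseteq> I \<and> card A = a. \<Sum>ys\<in>permutations_of_set A.
       \<Sum>zs\<in>permutations_of_set (I - A). f (ys @ zs)) =
    (\<Sum>(A, ys, zs)\<in>(SIGMA A:{A. A \<subseteq> I \<and> card A = a}.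
       permutations_of_set A \<times> permutations_of_set (I - A)). f (ys @ zs))"
    using assms(1) by (simp add: sum.cartesian_product sum.Sigma[OF fin])
  also have "\<dots> = (\<Sum>xs\<in>permutations_of_set I. f xs)"
    by (rule sum.reindex_bij_witness[of _
          "\<lambda>xs. (set (take a xs), take a xs, drop a xs)" "\<lambda>(A, ys, zs). ys @ zs"])
       (use assms in \<open>auto simp: permutations_of_set_def distinct_card drop
          dest: in_set_takeD\<close>)
  finally show ?thesis ..
qed

text \<open>The summation set of the hyper-Pfaffian, as lists of blocks instead of permutations:
  \<open>n\<close> disjoint \<open>m\<close>-subsets exhausting \<open>I\<close>, in any order. The
  recursion on the first block matches one step of the Laplace expansion.\<close>

fun ordered_blocks :: "nat \<Rightarrow> nat \<Rightarrow> nat set \<Rightarrow> nat set list set" where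
  "ordered_blocks m 0 I = (if I = {} then {[]} else {})"
| "ordered_blocks m (Suc n) I =
     (\<Union>A\<in>{A. A \<subseteq> I \<and> card A = m}. (#) A ` ordered_blocks m n (I - A))"

text \<open>The one-line word of the permutation that belongs to a list of blocks; its inversion
  weight is the coefficient \<open>S\<close>.\<close>

definition flat :: "nat set list \<Rightarrow> nat list" where
  "flat Is = concat (map sorted_list_of_set Is)"

lemma flat_simps [simp]: "flat [] = []" "flat (A # Is) = sorted_list_of_set A @ flat Is"
  by (simp_all add: flat_def)

lemma finite_ordered_blocks: "finite I \<Longrightarrow> finite (ordered_blocks m n I)"
  by (induction n arbitrary: I) auto

lemma sum_ordered_blocks_Suc:
  fixes f :: "nat set list \<Rightarrow> 'a::comm_monoid_add"
  assumes "finite I"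
  shows "(\<Sum>Is\<in>ordered_blocks m (Suc n) I. f Is) =
    (\<Sum>A | A \<subseteq> I \<and> card A = m. \<Sum>Is\<in>ordered_blocks m n (I - A). f (A # Is))"
  using assms
  by (simp, subst sum.UNION_disjoint) (auto simp: finite_ordered_blocks sum.reindex)

text \<open>\<open>distinct (flat Is)\<close> expresses pairwise disjointness of the blocks. In this
  form the condition can be compared with the absence of repeated columns.\<close>

lemma ordered_blocks_iff:
  assumes "finite I"
  shows "Is \<in> ordered_blocks m n I \<longleftrightarrow> length Is = n \<and> (\<forall>A\<in>set Is. A \<subseteq> I \<and> card A = m) \<and>
    distinct (flat Is) \<and> set (flat Is) = I"
  using assms
proof (induction n arbitrary: I Is)
  case (Suc n)
  show ?case
  proof (cases Is)
    case (Cons A Is')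
    show ?thesis
    proof (cases "A \<subseteq> I")
      case True
      then have "finite A" "finite (I - A)" using Suc.prems finite_subset by blast+
      have "Is \<in> ordered_blocks m (Suc n) I \<longleftrightarrow>
          card A = m \<and> Is' \<in> ordered_blocks m n (I - A)"
        using True Cons by auto
      also have "\<dots> \<longleftrightarrow> card A = m \<and> length Is' = n \<and>
         (\<forall>A'\<in>set Is'. A' \<subseteq> I - A \<and> card A' = m) \<and>
         distinct (flat Is') \<and> set (flat Is') = I - A"
        using Suc.IH[OF \<open>finite (I - A)\<close>] by simp
      also have "\<dots> \<longleftrightarrow> length Is = Suc n \<and> (\<forall>A\<in>set Is. A \<subseteq> I \<and> card A = m) \<and>
         distinct (flat Is) \<and> set (flat Is) = I"
      proof -
        \<comment> \<open>Turns disjointness of words into disjointness of blocks: the letters of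
          \<open>flat Is'\<close> avoid \<open>A\<close>, and a later block consists of such
          letters.\<close>
        have "A' \<subseteq> set (flat Is')" if "A' \<in> set Is'" "A' \<subseteq> I" for A'
          using that finite_subset[OF _ Suc.prems] by (auto simp: flat_def)
        then show ?thesis
          using True Cons \<open>finite A\<close> by simp blast
      qed
      finally show ?thesis .
    qed (use Cons in auto)
  qed auto
qed auto

text \<open>Injectivity is checked directly; surjectivity follows by counting, as both sides have
  \<open>r!\<close> elements.\<close>

lemma bij_betw_permutes_permutations_of_set:
  assumes "inj_on f {1..r}"
  shows "bij_betw (\<lambda>\<sigma>. map (\<lambda>k. f (\<sigma> k)) [1..<Suc r]) {\<sigma>. \<sigma> permutes {1..r}}
    (permutations_of_set (f ` {1..r}))"
proof -
  let ?F = "\<lambda>\<sigma>. map (\<lambda>k. f (\<sigma> k)) [1..<Suc r]"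
  have inj: "inj_on ?F {\<sigma>. \<sigma> permutes {1..r}}"
  proof (rule inj_onI, rule ext)
    fix \<sigma> \<tau> :: "nat \<Rightarrow> nat" and k
    assume st: "\<sigma> \<in> {\<sigma>. \<sigma> permutes {1..r}}" "\<tau> \<in> {\<sigma>. \<sigma> permutes {1..r}}" "?F \<sigma> = ?F \<tau>"
    show "\<sigma> k = \<tau> k"
    proof (cases "k \<in> {1..r}")
      case True
      then have "f (\<sigma> k) = f (\<tau> k)" using st(3) by (auto simp: map_eq_conv)
      then show ?thesis
        using assms True st(1,2) by (auto dest!: inj_onD simp: permutes_in_image)
          (metis atLeastAtMost_iff permutes_in_image)+
    next
      case False
      then show ?thesis using st(1,2) permutes_not_in by (metis mem_Collect_eq)
    qed
  qed
  have sub: "?F ` {\<sigma>. \<sigma> permutes {1..r}} \<subseteq> permutations_of_set (f ` {1..r})"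
  proof clarify
    fix \<sigma> assume \<sigma>: "\<sigma> permutes {1..r}"
    have "inj_on (f \<circ> \<sigma>) {1..r}"
      using assms permutes_inj_on[OF \<sigma>] permutes_image[OF \<sigma>] by (intro comp_inj_on) auto
    moreover have "(\<lambda>k. f (\<sigma> k)) ` {1..r} = f ` {1..r}"
      using permutes_image[OF \<sigma>] by (metis image_image)
    ultimately show "?F \<sigma> \<in> permutations_of_set (f ` {1..r})"
      by (simp add: permutations_of_set_def distinct_map comp_def atLeastLessThanSuc_atLeastAtMost
          del: upt_Suc)
  qed
  have "card (?F ` {\<sigma>. \<sigma> permutes {1..r}}) = card (permutations_of_set (f ` {1..r}))"
    by (simp only: card_image[OF inj] card_image[OF assms] card_permutations[OF refl]
        card_permutations_of_set finite_imageI finite_atLeastAtMost)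
  then show ?thesis
    using inj card_subset_eq[OF _ sub] by (auto simp: bij_betw_def)
qed

lemma elt_strict_mono: "strict_mono_on {1..card I} (elt I)"
proof (rule strict_mono_onI)
  fix k l assume "k \<in> {1..card I}" "l \<in> {1..card I}" "k < l"
  then show "elt I k < elt I l"
    unfolding elt_def by (intro sorted_wrt_nth_less[OF strict_sorted_list_of_set]) auto
qed

lemma elt_image: "finite I \<Longrightarrow> elt I ` {1..card I} = I"
proof -
  assume "finite I"
  have "elt I ` {1..card I} = (\<lambda>k. sorted_list_of_set I ! k) ` {0..<card I}"
    unfolding elt_def by (force simp: image_iff intro: bexI[of _ "Suc _"])
  also have "\<dots> = set (sorted_list_of_set I)"
    by (auto simp: set_conv_nth)
  finally show ?thesis using \<open>finite I\<close> by simp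
qed

lemma map_elt: "map (elt I) [1..<Suc (card I)] = sorted_list_of_set I"
  by (rule nth_equalityI) (auto simp: elt_def simp del: upt_Suc)

lemma elt_interval: "k \<in> {1..N} \<Longrightarrow> elt {1..N} k = k"
proof -
  assume k: "k \<in> {1..N}"
  have "sorted_list_of_set {1..N} = [1..<Suc N]"
    using sorted_list_of_set.idem_if_sorted_distinct[OF sorted_upt distinct_upt, of 1 "Suc N"]
    by (simp add: atLeastLessThanSuc_atLeastAtMost del: upt_Suc)
  with k show ?thesis by (auto simp: elt_def simp del: upt_Suc)
qed

text \<open>\<open>elt I\<close> is increasing, so comparing \<open>\<sigma> k\<close> with
  \<open>\<sigma> l\<close> and comparing the letters single out the same inversions. The witnesses
  account for positions counted from 1 in \<open>Sfun\<close> and from 0 in lists.\<close>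

lemma Sfun_eq_inv_weight:
  assumes "\<sigma> permutes {1..card I}"
  shows "Sfun \<eta> \<sigma> I =
    inv_weight (\<lambda>a b. - hmero \<eta> a b) (map (\<lambda>k. elt I (\<sigma> k)) [1..<Suc (card I)])"
proof -
  let ?xs = "map (\<lambda>k. elt I (\<sigma> k)) [1..<Suc (card I)]"
  have less: "elt I (\<sigma> l) < elt I (\<sigma> k) \<longleftrightarrow> \<sigma> l < \<sigma> k"
    if "k \<in> {1..card I}" "l \<in> {1..card I}" for k l
    using strict_mono_on_less[OF elt_strict_mono, of "\<sigma> l" I "\<sigma> k"] that
      permutes_in_image[OF assms] by simp
  have "?xs \<in> permutations_of_set (elt I ` {1..card I})"
    using bij_betw_permutes_permutations_of_set[OF strict_mono_on_imp_inj_on[OF elt_strict_mono[of I]]]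
      assms unfolding bij_betw_def by blast
  then have "distinct ?xs" by (simp add: permutations_of_set_def)
  have nth: "?xs ! k = elt I (\<sigma> (Suc k))" if "k < card I" for k
    using that by (simp del: upt_Suc)
  show ?thesis
    unfolding inv_weight_eq_prod[OF \<open>distinct ?xs\<close>] Sfun_def
    by (rule prod.reindex_bij_witness[of _ "\<lambda>(k, l). (Suc k, Suc l)" "\<lambda>(k, l). (k - 1, l - 1)"])
       (auto simp: nth less simp del: upt_Suc)
qed

section \<open>Permutations that increase on blocks, and lists of blocks\<close>

lemma set_block_upt: "set [(k - 1) * m + 1..<Suc (k * m)] = blocks m k"
  by (simp add: blocks_def atLeastLessThanSuc_atLeastAtMost del: upt_Suc)

lemma concat_block_upts: "concat (map (\<lambda>k. [(k - 1) * m + 1..<Suc (k * m)]) [1..<Suc n]) = [1..<Suc (m * n)]"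
proof (induction n)
  case (Suc n)
  have "[1..<Suc (m * n)] @ [Suc (m * n)..<Suc (m * Suc n)] = [1..<Suc (m * Suc n)]"
    using upt_add_eq_append[of 1 "Suc (m * n)" m] by (simp add: add_ac del: upt_Suc)
  moreover have "[1..<Suc (Suc n)] = [1..<Suc n] @ [Suc n]"
    by simp
  ultimately show ?case
    using Suc by (simp add: mult.commute del: upt_Suc)
qed simp

lemma sorted_list_of_image_block:
  assumes "strict_mono_on (blocks m k) \<sigma>"
  shows "sorted_list_of_set (\<sigma> ` blocks m k) = map \<sigma> [(k - 1) * m + 1..<Suc (k * m)]"
proof -
  let ?xs = "[(k - 1) * m + 1..<Suc (k * m)]"
  have "sorted_wrt (<) (map \<sigma> ?xs)"
    unfolding sorted_wrt_map
    by (rule sorted_wrt_mono_rel[OF _ sorted_wrt_upt])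
       (use strict_mono_onD[OF assms] in \<open>simp only: set_block_upt\<close>)
  then show ?thesis
    using sorted_list_of_set.idem_if_sorted_distinct[of "map \<sigma> ?xs"]
    by (simp only: set_map set_block_upt strict_sorted_iff)
qed

lemma flat_image_blocks:
  assumes "\<forall>k\<in>{1..n}. strict_mono_on (blocks m k) \<sigma>"
  shows "flat (map (\<lambda>k. \<sigma> ` blocks m k) [1..<Suc n]) = map \<sigma> [1..<Suc (m * n)]"
proof -
  have "flat (map (\<lambda>k. \<sigma> ` blocks m k) [1..<Suc n]) =
      concat (map (\<lambda>k. map \<sigma> [(k - 1) * m + 1..<Suc (k * m)]) [1..<Suc n])"
    unfolding flat_def map_map comp_def
    by (rule arg_cong[of _ _ concat], rule map_cong[OF refl], rule sorted_list_of_image_block)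
       (use assms in \<open>auto simp del: upt_Suc\<close>)
  also have "\<dots> = map \<sigma> (concat (map (\<lambda>k. [(k - 1) * m + 1..<Suc (k * m)]) [1..<Suc n]))"
    by (simp add: map_concat comp_def del: upt_Suc)
  finally show ?thesis by (simp only: concat_block_upts)
qed

text \<open>Sorting each image block and concatenating gives back the one-line word of the
  permutation, hence injectivity. Conversely \<open>flat Is\<close> is the one-line word of some
  permutation, which increases on every block because each piece of \<open>flat Is\<close> is
  sorted.\<close>

lemma bij_betw_ordered_blocks:
  "bij_betw (\<lambda>\<sigma>. map (\<lambda>k. \<sigma> ` blocks m k) [1..<Suc n])
    {\<sigma>. \<sigma> permutes {1..m * n} \<and> (\<forall>k\<in>{1..n}. strict_mono_on (blocks m k) \<sigma>)}
    (ordered_blocks m n {1..m * n})" (is "bij_betw ?F ?P _")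
proof -
  have bij: "bij_betw (\<lambda>\<sigma>. map \<sigma> [1..<Suc (m * n)]) {\<sigma>. \<sigma> permutes {1..m * n}}
      (permutations_of_set {1..m * n})"
    using bij_betw_permutes_permutations_of_set[of "\<lambda>k. k" "m * n"] by simp
  show ?thesis
  proof (rule bij_betw_imageI)
    show "inj_on ?F ?P"
    proof (rule inj_onI)
      fix \<sigma> \<tau> assume st: "\<sigma> \<in> ?P" "\<tau> \<in> ?P" "?F \<sigma> = ?F \<tau>"
      then have "map \<sigma> [1..<Suc (m * n)] = map \<tau> [1..<Suc (m * n)]"
        using flat_image_blocks by (metis (no_types, lifting) mem_Collect_eq)
      then show "\<sigma> = \<tau>"
        using bij_betw_imp_inj_on[OF bij] st(1,2) by (auto dest: inj_onD)
    qed
    show "?F ` ?P = ordered_blocks m n {1..m * n}"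
    proof (intro equalityI subsetI)
      fix Is assume "Is \<in> ?F ` ?P"
      then obtain \<sigma> where \<sigma>: "Is = ?F \<sigma>" "\<sigma> permutes {1..m * n}"
        "\<forall>k\<in>{1..n}. strict_mono_on (blocks m k) \<sigma>" by blast
      have "flat Is \<in> permutations_of_set {1..m * n}"
        unfolding \<sigma>(1) flat_image_blocks[OF \<sigma>(3)] using bij_betwE[OF bij] \<sigma>(2) by blast
      moreover have "\<sigma> ` blocks m k \<subseteq> {1..m * n} \<and> card (\<sigma> ` blocks m k) = m" if "k \<in> {1..n}" for k
      proof -
        have "k * m \<le> m * n" using that by (simp add: mult.commute)
        then have "blocks m k \<subseteq> {1..m * n}" by (auto simp: blocks_def)
        moreover have "card (blocks m k) = m"
          using that by (cases k) (auto simp: blocks_def)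
        ultimately show ?thesis
          using \<sigma>(2) permutes_image[OF \<sigma>(2)] by (auto simp: card_image permutes_inj_on)
      qed
      ultimately show "Is \<in> ordered_blocks m n {1..m * n}"
        unfolding ordered_blocks_iff[OF finite_atLeastAtMost] \<sigma>(1)
        by (auto simp: permutations_of_set_def simp del: upt_Suc)
    next
      fix Is assume "Is \<in> ordered_blocks m n {1..m * n}"
      then have Is: "length Is = n" "\<forall>A\<in>set Is. A \<subseteq> {1..m * n} \<and> card A = m"
        "flat Is \<in> permutations_of_set {1..m * n}"
        by (auto simp: ordered_blocks_iff permutations_of_set_def)
      then obtain \<sigma> where \<sigma>: "\<sigma> permutes {1..m * n}" "map \<sigma> [1..<Suc (m * n)] = flat Is"
        using bij_betw_imp_surj_on[OF bij] by (metis (no_types, lifting) imageE mem_Collect_eq)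
      let ?b = "\<lambda>k. [(k - 1) * m + 1..<Suc (k * m)]"
      have "concat (map (\<lambda>k. map \<sigma> (?b k)) [1..<Suc n]) = concat (map sorted_list_of_set Is)"
        unfolding flat_def[symmetric] \<sigma>(2)[symmetric] concat_block_upts[symmetric]
        by (simp add: map_concat comp_def del: upt_Suc)
      \<comment> \<open>All pieces have length \<open>m\<close>, so equality of the concatenations
        forces equality piece by piece.\<close>
      moreover have "\<forall>(x, y)\<in>set (zip (map (\<lambda>k. map \<sigma> (?b k)) [1..<Suc n]) (map sorted_list_of_set Is)).
          length x = length y"
        using Is by (auto simp: set_zip simp del: upt_Suc)
      ultimately have eq: "map (\<lambda>k. map \<sigma> (?b k)) [1..<Suc n] = map sorted_list_of_set Is"
        using concat_eq_concat_iff[of "map (\<lambda>k. map \<sigma> (?b k)) [1..<Suc n]" "map sorted_list_of_set Is"] Is(1)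
        by (simp del: upt_Suc)
      have "?F \<sigma> = map set (map (\<lambda>k. map \<sigma> (?b k)) [1..<Suc n])"
        unfolding map_map comp_def set_map set_block_upt ..
      also have "\<dots> = map (\<lambda>A. A) Is"
        unfolding eq map_map comp_def
        using Is(2) by (intro map_cong refl set_sorted_list_of_set)
          (blast intro: finite_subset[OF _ finite_atLeastAtMost])
      finally have F: "?F \<sigma> = Is" by simp
      have "strict_mono_on (blocks m k) \<sigma>" if "k \<in> {1..n}" for k
      proof -
        have "map \<sigma> (?b k) \<in> set (map (\<lambda>k. map \<sigma> (?b k)) [1..<Suc n])"
          using that by (auto simp del: upt_Suc)
        then obtain A where A: "map \<sigma> (?b k) = sorted_list_of_set A"
          unfolding eq by auto
        have "sorted_wrt (\<lambda>x y. \<sigma> x < \<sigma> y) (?b k)"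
          using strict_sorted_list_of_set[of A] unfolding A[symmetric] sorted_wrt_map .
        then have "\<sigma> x < \<sigma> y" if "x < y" "x \<in> blocks m k" "y \<in> blocks m k" for x y
          using that sorted_wrt_nth_less[of "\<lambda>x y. \<sigma> x < \<sigma> y" "?b k" "x - ((k - 1) * m + 1)" "y - ((k - 1) * m + 1)"]
          by (auto simp: blocks_def simp del: upt_Suc)
        then show ?thesis by (intro strict_mono_onI)
      qed
      then show "Is \<in> ?F ` ?P" using \<sigma>(1) F by blast
    qed
  qed
qed

section \<open>Column exchange and Laplace expansion modulo a two-sided ideal\<close>

lemma take_nth_nth_drop:
  assumes "Suc p < length xs"
  shows "xs = take p xs @ xs ! p # xs ! Suc p # drop (p + 2) xs"
proof -
  have "xs ! p # xs ! Suc p # drop (p + 2) xs = drop p xs"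
    using assms by (simp add: Cons_nth_drop_Suc)
  then show ?thesis by (simp only: append_take_drop_id)
qed

text \<open>\<open>K\<close> is a two-sided ideal of a type-class ring; computing with congruences
  keeps \<open>sum\<close> and \<open>prod_list\<close> usable.\<close>

locale ring_congruence =
  fixes K :: "'a::ring_1 set"
  assumes zero_mem: "0 \<in> K"
    and diff_mem: "x \<in> K \<Longrightarrow> y \<in> K \<Longrightarrow> x - y \<in> K"
    and mult_left_mem: "x \<in> K \<Longrightarrow> a * x \<in> K"
    and mult_right_mem: "x \<in> K \<Longrightarrow> x * a \<in> K"
begin

definition cong :: "'a \<Rightarrow> 'a \<Rightarrow> bool" (infix "\<doteq>" 50) where
  "x \<doteq> y \<longleftrightarrow> x - y \<in> K"

lemma minus_mem: "x \<in> K \<Longrightarrow> - x \<in> K"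
  using diff_mem[OF zero_mem] by simp

lemma add_mem: "x \<in> K \<Longrightarrow> y \<in> K \<Longrightarrow> x + y \<in> K"
  using diff_mem[OF _ minus_mem] by simp

lemma cong_refl [simp, intro!]: "x \<doteq> x"
  by (simp add: cong_def zero_mem)

lemma cong_sym: "x \<doteq> y \<Longrightarrow> y \<doteq> x"
  unfolding cong_def using minus_mem by fastforce

lemma cong_trans [trans]: "x \<doteq> y \<Longrightarrow> y \<doteq> z \<Longrightarrow> x \<doteq> z"
  unfolding cong_def using add_mem by fastforce

lemma eq_cong_trans [trans]: "x = y \<Longrightarrow> y \<doteq> z \<Longrightarrow> x \<doteq> z"
  by simp

lemma cong_eq_trans [trans]: "x \<doteq> y \<Longrightarrow> y = z \<Longrightarrow> x \<doteq> z"
  by simp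

lemma cong_add: "x \<doteq> x' \<Longrightarrow> y \<doteq> y' \<Longrightarrow> x + y \<doteq> x' + y'"
  unfolding cong_def using add_mem by (fastforce simp: algebra_simps)

lemma cong_mult: "x \<doteq> x' \<Longrightarrow> y \<doteq> y' \<Longrightarrow> x * y \<doteq> x' * y'"
proof -
  assume "x \<doteq> x'" "y \<doteq> y'"
  then have "(x - x') * y + x' * (y - y') \<in> K"
    unfolding cong_def by (intro add_mem mult_left_mem mult_right_mem)
  then show ?thesis by (simp add: cong_def algebra_simps)
qed

lemma cong_mult_left: "x \<doteq> x' \<Longrightarrow> a * x \<doteq> a * x'"
  by (rule cong_mult) auto

lemma cong_mult_right: "x \<doteq> x' \<Longrightarrow> x * a \<doteq> x' * a"
  by (rule cong_mult) auto

lemma cong_sum: "(\<And>i. i \<in> A \<Longrightarrow> f i \<doteq> g i) \<Longrightarrow> sum f A \<doteq> sum g A"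
  by (induction A rule: infinite_finite_induct) (auto intro: cong_add)

end

definition word_prod :: "(nat \<Rightarrow> nat \<Rightarrow> 'a::monoid_mult) \<Rightarrow> nat list \<Rightarrow> nat list \<Rightarrow> 'a" where
  "word_prod T is js = prod_list (map2 T is js)"

text \<open>This is \<open>\<xi>(I, js)\<close>. The column word may be unsorted and may have
  repetitions, as happens when the columns of several blocks are concatenated.\<close>

definition qminor :: "('f::comm_monoid_mult \<Rightarrow> 'a::semiring_1) \<Rightarrow> (nat \<Rightarrow> nat \<Rightarrow> 'f) \<Rightarrow>
    (nat \<Rightarrow> nat \<Rightarrow> 'a) \<Rightarrow> nat set \<Rightarrow> nat list \<Rightarrow> 'a" where
  "qminor L H T I js = (\<Sum>is\<in>permutations_of_set I. L (inv_weight H is) * word_prod T is js)"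

lemma word_prod_append:
  "length is = length js \<Longrightarrow>
    word_prod T (is @ is') (js @ js') = word_prod T is js * word_prod T is' js'"
  by (simp add: word_prod_def)

lemma word_prod_simps [simp]:
  "word_prod T [] [] = 1" "word_prod T (i # is) (j # js) = T i j * word_prod T is js"
  by (simp_all add: word_prod_def)

text \<open>\<open>L\<close> and \<open>R\<close> abstract \<open>\<mu>\<^sub>l\<close> and
  \<open>\<mu>\<^sub>r\<close>, and \<open>H\<close> stands for \<open>-h\<close>. \<open>sh\<close>
  is the shift acquired by a function of \<open>\<lambda>\<close> that moves right past
  \<open>T i j\<close>; \<open>ush\<close> is the inverse shift, for a function of
  \<open>\<mu>\<close> that moves left. \<open>column_eq\<close> and \<open>column_swap\<close> are
  the two facts about 2 by 2 minors: vanishing for equal columns, and the factor caused by reversing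
  the columns.\<close>

locale dynamical_matrix = ring_congruence K for K :: "'a::ring_1 set" +
  fixes L R :: "'f::comm_ring_1 \<Rightarrow> 'a" and sh ush :: "nat \<Rightarrow> 'f \<Rightarrow> 'f"
    and H :: "nat \<Rightarrow> nat \<Rightarrow> 'f" and T :: "nat \<Rightarrow> nat \<Rightarrow> 'a" and X :: "nat set"
  assumes L_mult: "L (f * g) \<doteq> L f * L g" and L_one: "L 1 \<doteq> 1"
    and R_mult: "R (f * g) \<doteq> R f * R g" and R_one: "R 1 \<doteq> 1"
    and LR: "L f * R g \<doteq> R g * L f"
    and LT: "i \<in> X \<Longrightarrow> j \<in> X \<Longrightarrow> L f * T i j \<doteq> T i j * L (sh i f)"
    and TR: "i \<in> X \<Longrightarrow> j \<in> X \<Longrightarrow> T i j * R f \<doteq> R (ush j f) * T i j"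
    and sh_mult: "sh i (f * g) = sh i f * sh i g" and sh_one: "sh i 1 = 1"
    and sh_H: "i \<in> X \<Longrightarrow> x \<in> X \<Longrightarrow> y \<in> X \<Longrightarrow> i \<noteq> x \<Longrightarrow> i \<noteq> y \<Longrightarrow> x \<noteq> y \<Longrightarrow> sh i (H x y) = H x y"
    and ush_H: "i \<in> X \<Longrightarrow> x \<in> X \<Longrightarrow> y \<in> X \<Longrightarrow> i \<noteq> x \<Longrightarrow> i \<noteq> y \<Longrightarrow> x \<noteq> y \<Longrightarrow> ush i (H x y) = H x y"
    and column_eq: "i \<in> X \<Longrightarrow> j \<in> X \<Longrightarrow> k \<in> X \<Longrightarrow> i < j \<Longrightarrow>
      T i k * T j k + L (H j i) * T j k * T i k \<doteq> 0"
    and column_swap: "i \<in> X \<Longrightarrow> j \<in> X \<Longrightarrow> k \<in> X \<Longrightarrow> l \<in> X \<Longrightarrow> i < j \<Longrightarrow> k < l \<Longrightarrow>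
      T i l * T j k + L (H j i) * T j l * T i k \<doteq>
      R (H l k) * (T i k * T j l + L (H j i) * T j k * T i l)"
begin

abbreviation "tprod \<equiv> word_prod T"
abbreviation "xi \<equiv> qminor L H T"

definition fixed_by :: "nat set \<Rightarrow> 'f \<Rightarrow> bool" where
  "fixed_by A f \<longleftrightarrow> (\<forall>i\<in>A. sh i f = f)"

lemma fixed_by_mult: "fixed_by A f \<Longrightarrow> fixed_by A g \<Longrightarrow> fixed_by A (f * g)"
  by (simp add: fixed_by_def sh_mult)

lemma fixed_by_one: "fixed_by A 1"
  by (simp add: fixed_by_def sh_one)

lemma fixed_by_prod: "(\<And>b. b \<in> B \<Longrightarrow> fixed_by A (f b)) \<Longrightarrow> fixed_by A (prod f B)"
  by (induction B rule: infinite_finite_induct) (auto intro: fixed_by_mult fixed_by_one)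

lemma fixed_by_cross:
  "A \<subseteq> X \<Longrightarrow> B \<subseteq> X \<Longrightarrow> C \<subseteq> X \<Longrightarrow> C \<inter> (A \<union> B) = {} \<Longrightarrow> fixed_by C (cross H A B)"
  unfolding cross_def by (intro fixed_by_prod) (auto simp: fixed_by_def intro!: sh_H)

lemma fixed_by_inv_weight:
  "set xs \<subseteq> X \<Longrightarrow> C \<subseteq> X \<Longrightarrow> C \<inter> set xs = {} \<Longrightarrow> fixed_by C (inv_weight H xs)"
  by (induction xs) (auto intro!: fixed_by_mult fixed_by_cross fixed_by_one)

text \<open>A factor in row \<open>i\<close> shifts \<open>f\<close> by \<open>sh i\<close> whatever
  its column is, so invariance under the shifts of the rows of the word suffices.\<close>

lemma tprod_L:
  assumes "length is = length js" "set is \<subseteq> X" "set js \<subseteq> X" "fixed_by (set is) f"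
  shows "tprod is js * L f \<doteq> L f * tprod is js"
  using assms
proof (induction "is" js rule: list_induct2)
  case (Cons i "is" j js)
  have "T i j * tprod is js * L f \<doteq> T i j * (L f * tprod is js)"
    unfolding mult.assoc using Cons by (intro cong_mult_left) (auto simp: fixed_by_def)
  also have "\<dots> \<doteq> L f * T i j * tprod is js"
    unfolding mult.assoc[symmetric]
    using cong_sym[OF LT[of i j f]] Cons.prems by (intro cong_mult_right) (auto simp: fixed_by_def)
  finally show ?case by (simp add: mult.assoc)
qed simp

text \<open>The accumulated column shift is kept in the statement, since with repeated columns it
  can act nontrivially on the factor of an exchange.\<close>

lemma tprod_R:
  assumes "length is = length js" "set is \<subseteq> X" "set js \<subseteq> X"
  shows "tprod is js * R f \<doteq> R (foldr ush js f) * tprod is js"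
  using assms
proof (induction "is" js rule: list_induct2)
  case (Cons i "is" j js)
  have "T i j * tprod is js * R f \<doteq> T i j * (R (foldr ush js f) * tprod is js)"
    unfolding mult.assoc using Cons by (intro cong_mult_left) auto
  also have "\<dots> \<doteq> R (ush j (foldr ush js f)) * T i j * tprod is js"
    unfolding mult.assoc[symmetric] using TR Cons.prems by (intro cong_mult_right) auto
  finally show ?case by (simp add: mult.assoc)
qed simp

lemma foldr_ush_H:
  assumes "set js \<subseteq> X" "x \<in> X" "y \<in> X" "x \<noteq> y" "x \<notin> set js" "y \<notin> set js"
  shows "foldr ush js (H x y) = H x y"
  using assms by (induction js) (auto simp: ush_H)

text \<open>\<open>P\<close> lists the row words with an ascent at the positions of the two columns,
  cut open there. Each is combined with the word in which \<open>x\<close> and \<open>y\<close> are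
  exchanged, and the bracket is the 2 by 2 minor of the rows \<open>x < y\<close>. \<open>P\<close>
  is obtained before \<open>k\<close> and \<open>l\<close> are given, so one index set describes
  both orders of the columns.\<close>

lemma xi_pairing:
  assumes "finite I" "I \<subseteq> X" "set (as @ bs) \<subseteq> X"
    and len: "length as + length bs + 2 = card I"
  obtains P :: "(nat list \<times> nat \<times> nat \<times> nat list) set" where
    "\<And>us x y vs. (us, x, y, vs) \<in> P \<Longrightarrow> length us = length as \<and> set us \<subseteq> X \<and> x \<in> X \<and> y \<in> X \<and> x < y"
    "\<And>k l. xi I (as @ k # l # bs) \<doteq> (\<Sum>(us, x, y, vs)\<in>P.
        L (inv_weight H (us @ x # y # vs)) * tprod us as *
        (T x k * T y l + L (H y x) * T y k * T x l) * tprod vs bs)"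
proof -
  let ?p = "length as"
  let ?Q = "{xs \<in> permutations_of_set I. xs ! ?p < xs ! Suc ?p}"
  let ?split = "\<lambda>xs. (take ?p xs, xs ! ?p, xs ! Suc ?p, drop (?p + 2) xs)"
  have Q: "xs = take ?p xs @ xs ! ?p # xs ! Suc ?p # drop (?p + 2) xs" "length xs = card I"
    if "xs \<in> ?Q" for xs
  proof -
    show "length xs = card I"
      using that by (auto dest: length_finite_permutations_of_set)
    then show "xs = take ?p xs @ xs ! ?p # xs ! Suc ?p # drop (?p + 2) xs"
      using len by (intro take_nth_nth_drop) simp
  qed
  have inj: "inj_on ?split ?Q"
    by (rule inj_on_inverseI[where g = "\<lambda>(us, x, y, vs). us @ x # y # vs"])
       (use Q(1)[symmetric] in simp)
  have split_props: "length us = length as \<and> set us \<subseteq> X \<and> x \<in> X \<and> y \<in> X \<and> x < y \<and>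
      distinct (us @ x # y # vs) \<and> length vs = length bs"
    if mem: "(us, x, y, vs) \<in> ?split ` ?Q" for us x y vs
  proof -
    obtain xs where split: "(us, x, y, vs) = ?split xs" and xs: "xs \<in> ?Q"
      using mem by (rule imageE)
    then have "us @ x # y # vs = xs" using Q(1)[OF xs] split by simp
    moreover have "set xs \<subseteq> X" "distinct xs"
      using xs assms(2) by (auto simp: permutations_of_set_def)
    ultimately show ?thesis
      using xs split Q(2)[OF xs] len by (auto dest: in_set_takeD)
  qed
  show ?thesis
  proof (rule that[of "?split ` ?Q"])
    fix k l
    let ?js = "as @ k # l # bs"
    have "xi I ?js = (\<Sum>xs\<in>?Q. L (inv_weight H xs) * tprod xs ?js +
        L (inv_weight H (xs[?p := xs ! Suc ?p, Suc ?p := xs ! ?p])) *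
          tprod (xs[?p := xs ! Suc ?p, Suc ?p := xs ! ?p]) ?js)"
      unfolding qminor_def using assms by (intro sum_permutations_of_set_swap) auto
    also have "\<dots> = (\<Sum>(us, x, y, vs)\<in>?split ` ?Q.
        L (inv_weight H (us @ x # y # vs)) * tprod (us @ x # y # vs) ?js +
        L (inv_weight H (us @ y # x # vs)) * tprod (us @ y # x # vs) ?js)"
      unfolding sum.reindex[OF inj]
    proof (rule sum.cong[OF refl], unfold comp_def prod.case)
      fix xs assume xs: "xs \<in> ?Q"
      have "(us @ x # y # vs)[length us := y, Suc (length us) := x] = us @ y # x # vs"
        for us vs and x y :: nat
        by (simp add: list_update_append)
      moreover have "length (take ?p xs) = ?p"
        using Q(2)[OF xs] len by simp
      ultimately have swap: "xs[?p := xs ! Suc ?p, Suc ?p := xs ! ?p] =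
          take ?p xs @ xs ! Suc ?p # xs ! ?p # drop (?p + 2) xs"
        using Q(1)[OF xs, symmetric] by (metis (no_types))
      show "L (inv_weight H xs) * tprod xs ?js +
          L (inv_weight H (xs[?p := xs ! Suc ?p, Suc ?p := xs ! ?p])) *
            tprod (xs[?p := xs ! Suc ?p, Suc ?p := xs ! ?p]) ?js =
          L (inv_weight H (take ?p xs @ xs ! ?p # xs ! Suc ?p # drop (?p + 2) xs)) *
            tprod (take ?p xs @ xs ! ?p # xs ! Suc ?p # drop (?p + 2) xs) ?js +
          L (inv_weight H (take ?p xs @ xs ! Suc ?p # xs ! ?p # drop (?p + 2) xs)) *
            tprod (take ?p xs @ xs ! Suc ?p # xs ! ?p # drop (?p + 2) xs) ?js"
        by (simp only: swap Q(1)[OF xs, symmetric])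
    qed
    also have "\<dots> \<doteq> (\<Sum>(us, x, y, vs)\<in>?split ` ?Q.
        L (inv_weight H (us @ x # y # vs)) * tprod us as *
        (T x k * T y l + L (H y x) * T y k * T x l) * tprod vs bs)"
    proof (rule cong_sum, unfold split_paired_all prod.case)
      fix us x y vs assume "(us, x, y, vs) \<in> ?split ` ?Q"
      then have us: "length us = length as" "set us \<subseteq> X" "x \<in> X" "y \<in> X" "x < y"
          "distinct (us @ x # y # vs)" "length vs = length bs"
        using split_props[of us x y vs] by simp_all
      let ?w = "inv_weight H (us @ x # y # vs)"
      \<comment> \<open>The exchanged word has one more inversion; its factor \<open>H y x\<close>
        must be brought next to \<open>T y k\<close>.\<close>
      have "L (inv_weight H (us @ y # x # vs)) * tprod (us @ y # x # vs) ?js \<doteq>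
          L ?w * L (H y x) * (tprod us as * T y k * T x l * tprod vs bs)"
        using cong_mult_right[OF L_mult[of ?w "H y x"]]
        by (simp add: inv_weight_swap[OF us(6,5)] mult.commute[of "H y x"] word_prod_append us mult.assoc)
      also have "\<dots> \<doteq> L ?w * (tprod us as * L (H y x)) * (T y k * T x l * tprod vs bs)"
      proof -
        \<comment> \<open>The prefix \<open>us\<close> contains neither \<open>x\<close> nor
          \<open>y\<close>, so the factor passes it without a shift.\<close>
        have "fixed_by (set us) (H y x)"
          using us by (auto simp: fixed_by_def intro!: sh_H)
        then have "L (H y x) * tprod us as \<doteq> tprod us as * L (H y x)"
          using tprod_L[THEN cong_sym, of us as "H y x"] us assms(3) by simp
        from cong_mult_right[OF cong_mult_left[OF this]] show ?thesis
          by (simp add: mult.assoc)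
      qed
      finally have "L ?w * tprod (us @ x # y # vs) ?js +
          L (inv_weight H (us @ y # x # vs)) * tprod (us @ y # x # vs) ?js \<doteq>
          L ?w * tprod (us @ x # y # vs) ?js +
          L ?w * (tprod us as * L (H y x)) * (T y k * T x l * tprod vs bs)"
        by (intro cong_add) auto
      moreover have "L ?w * tprod us as * (T x k * T y l + L (H y x) * T y k * T x l) * tprod vs bs =
          L ?w * tprod (us @ x # y # vs) ?js +
          L ?w * (tprod us as * L (H y x)) * (T y k * T x l * tprod vs bs)"
        by (simp only: word_prod_append[OF us(1)] word_prod_simps distrib_left distrib_right mult.assoc)
      ultimately show "L ?w * tprod (us @ x # y # vs) ?js +
          L (inv_weight H (us @ y # x # vs)) * tprod (us @ y # x # vs) ?js \<doteq>
          L ?w * tprod us as * (T x k * T y l + L (H y x) * T y k * T x l) * tprod vs bs"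
        by (simp only:)
    qed
    finally show "xi I ?js \<doteq> (\<Sum>(us, x, y, vs)\<in>?split ` ?Q.
        L (inv_weight H (us @ x # y # vs)) * tprod us as *
        (T x k * T y l + L (H y x) * T y k * T x l) * tprod vs bs)" .
  next
    fix us x y vs assume "(us, x, y, vs) \<in> ?split ` ?Q"
    from split_props[OF this]
    show "length us = length as \<and> set us \<subseteq> X \<and> x \<in> X \<and> y \<in> X \<and> x < y" by simp
  qed
qed

text \<open>After the pairing every bracket is a 2 by 2 minor with equal columns.\<close>

lemma xi_adjacent_eq:
  assumes "finite I" "I \<subseteq> X" "set (as @ k # k # bs) \<subseteq> X" "length (as @ k # k # bs) = card I"
  shows "xi I (as @ k # k # bs) \<doteq> 0"
proof -
  obtain P where P: "\<And>us x y vs. (us, x, y, vs) \<in> P \<Longrightarrow>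
        length us = length as \<and> set us \<subseteq> X \<and> x \<in> X \<and> y \<in> X \<and> x < y"
    and xi: "\<And>k l. xi I (as @ k # l # bs) \<doteq> (\<Sum>(us, x, y, vs)\<in>P.
        L (inv_weight H (us @ x # y # vs)) * tprod us as *
        (T x k * T y l + L (H y x) * T y k * T x l) * tprod vs bs)"
    using xi_pairing[of I as bs] assms by auto
  have "xi I (as @ k # k # bs) \<doteq> (\<Sum>(us, x, y, vs)\<in>P.
        L (inv_weight H (us @ x # y # vs)) * tprod us as *
        (T x k * T y k + L (H y x) * T y k * T x k) * tprod vs bs)"
    using xi assms by simp
  also have "\<dots> \<doteq> (\<Sum>(us, x, y, vs)\<in>P.
        L (inv_weight H (us @ x # y # vs)) * tprod us as * 0 * tprod vs bs)"
    by (rule cong_sum, clarify)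
       (intro cong_mult_right cong_mult_left column_eq, use P assms in auto)
  finally show ?thesis by simp
qed

text \<open>\<open>R (H l k)\<close> arises behind the prefix in rows \<open>us\<close> and columns
  \<open>as\<close>. Pulling it to the left end shifts it by the columns \<open>as\<close>, and
  there it commutes with the row weight.\<close>

lemma xi_adjacent_swap:
  assumes "finite I" "I \<subseteq> X" "set (as @ k # l # bs) \<subseteq> X" "length (as @ k # l # bs) = card I"
    and "k < l"
  shows "xi I (as @ l # k # bs) \<doteq> R (foldr ush as (H l k)) * xi I (as @ k # l # bs)"
proof -
  let ?f = "foldr ush as (H l k)"
  let ?Q = "\<lambda>x y k l. T x k * T y l + L (H y x) * T y k * T x l"
  obtain P where P: "\<And>us x y vs. (us, x, y, vs) \<in> P \<Longrightarrow>
        length us = length as \<and> set us \<subseteq> X \<and> x \<in> X \<and> y \<in> X \<and> x < y"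
    and xi: "\<And>k l. xi I (as @ k # l # bs) \<doteq> (\<Sum>(us, x, y, vs)\<in>P.
        L (inv_weight H (us @ x # y # vs)) * tprod us as * ?Q x y k l * tprod vs bs)"
    using xi_pairing[of I as bs] assms by auto
  have "xi I (as @ l # k # bs) \<doteq> (\<Sum>(us, x, y, vs)\<in>P.
        L (inv_weight H (us @ x # y # vs)) * tprod us as * ?Q x y l k * tprod vs bs)"
    using xi assms by simp
  also have "\<dots> \<doteq> (\<Sum>(us, x, y, vs)\<in>P. R ?f * (
        L (inv_weight H (us @ x # y # vs)) * tprod us as * ?Q x y k l * tprod vs bs))"
  proof (rule cong_sum, clarify)
    fix us x y vs assume "(us, x, y, vs) \<in> P"
    then have us: "length us = length as" "set us \<subseteq> X" "x \<in> X" "y \<in> X" "x < y"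
      using P by blast+
    let ?w = "L (inv_weight H (us @ x # y # vs))"
    have "?w * tprod us as * ?Q x y l k * tprod vs bs \<doteq>
        ?w * tprod us as * (R (H l k) * ?Q x y k l) * tprod vs bs"
      by (intro cong_mult_right cong_mult_left column_swap) (use us assms in auto)
    also have "\<dots> = ?w * (tprod us as * R (H l k)) * (?Q x y k l * tprod vs bs)"
      by (simp add: mult.assoc)
    also have "\<dots> \<doteq> ?w * (R ?f * tprod us as) * (?Q x y k l * tprod vs bs)"
      by (intro cong_mult_right cong_mult_left tprod_R) (use us assms in auto)
    also have "\<dots> = (?w * R ?f) * (tprod us as * ?Q x y k l * tprod vs bs)"
      by (simp only: mult.assoc)
    also have "\<dots> \<doteq> (R ?f * ?w) * (tprod us as * ?Q x y k l * tprod vs bs)"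
      by (intro cong_mult_right LR)
    finally show "?w * tprod us as * ?Q x y l k * tprod vs bs \<doteq>
        R ?f * (?w * tprod us as * ?Q x y k l * tprod vs bs)"
      by (simp only: mult.assoc)
  qed
  also have "\<dots> = R ?f * (\<Sum>(us, x, y, vs)\<in>P.
        L (inv_weight H (us @ x # y # vs)) * tprod us as * ?Q x y k l * tprod vs bs)"
    by (simp add: sum_distrib_left case_prod_unfold)
  also have "\<dots> \<doteq> R ?f * xi I (as @ k # l # bs)"
    by (intro cong_mult_left cong_sym[OF xi])
  finally show ?thesis .
qed

text \<open>Sorting by adjacent exchanges: exchanging a descent makes the column word
  lexicographically smaller at the same length, so the induction runs along
  \<open>lex less_than\<close>. Each exchange contributes the factor of the inversion it
  removes.\<close>

lemma xi_sort:
  assumes "finite I" "I \<subseteq> X" "set js \<subseteq> X" "length js = card I"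
  shows "(if distinct js then xi I js \<doteq> R (inv_weight H js) * xi I (sort js) else xi I js \<doteq> 0)"
  using assms(3,4)
proof (induction js rule: wf_induct_rule[OF wf_lex[OF wf_less_than]])
  case (1 js)
  show ?case
  proof (cases "sorted js")
    case True
    show ?thesis
    proof (cases "distinct js")
      case True
      have "R (inv_weight H js) * xi I js \<doteq> 1 * xi I js"
        using \<open>sorted js\<close> by (intro cong_mult_right) (simp add: inv_weight_sorted R_one)
      then show ?thesis
        using True \<open>sorted js\<close> cong_sym by (simp add: sorted_sort_id)
    next
      case False
      \<comment> \<open>A sorted word with a repetition has two equal neighbours, so its minor
        vanishes.\<close>
      then have "\<not> sorted_wrt (<) js"
        by (simp add: strict_sorted_iff)
      then obtain p where p: "Suc p < length js" "\<not> js ! p < js ! Suc p"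
        by (auto simp: sorted_wrt_iff_nth_Suc_transp)
      then have "js ! p = js ! Suc p"
        using sorted_nth_mono[OF True, of p "Suc p"] by simp
      moreover have "js = take p js @ js ! p # js ! Suc p # drop (p + 2) js"
        using p(1) by (rule take_nth_nth_drop)
      ultimately have "js = take p js @ js ! p # js ! p # drop (p + 2) js"
        by metis
      then show ?thesis
        using xi_adjacent_eq[of I "take p js" "js ! p" "drop (p + 2) js"] assms(1,2) 1(2,3) False
        by simp
    qed
  next
    case False
    then obtain p where p: "Suc p < length js" "js ! Suc p < js ! p"
      by (auto simp: sorted_iff_nth_Suc not_le)
    define as bs where "as = take p js" and "bs = drop (p + 2) js"
    define k l where "k = js ! Suc p" and "l = js ! p"
    note as_bs_k_l_def = as_def bs_def k_def l_def
    have js: "js = as @ l # k # bs"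
      unfolding as_bs_k_l_def using p(1) by (rule take_nth_nth_drop)
    have "k < l" using p(2) by (simp add: as_bs_k_l_def)
    let ?js = "as @ k # l # bs"
    have lex: "(?js, js) \<in> lex less_than"
      unfolding js using \<open>k < l\<close> by (intro lex_append_leftI) simp
    have IH: "if distinct ?js then xi I ?js \<doteq> R (inv_weight H ?js) * xi I (sort ?js) else xi I ?js \<doteq> 0"
      by (rule 1(1)[OF lex]) (use 1(2,3) js in auto)
    have swap: "xi I js \<doteq> R (foldr ush as (H l k)) * xi I ?js"
      unfolding js by (rule xi_adjacent_swap) (use assms(1,2) 1(2,3) js \<open>k < l\<close> in auto)
    show ?thesis
    proof (cases "distinct js")
      case True
      \<comment> \<open>Distinct columns: \<open>as\<close> contains neither \<open>k\<close> nor
        \<open>l\<close>, so the shift along the prefix is trivial.\<close>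
      have "foldr ush as (H l k) = H l k"
        by (rule foldr_ush_H) (use True 1(2) js in auto)
      then have "xi I js \<doteq> R (H l k) * xi I ?js" using swap by simp
      also have "\<dots> \<doteq> R (H l k) * (R (inv_weight H ?js) * xi I (sort ?js))"
        using IH True js by (intro cong_mult_left) (auto split: if_splits)
      also have "\<dots> = R (H l k) * R (inv_weight H ?js) * xi I (sort ?js)"
        by (simp add: mult.assoc)
      also have "\<dots> \<doteq> R (H l k * inv_weight H ?js) * xi I (sort ?js)"
        by (intro cong_mult_right cong_sym[OF R_mult])
      also have "H l k * inv_weight H ?js = inv_weight H js"
        unfolding js using True js \<open>k < l\<close> by (intro inv_weight_swap[symmetric]) auto
      also have "sort ?js = sort js"
        unfolding js by (rule properties_for_sort) auto
      finally show ?thesis using True by simp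
    next
      case False
      then have "xi I ?js \<doteq> 0" using IH js by (auto split: if_splits)
      \<comment> \<open>With repeated columns the prefix may contain \<open>k\<close> or
        \<open>l\<close>; the shifted factor stays unevaluated because it multiplies
        \<open>0\<close>.\<close>
      then have "xi I js \<doteq> R (foldr ush as (H l k)) * 0"
        using swap cong_trans cong_mult_left by blast
      then show ?thesis using False by simp
    qed
  qed
qed

section \<open>Laplace expansion along blocks of rows\<close>

lemma xi_L:
  assumes "finite A" "A \<subseteq> X" "set js \<subseteq> X" "length js = card A" "fixed_by A f"
  shows "xi A js * L f \<doteq> L f * xi A js"
  unfolding qminor_def sum_distrib_left sum_distrib_right
proof (rule cong_sum)
  fix xs assume "xs \<in> permutations_of_set A"
  then have xs: "set xs = A" "length xs = card A"
    by (auto simp: permutations_of_set_def distinct_card)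
  let ?w = "inv_weight H xs"
  have "L ?w * tprod xs js * L f \<doteq> L ?w * (L f * tprod xs js)"
    unfolding mult.assoc by (intro cong_mult_left tprod_L) (use xs assms in auto)
  also have "\<dots> = L ?w * L f * tprod xs js"
    by (simp add: mult.assoc)
  also have "\<dots> \<doteq> L f * L ?w * tprod xs js"
    by (intro cong_mult_right) (metis L_mult cong_sym cong_trans mult.commute)
  finally show "L ?w * tprod xs js * L f \<doteq> L f * (L ?w * tprod xs js)"
    by (simp add: mult.assoc)
qed

text \<open>Cut each row word after \<open>length js\<close> letters. Its weight is the product of a
  cross term and the weights of the two pieces. The weight of the second piece is fixed by the
  shifts in the rows \<open>A\<close>, so it passes the generators of the first piece and completes
  the second minor.\<close>

lemma laplace:
  assumes "finite I" "I \<subseteq> X" "set js \<subseteq> X" "set ks \<subseteq> X" "length js + length ks = card I"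
  shows "xi I (js @ ks) \<doteq> (\<Sum>A | A \<subseteq> I \<and> card A = length js.
    L (cross H A (I - A)) * (xi A js * xi (I - A) ks))"
proof -
  have "xi I (js @ ks) = (\<Sum>A | A \<subseteq> I \<and> card A = length js. \<Sum>ys\<in>permutations_of_set A.
      \<Sum>zs\<in>permutations_of_set (I - A). L (inv_weight H (ys @ zs)) * tprod (ys @ zs) (js @ ks))"
    unfolding qminor_def by (rule sum_permutations_of_set_split) (use assms in auto)
  also have "\<dots> \<doteq> (\<Sum>A | A \<subseteq> I \<and> card A = length js. \<Sum>ys\<in>permutations_of_set A.
      \<Sum>zs\<in>permutations_of_set (I - A). L (cross H A (I - A)) *
        ((L (inv_weight H ys) * tprod ys js) * (L (inv_weight H zs) * tprod zs ks)))"
  proof (intro cong_sum, clarify)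
    fix A ys zs assume A: "A \<subseteq> I" "card A = length js"
      and "ys \<in> permutations_of_set A" "zs \<in> permutations_of_set (I - A)"
    then have ys: "set ys = A" "distinct ys" and zs: "set zs = I - A" "distinct zs"
      by (auto simp: permutations_of_set_def)
    have len: "length ys = length js"
      using distinct_card[OF ys(2)] ys(1) A by simp
    have "L (inv_weight H (ys @ zs)) = L (cross H A (I - A) * (inv_weight H ys * inv_weight H zs))"
      using inv_weight_append[of ys zs H] ys zs by (simp add: mult_ac)
    also have "\<dots> \<doteq> L (cross H A (I - A)) * (L (inv_weight H ys) * L (inv_weight H zs))"
      using L_mult cong_mult_left cong_trans by blast
    finally have "L (inv_weight H (ys @ zs)) * tprod (ys @ zs) (js @ ks) \<doteq>
        L (cross H A (I - A)) * (L (inv_weight H ys) * L (inv_weight H zs)) * tprod (ys @ zs) (js @ ks)"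
      by (rule cong_mult_right)
    also have "\<dots> = L (cross H A (I - A)) * L (inv_weight H ys) *
        (L (inv_weight H zs) * tprod ys js) * tprod zs ks"
      by (simp add: word_prod_append[OF len] mult.assoc)
    also have "\<dots> \<doteq> L (cross H A (I - A)) * L (inv_weight H ys) *
        (tprod ys js * L (inv_weight H zs)) * tprod zs ks"
      by (intro cong_mult_right cong_mult_left cong_sym[OF tprod_L] fixed_by_inv_weight)
         (use len assms A ys zs in auto)
    finally show "L (inv_weight H (ys @ zs)) * tprod (ys @ zs) (js @ ks) \<doteq>
        L (cross H A (I - A)) *
        ((L (inv_weight H ys) * tprod ys js) * (L (inv_weight H zs) * tprod zs ks))"
      by (simp add: mult.assoc)
  qed
  also have "\<dots> = (\<Sum>A | A \<subseteq> I \<and> card A = length js.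
      L (cross H A (I - A)) * (xi A js * xi (I - A) ks))"
    by (simp only: qminor_def sum_product) (simp only: sum_distrib_left)
  finally show ?thesis .
qed

text \<open>The column words stay fixed while the rows are distributed over them in all ways, so the
  sum is the iterated expansion of one minor with concatenated columns. In the induction the first
  row block, being sorted, has weight \<open>1\<close>, and the weight of the later blocks moves
  past its minor by \<open>xi_L\<close>.\<close>

lemma laplace_blocks:
  assumes "finite I" "I \<subseteq> X" "card I = m * n" "length Js = n"
    and "\<forall>js\<in>set Js. length js = m \<and> set js \<subseteq> X"
  shows "(\<Sum>Is\<in>ordered_blocks m n I. L (inv_weight H (flat Is)) * prod_list (map2 xi Is Js))
    \<doteq> xi I (concat Js)"
  using assms
proof (induction n arbitrary: I Js)
  case 0
  then show ?case by (simp add: qminor_def)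
next
  case (Suc n)
  then obtain js Js' where Js: "Js = js # Js'" by (cases Js) auto
  have js: "length js = m" "set js \<subseteq> X" "length Js' = n" "\<forall>js\<in>set Js'. length js = m \<and> set js \<subseteq> X"
    using Suc.prems Js by auto
  have fin: "finite A" "finite (I - A)" "card (I - A) = m * n"
    if "A \<subseteq> I" "card A = m" for A
    using that Suc.prems by (auto intro: finite_subset simp: card_Diff_subset[OF finite_subset])
  let ?S = "\<lambda>I. \<Sum>Is\<in>ordered_blocks m n I. L (inv_weight H (flat Is)) * prod_list (map2 xi Is Js')"
  have "(\<Sum>Is\<in>ordered_blocks m (Suc n) I. L (inv_weight H (flat Is)) * prod_list (map2 xi Is Js)) =
      (\<Sum>A | A \<subseteq> I \<and> card A = m. \<Sum>Is\<in>ordered_blocks m n (I - A).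
        L (inv_weight H (sorted_list_of_set A @ flat Is)) * (xi A js * prod_list (map2 xi Is Js')))"
    by (subst sum_ordered_blocks_Suc[OF Suc.prems(1)]) (simp add: Js)
  also have "\<dots> \<doteq> (\<Sum>A | A \<subseteq> I \<and> card A = m. \<Sum>Is\<in>ordered_blocks m n (I - A).
        L (cross H A (I - A)) * (xi A js * (L (inv_weight H (flat Is)) * prod_list (map2 xi Is Js'))))"
  proof (intro cong_sum, clarify)
    fix A Is assume A: "A \<subseteq> I" "m = card A" and Is: "Is \<in> ordered_blocks (card A) n (I - A)"
    then have flat: "distinct (flat Is)" "set (flat Is) = I - A"
      using ordered_blocks_iff[OF fin(2), of A] by auto
    have "inv_weight H (sorted_list_of_set A @ flat Is) = inv_weight H (flat Is) * cross H A (I - A)"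
      using flat fin[OF A(1)] A(2) by (subst inv_weight_append) (auto simp: inv_weight_sorted)
    then have "L (inv_weight H (sorted_list_of_set A @ flat Is)) \<doteq>
        L (cross H A (I - A)) * L (inv_weight H (flat Is))"
      using L_mult[of "cross H A (I - A)" "inv_weight H (flat Is)"] by (simp add: mult.commute)
    from cong_mult_right[OF this]
    have "L (inv_weight H (sorted_list_of_set A @ flat Is)) * (xi A js * prod_list (map2 xi Is Js'))
       \<doteq> L (cross H A (I - A)) * (L (inv_weight H (flat Is)) * xi A js) * prod_list (map2 xi Is Js')"
      by (simp add: mult.assoc)
    also have "\<dots> \<doteq> L (cross H A (I - A)) * (xi A js * L (inv_weight H (flat Is))) * prod_list (map2 xi Is Js')"
    proof -
      have "fixed_by A (inv_weight H (flat Is))"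
        by (rule fixed_by_inv_weight) (use flat(2) A(1) Suc.prems(2) in auto)
      then have "xi A js * L (inv_weight H (flat Is)) \<doteq> L (inv_weight H (flat Is)) * xi A js"
        by (intro xi_L) (use fin(1)[OF A(1)] A Suc.prems(2) js(1,2) in auto)
      from cong_mult_right[OF cong_mult_left[OF cong_sym[OF this]]] show ?thesis .
    qed
    finally show "L (inv_weight H (sorted_list_of_set A @ flat Is)) * (xi A js * prod_list (map2 xi Is Js'))
       \<doteq> L (cross H A (I - A)) * (xi A js * (L (inv_weight H (flat Is)) * prod_list (map2 xi Is Js')))"
      by (simp add: mult.assoc)
  qed
  also have "\<dots> = (\<Sum>A | A \<subseteq> I \<and> card A = m. L (cross H A (I - A)) * (xi A js * ?S (I - A)))"
    by (simp only: sum_distrib_left)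
  also have "\<dots> \<doteq> (\<Sum>A | A \<subseteq> I \<and> card A = m. L (cross H A (I - A)) * (xi A js * xi (I - A) (concat Js')))"
  proof (intro cong_sum cong_mult_left)
    fix A assume "A \<in> {A. A \<subseteq> I \<and> card A = m}"
    then show "?S (I - A) \<doteq> xi (I - A) (concat Js')"
      using Suc.prems(2) fin[of A] js by (intro Suc.IH) blast+
  qed
  also have "\<dots> \<doteq> xi I (js @ concat Js')"
  proof -
    have "length (concat Js') = m * n"
      using js(3,4) by (induction Js' arbitrary: n) auto
    moreover have "set (concat Js') \<subseteq> X"
      using js(4) by auto
    ultimately have "xi I (js @ concat Js') \<doteq> (\<Sum>A | A \<subseteq> I \<and> card A = length js.
        L (cross H A (I - A)) * (xi A js * xi (I - A) (concat Js')))"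
      using Suc.prems(1-3) js(1,2) by (intro laplace) simp_all
    from cong_sym[OF this] show ?thesis
      unfolding js(1) .
  qed
  finally show ?case by (simp add: Js)
qed

end

section \<open>Presented algebras and their tensor product\<close>

lemma ring_free_algebra: "ring (free_algebra G)"
proof (intro ringI abelian_groupI monoidI)
  fix x y assume x: "x \<in> carrier (free_algebra G)" and y: "y \<in> carrier (free_algebra G)"
  have "set w \<subseteq> G" if w: "w \<in> Poly_Mapping.keys (x * y)" for w
  proof -
    obtain u v where "w = u @ v" "u \<in> Poly_Mapping.keys x" "v \<in> Poly_Mapping.keys y"
      using w keys_mult[of x y] unfolding plus_list_def by blast
    then show ?thesis using x y by (simp add: free_algebra_def)
  qed
  then show "x \<otimes>\<^bsub>free_algebra G\<^esub> y \<in> carrier (free_algebra G)"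
    by (simp add: free_algebra_def)
  show "x \<oplus>\<^bsub>free_algebra G\<^esub> y \<in> carrier (free_algebra G)"
    using x y Poly_Mapping.keys_add[of x y] unfolding free_algebra_def by auto
next
  fix x assume "x \<in> carrier (free_algebra G)"
  then show "\<exists>y\<in>carrier (free_algebra G). y \<oplus>\<^bsub>free_algebra G\<^esub> x = \<zero>\<^bsub>free_algebra G\<^esub>"
    by (intro bexI[of _ "- x"]) (auto simp: free_algebra_def)
qed (auto simp: free_algebra_def zero_list_def algebra_simps)

locale presentation =
  fixes G :: "'g set" and rel :: "'g free_alg \<Rightarrow> 'g free_alg \<Rightarrow> bool"
  assumes rel_carrier: "rel x y \<Longrightarrow> x - y \<in> carrier (free_algebra G)"
begin

abbreviation "F \<equiv> free_algebra G"
abbreviation "K \<equiv> rel_ideal G rel"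
abbreviation "P \<equiv> presented G rel"
abbreviation "cls \<equiv> pclass G rel"

sublocale F: ring F by (rule ring_free_algebra)

lemma F_simps: "x \<otimes>\<^bsub>F\<^esub> y = x * y" "x \<oplus>\<^bsub>F\<^esub> y = x + y" "\<one>\<^bsub>F\<^esub> = 1" "\<zero>\<^bsub>F\<^esub> = 0"
  by (simp_all add: free_algebra_def)

lemma F_closed:
  "x \<in> carrier F \<Longrightarrow> y \<in> carrier F \<Longrightarrow> x * y \<in> carrier F"
  "x \<in> carrier F \<Longrightarrow> y \<in> carrier F \<Longrightarrow> x + y \<in> carrier F"
  "1 \<in> carrier F" "0 \<in> carrier F"
  using F.m_closed[of x y] F.a_closed[of x y] F.one_closed F.zero_closed
  unfolding F_simps by blast+

lemma gen_closed: "g \<in> G \<Longrightarrow> gen g \<in> carrier F"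
  by (simp add: free_algebra_def gen_def)

lemma scal_closed: "scal c \<in> carrier F"
  by (simp add: free_algebra_def scal_def)

lemma F_minus: "x \<in> carrier F \<Longrightarrow> y \<in> carrier F \<Longrightarrow> x \<ominus>\<^bsub>F\<^esub> y = x - y"
proof -
  assume x: "x \<in> carrier F" and y: "y \<in> carrier F"
  have "- y \<in> carrier F" using y by (simp add: free_algebra_def)
  then have "\<ominus>\<^bsub>F\<^esub> y = - y" using y F.minus_equality[of "- y" y] by (simp add: F_simps)
  then show ?thesis by (simp add: a_minus_def F_simps)
qed

sublocale K: ideal K F
  unfolding rel_ideal_def by (rule F.genideal_ideal) (auto intro: rel_carrier)

lemma rel_mem: "rel x y \<Longrightarrow> x - y \<in> K"
  using F.genideal_self[of "{x - y | x y. rel x y}"] rel_carrier unfolding rel_ideal_def by auto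

lemma presented_simps:
  "carrier P = carrier (F Quot K)" "mult P = mult (F Quot K)" "one P = one (F Quot K)"
  "zero P = zero (F Quot K)" "add P = add (F Quot K)"
  "smult P = (\<lambda>c x. cls (scal c) \<otimes>\<^bsub>F Quot K\<^esub> x)"
  by (simp_all add: presented_def Let_def ring.defs module.defs)

text \<open>\<open>P\<close> and the quotient ring are records of different types with equal ring
  operations, so the axioms are transferred one at a time.\<close>

sublocale P: ring P
proof -
  interpret Q: ring "F Quot K" by (rule K.quotient_is_ring)
  show "ring P"
    by (intro ringI abelian_groupI monoidI)
       (auto simp: presented_simps Q.a_ac Q.m_assoc Q.l_distr Q.r_distr intro: Q.add.l_inv_ex)
qed

lemma cls_hom: "cls \<in> ring_hom F P"
  using K.rcos_ring_hom unfolding pclass_def[abs_def] ring_hom_def by (simp add: presented_simps)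

lemma cls_closed [simp, intro]: "x \<in> carrier F \<Longrightarrow> cls x \<in> carrier P"
  using ring_hom_closed[OF cls_hom] .

lemma cls_mult: "x \<in> carrier F \<Longrightarrow> y \<in> carrier F \<Longrightarrow> cls (x * y) = cls x \<otimes>\<^bsub>P\<^esub> cls y"
  using ring_hom_mult[OF cls_hom] by (simp add: F_simps)

lemma cls_add: "x \<in> carrier F \<Longrightarrow> y \<in> carrier F \<Longrightarrow> cls (x + y) = cls x \<oplus>\<^bsub>P\<^esub> cls y"
  using ring_hom_add[OF cls_hom] by (simp add: F_simps)

lemma cls_one: "cls 1 = \<one>\<^bsub>P\<^esub>"
  using ring_hom_one[OF cls_hom] by (simp add: F_simps)

lemma cls_zero: "cls 0 = \<zero>\<^bsub>P\<^esub>"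
  using ring_hom_zero[OF cls_hom F.ring_axioms P.ring_axioms] by (simp add: F_simps)

lemma cls_eqI: "x \<in> carrier F \<Longrightarrow> y \<in> carrier F \<Longrightarrow> x - y \<in> K \<Longrightarrow> cls x = cls y"
  using F.quotient_eq_iff_same_a_r_cos[OF K.ideal_axioms, of x y]
  by (simp add: F_minus pclass_def)

lemma cls_rel: "rel x y \<Longrightarrow> x \<in> carrier F \<Longrightarrow> y \<in> carrier F \<Longrightarrow> cls x = cls y"
  by (intro cls_eqI rel_mem)

lemma cls_sum:
  assumes "\<And>i. i \<in> A \<Longrightarrow> f i \<in> carrier F"
  shows "cls (sum f A) = (\<Oplus>\<^bsub>P\<^esub>i\<in>A. cls (f i))" and "sum f A \<in> carrier F"
proof -
  have "cls (sum f A) = (\<Oplus>\<^bsub>P\<^esub>i\<in>A. cls (f i)) \<and> sum f A \<in> carrier F"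
    using assms
    by (induction A rule: infinite_finite_induct) (auto simp: cls_zero cls_add F_closed Pi_iff)
  then show "cls (sum f A) = (\<Oplus>\<^bsub>P\<^esub>i\<in>A. cls (f i))" "sum f A \<in> carrier F" by auto
qed

lemma cls_prod_list:
  assumes "\<And>i. i \<in> set xs \<Longrightarrow> f i \<in> carrier F"
  shows "cls (prod_list (map f xs)) = lprod P (map (\<lambda>i. cls (f i)) xs)"
    and "prod_list (map f xs) \<in> carrier F"
proof -
  have "cls (prod_list (map f xs)) = lprod P (map (\<lambda>i. cls (f i)) xs) \<and>
      prod_list (map f xs) \<in> carrier F"
    using assms by (induction xs) (auto simp: lprod_def cls_one cls_mult F_closed)
  then show "cls (prod_list (map f xs)) = lprod P (map (\<lambda>i. cls (f i)) xs)"
    "prod_list (map f xs) \<in> carrier F" by auto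
qed

lemma smult_closed: "x \<in> carrier P \<Longrightarrow> c \<odot>\<^bsub>P\<^esub> x \<in> carrier P"
  using P.m_closed[OF cls_closed[OF scal_closed]] by (simp add: presented_simps)

end

lemma poly_mapping_supported_induct [consumes 1, case_names zero add]:
  assumes "Poly_Mapping.keys x \<subseteq> S" and "P 0"
    and "\<And>k c y. k \<in> S \<Longrightarrow> P y \<Longrightarrow> P (Poly_Mapping.single k c + y)"
  shows "P (x :: 'k \<Rightarrow>\<^sub>0 'c::comm_monoid_add)"
proof -
  have "x = (\<Sum>k\<in>Poly_Mapping.keys x. Poly_Mapping.single k (Poly_Mapping.lookup x k))"
    by (rule poly_mapping_eqI)
       (auto simp: lookup_sum lookup_single when_def in_keys_iff sum.delta)
  moreover have "P (\<Sum>k\<in>A. Poly_Mapping.single k (Poly_Mapping.lookup x k))"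
    if "finite A" "A \<subseteq> S" for A
    using that by (induction A) (auto intro: assms(2,3))
  ultimately show ?thesis using assms(1) by (metis finite_keys)
qed

section \<open>The tensor product as a ring\<close>

locale tensor_pair =
  A: ring A + B: ring B for A :: "(complex, 'a) module" (structure) and B :: "(complex, 'b) module" +
  assumes smult_A: "x \<in> carrier A \<Longrightarrow> c \<odot>\<^bsub>A\<^esub> x \<in> carrier A"
    and smult_B: "y \<in> carrier B \<Longrightarrow> c \<odot>\<^bsub>B\<^esub> y \<in> carrier B"
begin

abbreviation "R \<equiv> pair_algebra A B"
abbreviation "pm \<equiv> mult R"
abbreviation "I \<equiv> genideal R (bilinear_rels A B)"
abbreviation "AB \<equiv> tensor A B"
abbreviation tns (infix "\<otimes>\<otimes>" 70) where "tns \<equiv> tens A B"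

text \<open>Cancellation can shrink the support of a sum. Summing over a common finite superset of
  the supports gives several products the same index set, and additivity becomes termwise.\<close>

lemma pm_superset:
  assumes "finite S" "Poly_Mapping.keys x \<subseteq> S" "finite T" "Poly_Mapping.keys y \<subseteq> T"
  shows "pm x y = (\<Sum>p\<in>S. \<Sum>r\<in>T. Poly_Mapping.single
    (fst p \<otimes>\<^bsub>A\<^esub> fst r, snd p \<otimes>\<^bsub>B\<^esub> snd r) (Poly_Mapping.lookup x p * Poly_Mapping.lookup y r))"
proof -
  have "pm x y = (\<Sum>p\<in>Poly_Mapping.keys x. \<Sum>r\<in>Poly_Mapping.keys y. Poly_Mapping.single
    (fst p \<otimes>\<^bsub>A\<^esub> fst r, snd p \<otimes>\<^bsub>B\<^esub> snd r) (Poly_Mapping.lookup x p * Poly_Mapping.lookup y r))"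
    by (simp add: pair_algebra_def case_prod_unfold)
  also have "\<dots> = (\<Sum>p\<in>Poly_Mapping.keys x. \<Sum>r\<in>T. Poly_Mapping.single
    (fst p \<otimes>\<^bsub>A\<^esub> fst r, snd p \<otimes>\<^bsub>B\<^esub> snd r) (Poly_Mapping.lookup x p * Poly_Mapping.lookup y r))"
    by (intro sum.cong refl sum.mono_neutral_left assms) (auto simp: in_keys_iff)
  also have "\<dots> = (\<Sum>p\<in>S. \<Sum>r\<in>T. Poly_Mapping.single
    (fst p \<otimes>\<^bsub>A\<^esub> fst r, snd p \<otimes>\<^bsub>B\<^esub> snd r) (Poly_Mapping.lookup x p * Poly_Mapping.lookup y r))"
    by (intro sum.mono_neutral_left assms) (auto simp: in_keys_iff)
  finally show ?thesis .
qed

lemma pm_add_left: "pm (x + x') y = pm x y + pm x' y"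
proof -
  let ?S = "Poly_Mapping.keys x \<union> Poly_Mapping.keys x'"
  have S: "finite ?S" "Poly_Mapping.keys (x + x') \<subseteq> ?S"
    using Poly_Mapping.keys_add[of x x'] by auto
  show ?thesis
    using pm_superset[OF S finite_keys order_refl, of y]
      pm_superset[OF S(1) Un_upper1 finite_keys order_refl, of y]
      pm_superset[OF S(1) Un_upper2 finite_keys order_refl, of y]
    by (simp add: lookup_add distrib_right single_add sum.distrib)
qed

lemma pm_add_right: "pm y (x + x') = pm y x + pm y x'"
proof -
  let ?S = "Poly_Mapping.keys x \<union> Poly_Mapping.keys x'"
  have S: "finite ?S" "Poly_Mapping.keys (x + x') \<subseteq> ?S"
    using Poly_Mapping.keys_add[of x x'] by auto
  show ?thesis
    using pm_superset[OF finite_keys order_refl S, of y]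
      pm_superset[OF finite_keys order_refl S(1) Un_upper1, of y]
      pm_superset[OF finite_keys order_refl S(1) Un_upper2, of y]
    by (simp add: lookup_add distrib_left single_add sum.distrib)
qed

lemma pm_zero: "pm 0 y = 0" "pm y 0 = 0"
  by (simp_all add: pair_algebra_def)

lemma pm_single:
  "pm (Poly_Mapping.single (a, b) c) (Poly_Mapping.single (a', b') d) =
    Poly_Mapping.single (a \<otimes>\<^bsub>A\<^esub> a', b \<otimes>\<^bsub>B\<^esub> b') (c * d)"
  by (subst pm_superset[of "{(a, b)}" _ "{(a', b')}"]) auto

lemma R_simps:
  "carrier R = {x. Poly_Mapping.keys x \<subseteq> carrier A \<times> carrier B}"
  "x \<oplus>\<^bsub>R\<^esub> y = x + y" "\<zero>\<^bsub>R\<^esub> = 0" "\<one>\<^bsub>R\<^esub> = Poly_Mapping.single (\<one>\<^bsub>A\<^esub>, \<one>\<^bsub>B\<^esub>) 1"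
  by (simp_all add: pair_algebra_def)

lemma R_add_closed: "x \<in> carrier R \<Longrightarrow> y \<in> carrier R \<Longrightarrow> x + y \<in> carrier R"
  using Poly_Mapping.keys_add[of x y] by (auto simp: R_simps)

lemma R_single_closed:
  "a \<in> carrier A \<Longrightarrow> b \<in> carrier B \<Longrightarrow> Poly_Mapping.single (a, b) c \<in> carrier R"
  by (auto simp: R_simps)

lemma R_induct [consumes 1, case_names zero add]:
  assumes "x \<in> carrier R" "P 0"
    and "\<And>a b c y. a \<in> carrier A \<Longrightarrow> b \<in> carrier B \<Longrightarrow> P y \<Longrightarrow> P (Poly_Mapping.single (a, b) c + y)"
  shows "P x"
  using assms poly_mapping_supported_induct[of x "carrier A \<times> carrier B" P] by (auto simp: R_simps)

text \<open>Closure, associativity and the unit laws are reduced to single symbols by additivity,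
  one argument at a time.\<close>

sublocale R: ring R
proof (intro ringI abelian_groupI monoidI)
  fix x y assume x: "x \<in> carrier R" and y: "y \<in> carrier R"
  have zero: "0 \<in> carrier R" by (simp add: R_simps)
  have single: "pm (Poly_Mapping.single (a, b) c) y \<in> carrier R"
    if "a \<in> carrier A" "b \<in> carrier B" for a b c
    using y by (induction rule: R_induct)
      (auto simp: pm_zero pm_add_right pm_single zero that intro!: R_add_closed R_single_closed)
  show "x \<otimes>\<^bsub>R\<^esub> y \<in> carrier R"
    using x by (induction rule: R_induct)
      (auto simp: pm_zero pm_add_left zero single intro!: R_add_closed)
  show "x \<oplus>\<^bsub>R\<^esub> y \<in> carrier R"
    using x y by (simp add: R_add_closed R_simps(2))
next
  fix x y z assume x: "x \<in> carrier R" and y: "y \<in> carrier R" and z: "z \<in> carrier R"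
  have 1: "pm (pm (Poly_Mapping.single (a, b) c) (Poly_Mapping.single (a', b') c')) z =
      pm (Poly_Mapping.single (a, b) c) (pm (Poly_Mapping.single (a', b') c') z)"
    if "a \<in> carrier A" "b \<in> carrier B" "a' \<in> carrier A" "b' \<in> carrier B" for a b c a' b' c'
    using z by (induction rule: R_induct)
      (auto simp: pm_zero pm_add_right pm_single that A.m_assoc B.m_assoc mult.assoc)
  have 2: "pm (pm (Poly_Mapping.single (a, b) c) y) z = pm (Poly_Mapping.single (a, b) c) (pm y z)"
    if "a \<in> carrier A" "b \<in> carrier B" for a b c
    using y by (induction rule: R_induct) (auto simp: pm_zero pm_add_right pm_add_left 1 that)
  show "pm (pm x y) z = pm x (pm y z)"
    using x by (induction rule: R_induct) (auto simp: pm_zero pm_add_left 2)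
  show "(x \<oplus>\<^bsub>R\<^esub> y) \<otimes>\<^bsub>R\<^esub> z = x \<otimes>\<^bsub>R\<^esub> z \<oplus>\<^bsub>R\<^esub> y \<otimes>\<^bsub>R\<^esub> z"
    and "z \<otimes>\<^bsub>R\<^esub> (x \<oplus>\<^bsub>R\<^esub> y) = z \<otimes>\<^bsub>R\<^esub> x \<oplus>\<^bsub>R\<^esub> z \<otimes>\<^bsub>R\<^esub> y"
    by (simp_all add: R_simps pm_add_left pm_add_right)
next
  fix x assume x: "x \<in> carrier R"
  show "\<one>\<^bsub>R\<^esub> \<otimes>\<^bsub>R\<^esub> x = x" "x \<otimes>\<^bsub>R\<^esub> \<one>\<^bsub>R\<^esub> = x"
    using x unfolding R_simps(4)
    by (induction rule: R_induct) (auto simp: pm_zero pm_add_right pm_add_left pm_single)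
  show "\<exists>y\<in>carrier R. y \<oplus>\<^bsub>R\<^esub> x = \<zero>\<^bsub>R\<^esub>"
    using x by (intro bexI[of _ "- x"]) (auto simp: R_simps)
qed (auto simp: R_simps add_ac)

lemma diff_closed: "x \<in> carrier R \<Longrightarrow> y \<in> carrier R \<Longrightarrow> x - y \<in> carrier R"
  using R_add_closed[of x "- y"] by (simp add: R_simps)

lemma R_minus: "x \<in> carrier R \<Longrightarrow> y \<in> carrier R \<Longrightarrow> x \<ominus>\<^bsub>R\<^esub> y = x - y"
proof -
  assume x: "x \<in> carrier R" and y: "y \<in> carrier R"
  have "- y \<in> carrier R" using y by (simp add: R_simps)
  then have "\<ominus>\<^bsub>R\<^esub> y = - y" using y R.minus_equality[of "- y" y] by (simp add: R_simps)
  then show ?thesis by (simp add: a_minus_def R_simps)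
qed

lemma bilinear_rels_closed: "bilinear_rels A B \<subseteq> carrier R"
  unfolding bilinear_rels_def Let_def
  by (auto intro!: diff_closed R_single_closed smult_A smult_B)

sublocale I: ideal I R
  by (rule R.genideal_ideal) (rule bilinear_rels_closed)

sublocale AB: ring AB
  unfolding tensor_def by (rule I.quotient_is_ring)

lemma coset_hom: "(+>\<^bsub>R\<^esub>) I \<in> ring_hom R AB"
  unfolding tensor_def by (rule I.rcos_ring_hom)

lemma tens_closed [simp, intro]: "a \<in> carrier A \<Longrightarrow> b \<in> carrier B \<Longrightarrow> a \<otimes>\<otimes> b \<in> carrier AB"
  unfolding tens_def by (intro ring_hom_closed[OF coset_hom] R_single_closed)

lemma tens_mult:
  assumes "a \<in> carrier A" "b \<in> carrier B" "a' \<in> carrier A" "b' \<in> carrier B"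
  shows "(a \<otimes>\<^bsub>A\<^esub> a') \<otimes>\<otimes> (b \<otimes>\<^bsub>B\<^esub> b') = (a \<otimes>\<otimes> b) \<otimes>\<^bsub>AB\<^esub> (a' \<otimes>\<otimes> b')"
  using ring_hom_mult[OF coset_hom R_single_closed R_single_closed, of a b a' b' 1 1] assms
  by (simp add: tens_def pm_single)

lemma tens_one: "\<one>\<^bsub>A\<^esub> \<otimes>\<otimes> \<one>\<^bsub>B\<^esub> = \<one>\<^bsub>AB\<^esub>"
  using ring_hom_one[OF coset_hom] by (simp add: tens_def R_simps)

lemma coset_eq_add:
  assumes "x - y - z \<in> bilinear_rels A B" "x \<in> carrier R" "y \<in> carrier R" "z \<in> carrier R"
  shows "I +>\<^bsub>R\<^esub> x = (I +>\<^bsub>R\<^esub> y) \<oplus>\<^bsub>AB\<^esub> (I +>\<^bsub>R\<^esub> z)"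
proof -
  have "x \<ominus>\<^bsub>R\<^esub> (y \<oplus>\<^bsub>R\<^esub> z) \<in> I"
    using R.genideal_self[OF bilinear_rels_closed] assms
    by (auto simp: R_minus R_add_closed R_simps(2) diff_diff_eq)
  then have "I +>\<^bsub>R\<^esub> x = I +>\<^bsub>R\<^esub> (y \<oplus>\<^bsub>R\<^esub> z)"
    using R.quotient_eq_iff_same_a_r_cos[OF I.ideal_axioms, of x "y \<oplus>\<^bsub>R\<^esub> z"] assms by simp
  then show ?thesis using ring_hom_add[OF coset_hom] assms by simp
qed

lemma tens_add_left:
  assumes "a \<in> carrier A" "a' \<in> carrier A" "b \<in> carrier B"
  shows "(a \<oplus>\<^bsub>A\<^esub> a') \<otimes>\<otimes> b = (a \<otimes>\<otimes> b) \<oplus>\<^bsub>AB\<^esub> (a' \<otimes>\<otimes> b)"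
  unfolding tens_def using assms
  by (intro coset_eq_add R_single_closed) (auto simp: bilinear_rels_def Let_def)

lemma tens_add_right:
  assumes "a \<in> carrier A" "b \<in> carrier B" "b' \<in> carrier B"
  shows "a \<otimes>\<otimes> (b \<oplus>\<^bsub>B\<^esub> b') = (a \<otimes>\<otimes> b) \<oplus>\<^bsub>AB\<^esub> (a \<otimes>\<otimes> b')"
  unfolding tens_def using assms
  by (intro coset_eq_add R_single_closed) (auto simp: bilinear_rels_def Let_def)

lemma tens_zero_left: "b \<in> carrier B \<Longrightarrow> \<zero>\<^bsub>A\<^esub> \<otimes>\<otimes> b = \<zero>\<^bsub>AB\<^esub>"
  using tens_add_left[of "\<zero>\<^bsub>A\<^esub>" "\<zero>\<^bsub>A\<^esub>" b] AB.add.l_cancel_one[of "\<zero>\<^bsub>A\<^esub> \<otimes>\<otimes> b" "\<zero>\<^bsub>A\<^esub> \<otimes>\<otimes> b"] by simp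

lemma tens_zero_right: "a \<in> carrier A \<Longrightarrow> a \<otimes>\<otimes> \<zero>\<^bsub>B\<^esub> = \<zero>\<^bsub>AB\<^esub>"
  using tens_add_right[of a "\<zero>\<^bsub>B\<^esub>" "\<zero>\<^bsub>B\<^esub>"] AB.add.l_cancel_one[of "a \<otimes>\<otimes> \<zero>\<^bsub>B\<^esub>" "a \<otimes>\<otimes> \<zero>\<^bsub>B\<^esub>"] by simp

lemma tens_finsum_left:
  assumes "f \<in> S \<rightarrow> carrier A" "b \<in> carrier B"
  shows "(\<Oplus>\<^bsub>A\<^esub>i\<in>S. f i) \<otimes>\<otimes> b = (\<Oplus>\<^bsub>AB\<^esub>i\<in>S. f i \<otimes>\<otimes> b)"
  using assms
proof (induction S rule: infinite_finite_induct)
  case (insert i S)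
  then have "f i \<in> carrier A" "f \<in> S \<rightarrow> carrier A" by auto
  then show ?case using insert by (simp add: tens_add_left Pi_iff)
qed (auto simp: tens_zero_left)

lemma tens_finsum_right:
  assumes "f \<in> S \<rightarrow> carrier B" "a \<in> carrier A"
  shows "a \<otimes>\<otimes> (\<Oplus>\<^bsub>B\<^esub>i\<in>S. f i) = (\<Oplus>\<^bsub>AB\<^esub>i\<in>S. a \<otimes>\<otimes> f i)"
  using assms
proof (induction S rule: infinite_finite_induct)
  case (insert i S)
  then have "f i \<in> carrier B" "f \<in> S \<rightarrow> carrier B" by auto
  then show ?case using insert by (simp add: tens_add_right Pi_iff)
qed (auto simp: tens_zero_right)

end

section \<open>Shifts of meromorphic functions\<close>

lemma mero_const_one: "mero_const 1 = 1"
  by transfer (rule mero_eq_refl[OF mero_fun_const])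

lemma mero_const_minus_one_mult: "mero_const (- 1) * f = - f"
proof -
  have "mero_const (- 1) = (- 1 :: 'a mero)"
    by transfer (rule mero_eq_refl[OF mero_fun_const])
  then show ?thesis by simp
qed

lemma mero_shift_mult: "mero_shift a (f * g) = mero_shift a f * mero_shift a g"
  by transfer (auto simp: mero_eq_def intro!: mero_fun_shift mero_fun_mult exI[of _ UNIV])

lemma mero_shift_uminus: "mero_shift a (- f) = - mero_shift a f"
  by transfer (auto simp: mero_eq_def intro!: mero_fun_shift mero_fun_uminus exI[of _ UNIV])

lemma mero_shift_one: "mero_shift a 1 = 1"
  by transfer (rule mero_eq_refl[OF mero_fun_const])

lemma mero_shift_minus_cancel: "mero_shift a (mero_shift (- a) f) = f"
  by transfer (auto simp: mero_eq_def intro!: mero_fun_shift exI[of _ UNIV])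

lemma coord_eq_iff:
  "i \<in> {1..CARD('N)} \<Longrightarrow> j \<in> {1..CARD('N)} \<Longrightarrow> (coord i :: 'N::finite) = coord j \<longleftrightarrow> i = j"
  using bij_betw_coord by (auto simp: bij_betw_def dest: inj_onD)

text \<open>The function involves only the coordinates \<open>x\<close> and \<open>y\<close>. The
  conditions \<open>\<eta> \<noteq> 0\<close> and \<open>x \<noteq> y\<close> guarantee a
  meromorphic representative, so that \<open>abs_mero\<close> can be evaluated.\<close>

lemma mero_shift_hmero:
  assumes "\<eta> \<noteq> 0" "x \<in> {1..CARD('N::finite)}" "y \<in> {1..CARD('N)}" "x \<noteq> y"
    and "a $ coord x = 0" "a $ coord y = (0 :: complex)"
  shows "mero_shift a (hmero \<eta> x y) = (hmero \<eta> x y :: 'N mero)"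
proof -
  have "mero_fun (\<lambda>z :: complex^'N. hfun \<eta> (z $ coord x - z $ coord y))"
    using assms by (intro mero_fun_hfun) (auto simp: coord_eq_iff)
  from mero_eq_refl[OF this] show ?thesis
    unfolding hmero_def by (simp add: mero_shift.abs_eq assms(5,6))
qed

text \<open>The witness is the coordinate function \<open>\<lambda>\<^sub>j\<close>. Its shift
  differs from it by exactly \<open>1\<close>, so a relation identifying \<open>f\<close> with its
  shift next to some \<open>t\<close> yields \<open>t \<otimes> 1 = 0\<close>.\<close>

lemma coordinate_mero:
  obtains f :: "'N::finite mero" where "mero_shift (omega j) f = f + 1"
proof -
  have "holo_on (\<lambda>z :: complex^'N. z $ coord j) UNIV"
    unfolding holo_on_def
    by (intro ballI exI[of _ "\<lambda>v. v $ coord j"])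
       (auto intro: bounded_linear_imp_has_derivative[OF bounded_linear_vec_nth])
  then have mero: "mero_fun (\<lambda>z :: complex^'N. z $ coord j)" by (rule mero_fun_holo)
  have one: "mero_eq (\<lambda>_. 1) (\<lambda>_ :: complex^'N. 1)"
    by (rule mero_eq_refl[OF mero_fun_const])
  have "mero_shift (omega j) (abs_mero (\<lambda>z :: complex^'N. z $ coord j)) =
      abs_mero (\<lambda>z. z $ coord j) + 1"
    unfolding mero_shift.abs_eq[OF mero_eq_refl[OF mero]] one_mero_def
      plus_mero.abs_eq[OF mero_eq_refl[OF mero] one]
    by (simp add: omega_def axis_def)
  then show ?thesis by (rule that)
qed

section \<open>The dynamical hyper-Pfaffian\<close>

lemma (in abelian_monoid) finsum_cartesian:
  assumes "finite S" "finite T" "f \<in> S \<times> T \<rightarrow> carrier G"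
  shows "finsum G f (S \<times> T) = (\<Oplus>i\<in>S. \<Oplus>j\<in>T. f (i, j))"
  using assms(1,3)
proof (induction S)
  case (insert i S)
  have closed: "(\<Oplus>j\<in>T. f (k, j)) \<in> carrier G" if "k \<in> insert i S" for k
    using insert.prems that by (intro finsum_closed) auto
  have "insert i S \<times> T = Pair i ` T \<union> S \<times> T" by auto
  then have "finsum G f (insert i S \<times> T) = finsum G f (Pair i ` T) \<oplus> finsum G f (S \<times> T)"
    using insert assms(2) by (simp only:) (rule finsum_Un_disjoint, auto)
  also have "finsum G f (Pair i ` T) = (\<Oplus>j\<in>T. f (i, j))"
    using insert.prems by (intro finsum_reindex) (auto simp: inj_on_def)
  also have "finsum G f (S \<times> T) = (\<Oplus>i\<in>S. \<Oplus>j\<in>T. f (i, j))"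
    using insert by (intro insert.IH) auto
  finally show ?case
    using insert closed by (subst finsum_insert) auto
qed simp

lemma (in abelian_monoid) finsum_swap:
  assumes "finite S" "finite T" "\<And>i j. i \<in> S \<Longrightarrow> j \<in> T \<Longrightarrow> f i j \<in> carrier G"
  shows "(\<Oplus>i\<in>S. \<Oplus>j\<in>T. f i j) = (\<Oplus>j\<in>T. \<Oplus>i\<in>S. f i j)"
proof -
  have "(\<Oplus>i\<in>S. \<Oplus>j\<in>T. f i j) = finsum G (\<lambda>(i, j). f i j) (S \<times> T)"
    using assms by (subst finsum_cartesian) auto
  also have "S \<times> T = prod.swap ` (T \<times> S)" by auto
  also have "finsum G (\<lambda>(i, j). f i j) (prod.swap ` (T \<times> S)) = finsum G (\<lambda>(j, i). f i j) (T \<times> S)"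
    using assms by (subst finsum_reindex) (auto simp: inj_on_def case_prod_unfold)
  also have "\<dots> = (\<Oplus>j\<in>T. \<Oplus>i\<in>S. f i j)"
    using assms by (subst finsum_cartesian) auto
  finally show ?thesis .
qed

lemma (in abelian_monoid) finsum_reindex_bij_betw:
  assumes "bij_betw h S T" "g \<in> T \<rightarrow> carrier G"
  shows "(\<Oplus>x\<in>S. g (h x)) = finsum G g T"
  using assms finsum_reindex[of g h S] by (auto simp: bij_betw_def)

lemma (in abelian_group) finsum_minus:
  assumes "f \<in> S \<rightarrow> carrier G" "g \<in> S \<rightarrow> carrier G"
  shows "finsum G f S \<ominus> finsum G g S = (\<Oplus>i\<in>S. f i \<ominus> g i)"
  using assms
proof (induction S rule: infinite_finite_induct)
  case (insert i S)
  then have "f i \<in> carrier G" "g i \<in> carrier G" "finsum G f S \<in> carrier G" "finsum G g S \<in> carrier G"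
    by auto
  moreover have "(f i \<oplus> finsum G f S) \<ominus> (g i \<oplus> finsum G g S) =
      (f i \<ominus> g i) \<oplus> (finsum G f S \<ominus> finsum G g S)"
    using calculation by (simp add: a_minus_def minus_add a_ac)
  ultimately show ?case using insert by (simp add: Pi_iff)
qed (auto simp: r_neg a_minus_def)

context ring
begin

lemma lprod_simps [simp]: "lprod R [] = \<one>" "lprod R (x # xs) = x \<otimes> lprod R xs"
  by (simp_all add: lprod_def)

lemma lprod_closed: "set xs \<subseteq> carrier R \<Longrightarrow> lprod R xs \<in> carrier R"
  by (induction xs) auto

end

lemma card_msubsets: "I \<in> msubsets m n \<Longrightarrow> I \<subseteq> {1..m * n} \<and> finite I \<and> card I = m"
  by (auto simp: msubsets_def intro: finite_subset)

lemma finite_msubsets: "finite (msubsets m n)"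
  by (rule finite_subset[of _ "Pow {1..m * n}"]) (auto simp: msubsets_def)

lemma ordered_blocks_msubsets:
  "Is \<in> ordered_blocks m n {1..m * n} \<Longrightarrow> set Is \<subseteq> msubsets m n \<and> length Is = n"
  by (auto simp: ordered_blocks_iff msubsets_def)

text \<open>Counting: \<open>n\<close> blocks of size \<open>m\<close> form a word of length
  \<open>m * n\<close>, so distinct letters exhaust \<open>{1..m * n}\<close>.\<close>

lemma ordered_blocks_iff_distinct:
  assumes "set Is \<subseteq> msubsets m n" "length Is = n"
  shows "Is \<in> ordered_blocks m n {1..m * n} \<longleftrightarrow> distinct (flat Is)"
proof -
  have "\<forall>I\<in>set Is. card I = m"
    using assms(1) by (auto simp: msubsets_def)
  then have "length (flat Is) = m * length Is"
    by (induction Is) auto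
  then have "length (flat Is) = m * n"
    using assms(2) by simp
  then have "card (set (flat Is)) = m * n" if "distinct (flat Is)"
    using distinct_card[OF that] by simp
  moreover have "set (flat Is) \<subseteq> {1..m * n}"
    using assms card_msubsets by (fastforce simp: flat_def)
  ultimately have "set (flat Is) = {1..m * n}" if "distinct (flat Is)"
    using that card_subset_eq[of "{1..m * n}" "set (flat Is)"] by auto
  then show ?thesis
    using assms by (auto simp: ordered_blocks_iff msubsets_def)
qed

abbreviation neg_h :: "complex \<Rightarrow> nat \<Rightarrow> nat \<Rightarrow> 'N::finite mero" where
  "neg_h \<eta> \<equiv> \<lambda>i j. - hmero \<eta> i j"

text \<open>Stated for an arbitrary ring because it is applied to the algebra of the
  \<open>b\<close>, to the tensor product and to its quotient by the two-sided ideal.\<close>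

lemma (in ring) Pf_eq_ordered_blocks:
  fixes \<iota> :: "'N::finite mero \<Rightarrow> 'a"
  assumes "\<And>f. \<iota> f \<in> carrier R" "\<And>I. I \<in> msubsets m n \<Longrightarrow> x I \<in> carrier R"
  shows "Pf R \<iota> \<eta> m n x = (\<Oplus>Is\<in>ordered_blocks m n {1..m * n}.
    \<iota> (inv_weight (neg_h \<eta>) (flat Is)) \<otimes> lprod R (map x Is))"
proof -
  let ?F = "\<lambda>\<sigma>. map (\<lambda>k. \<sigma> ` blocks m k) [1..<Suc n]"
  let ?P = "{\<sigma>. \<sigma> permutes {1..m * n} \<and> (\<forall>k\<in>{1..n}. strict_mono_on (blocks m k) \<sigma>)}"
  let ?g = "\<lambda>Is. \<iota> (inv_weight (neg_h \<eta>) (flat Is)) \<otimes> lprod R (map x Is)"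
  have g: "?g Is \<in> carrier R" if "Is \<in> ordered_blocks m n {1..m * n}" for Is
  proof -
    have "set (map x Is) \<subseteq> carrier R"
      using assms(2) ordered_blocks_msubsets[OF that] unfolding set_map by blast
    then show ?thesis using assms(1) lprod_closed by blast
  qed
  have "Sfun \<eta> \<sigma> {1..m * n} = inv_weight (neg_h \<eta> :: nat \<Rightarrow> nat \<Rightarrow> 'N mero) (flat (?F \<sigma>))"
    if "\<sigma> \<in> ?P" for \<sigma>
  proof -
    have \<sigma>: "\<sigma> permutes {1..m * n}" using that by simp
    have elt: "map (\<lambda>k. elt {1..m * n} (\<sigma> k)) [1..<Suc (m * n)] = map \<sigma> [1..<Suc (m * n)]"
      using permutes_in_image[OF \<sigma>] by (intro map_cong refl elt_interval) (auto simp del: upt_Suc)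
    have flat: "flat (?F \<sigma>) = map \<sigma> [1..<Suc (m * n)]"
      using that by (intro flat_image_blocks) simp
    show ?thesis
      using Sfun_eq_inv_weight[of \<sigma> "{1..m * n}" \<eta>] \<sigma>
      unfolding flat card_atLeastAtMost diff_Suc_1 elt by simp
  qed
  then have eq: "\<iota> (Sfun \<eta> \<sigma> {1..m * n}) \<otimes> lprod R (map (\<lambda>k. x (\<sigma> ` blocks m k)) [1..<Suc n]) =
      ?g (?F \<sigma>)" if "\<sigma> \<in> ?P" for \<sigma>
    using that by (simp add: comp_def del: upt_Suc)
  have "?g (?F \<sigma>) \<in> carrier R" if "\<sigma> \<in> ?P" for \<sigma>
    using g bij_betwE[OF bij_betw_ordered_blocks, of m n] that by blast
  then have "Pf R \<iota> \<eta> m n x = (\<Oplus>\<sigma>\<in>?P. ?g (?F \<sigma>))"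
    unfolding Pf_def by (intro finsum_cong' refl eq) blast+
  also have "\<dots> = (\<Oplus>Is\<in>ordered_blocks m n {1..m * n}. ?g Is)"
    using g by (intro finsum_reindex_bij_betw[OF bij_betw_ordered_blocks]) auto
  finally show ?thesis .
qed

lemma carrier_free_algebra_UNIV [simp]: "carrier (free_algebra UNIV) = UNIV"
  by (simp add: free_algebra_def)

lemma ring_congruence_rel_ideal: "ring_congruence (rel_ideal UNIV rel)"
proof -
  interpret presentation UNIV rel by standard simp
  have minus: "x - y = x \<ominus>\<^bsub>F\<^esub> y" for x y by (simp add: F_minus)
  show ?thesis
  proof
    show "0 \<in> K" using K.zero_closed by (simp add: F_simps)
    show "x \<in> K \<Longrightarrow> y \<in> K \<Longrightarrow> x - y \<in> K" for x y
      unfolding minus by (simp add: a_minus_def K.a_closed K.a_inv_closed)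
    show "x \<in> K \<Longrightarrow> a * x \<in> K" "x \<in> K \<Longrightarrow> x * a \<in> K" for x a
      using K.I_l_closed[of x a] K.I_r_closed[of x a] by (simp_all add: F_simps)
  qed
qed

lemma scal_simps: "scal 1 = 1" "scal (- 1) = - 1"
  by (simp_all add: scal_def single_uminus zero_list_def[symmetric])

text \<open>\<open>rel\<close> may be any set of relations containing \<open>fr_rel\<close>, so
  these facts serve both \<open>fr_rel\<close> and \<open>fr_minor_rel\<close>.\<close>

locale dynamical_tensor =
  fixes rel :: "'N::finite fr_rels" and \<eta> :: complex and m n :: nat
  assumes eta: "\<eta> \<noteq> 0" and m_pos: "m \<ge> 1" and n_pos: "n \<ge> 1" and card_N: "CARD('N) = m * n"
    and fr_rel: "fr_rel \<eta> x y \<Longrightarrow> rel x y"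
begin

sublocale FR: presentation UNIV rel
  by standard simp

sublocale BB: presentation "b_gens m n :: 'N b_gen set" b_rel
proof
  let ?C = "carrier (free_algebra (b_gens m n :: 'N b_gen set))"
  have fun_closed: "gen (Bfun f) \<in> ?C" for f
    by (auto simp: free_algebra_def gen_def b_gens_def)
  have scal: "scal c \<in> ?C" for c
    by (auto simp: free_algebra_def scal_def)
  interpret F: ring "free_algebra (b_gens m n :: 'N b_gen set)" by (rule ring_free_algebra)
  have add: "x + y \<in> ?C" and mult: "x * y \<in> ?C" and minus: "- x \<in> ?C"
    if "x \<in> ?C" "y \<in> ?C" for x y
    using F.a_closed[OF that] F.m_closed[OF that] that by (simp_all add: free_algebra_def)
  fix x y :: "'N b_gen free_alg" assume "b_rel x y"
  then have "x \<in> ?C \<and> y \<in> ?C"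
    by cases (auto intro: fun_closed add mult scal)
  then show "x - y \<in> ?C"
    using add[of x "- y"] minus[of y y] by simp
qed

sublocale T: tensor_pair "presented UNIV rel" "presented (b_gens m n :: 'N b_gen set) b_rel"
  by unfold_locales (rule FR.smult_closed, assumption, rule BB.smult_closed, assumption)

sublocale C: ring_congruence "rel_ideal UNIV rel"
  by (rule ring_congruence_rel_ideal)

notation C.cong (infix "\<doteq>" 50)

lemma congI: "rel x y \<Longrightarrow> x \<doteq> y"
  unfolding C.cong_def by (rule FR.rel_mem)

lemma cls_cong: "x \<doteq> y \<Longrightarrow> FR.cls x = FR.cls y"
  unfolding C.cong_def by (intro FR.cls_eqI) auto

text \<open>\<open>fl\<close> merely names generators and is linear only modulo the relations; the
  sign is extracted as multiplication by the constant \<open>-1\<close>.\<close>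

lemma fl_uminus: "fl (- f) \<doteq> - fl f"
proof -
  have "fl (mero_const (- 1) * f) \<doteq> fl (mero_const (- 1)) * fl f"
    by (intro congI fr_rel fr_rel.intros)
  also have "\<dots> \<doteq> scal (- 1) * fl f"
    by (intro C.cong_mult_right congI fr_rel fr_rel.intros)
  finally show ?thesis by (simp add: mero_const_minus_one_mult scal_simps)
qed

lemma fr_uminus: "fr (- f) \<doteq> - fr f"
proof -
  have "fr (mero_const (- 1) * f) \<doteq> fr (mero_const (- 1)) * fr f"
    by (intro congI fr_rel fr_rel.intros)
  also have "\<dots> \<doteq> scal (- 1) * fr f"
    by (intro C.cong_mult_right congI fr_rel fr_rel.intros)
  finally show ?thesis by (simp add: mero_const_minus_one_mult scal_simps)
qed

lemma shift_neg_h: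
  assumes "i \<in> {1..CARD('N)}" "x \<in> {1..CARD('N)}" "y \<in> {1..CARD('N)}" "i \<noteq> x" "i \<noteq> y" "x \<noteq> y"
  shows "mero_shift (omega i) (neg_h \<eta> x y) = (neg_h \<eta> x y :: 'N mero)"
    and "mero_shift (- omega i) (neg_h \<eta> x y) = (neg_h \<eta> x y :: 'N mero)"
  using assms eta by (auto simp: mero_shift_uminus omega_def axis_def coord_eq_iff
      intro!: mero_shift_hmero)

abbreviation "wt \<equiv> inv_weight (neg_h \<eta>) :: nat list \<Rightarrow> 'N mero"
abbreviation "xi \<equiv> qminor fl (neg_h \<eta>) ft :: nat set \<Rightarrow> nat list \<Rightarrow> 'N fr_gen free_alg"

text \<open>Passing from \<open>\<sigma>\<close> to its row word turns the sum formed in the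
  quotient into the class of a sum in the free algebra, where the abstract expansion results
  apply.\<close>

lemma minor_eq:
  assumes "finite I" "card J = card I"
  shows "minor \<eta> rel I J = FR.cls (xi I (sorted_list_of_set J))"
proof -
  let ?xs = "\<lambda>\<sigma>. map (\<lambda>k. elt I (\<sigma> k)) [1..<Suc (card I)]"
  have bij: "bij_betw ?xs {\<sigma>. \<sigma> permutes {1..card I}} (permutations_of_set I)"
    using bij_betw_permutes_permutations_of_set[OF strict_mono_on_imp_inj_on[OF elt_strict_mono[of I]]]
    unfolding elt_image[OF assms(1)] .
  have J: "sorted_list_of_set J = map (elt J) [1..<Suc (card I)]"
    using map_elt[of J] assms(2) by simp
  have zip: "map2 ft (map f ks) (map g ks) = map (\<lambda>k. ft (f k) (g k)) ks" for f g and ks :: "nat list"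
    by (induction ks) auto
  have "minor \<eta> rel I J = (\<Oplus>\<^bsub>FR.P\<^esub>\<sigma>\<in>{\<sigma>. \<sigma> permutes {1..card I}}.
      FR.cls (fl (Sfun \<eta> \<sigma> I) * word_prod ft (?xs \<sigma>) (sorted_list_of_set J)))"
    unfolding minor_def FRalg_def mu_l_def tF_def J word_prod_def zip
    by (simp add: FR.cls_mult FR.cls_prod_list(1) del: upt_Suc)
  also have "\<dots> = FR.cls (\<Sum>\<sigma>\<in>{\<sigma>. \<sigma> permutes {1..card I}}.
      fl (Sfun \<eta> \<sigma> I) * word_prod ft (?xs \<sigma>) (sorted_list_of_set J))"
    by (rule FR.cls_sum(1)[symmetric]) simp
  also have "(\<Sum>\<sigma>\<in>{\<sigma>. \<sigma> permutes {1..card I}}.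
      fl (Sfun \<eta> \<sigma> I) * word_prod ft (?xs \<sigma>) (sorted_list_of_set J)) =
      (\<Sum>\<sigma>\<in>{\<sigma>. \<sigma> permutes {1..card I}}.
      fl (wt (?xs \<sigma>)) * word_prod ft (?xs \<sigma>) (sorted_list_of_set J))"
    by (rule sum.cong) (auto simp: Sfun_eq_inv_weight simp del: upt_Suc)
  also have "\<dots> = xi I (sorted_list_of_set J)"
    unfolding qminor_def by (rule sum.reindex_bij_betw[OF bij])
  finally show ?thesis .
qed

lemma fB_eq: "fB m n f = BB.cls (gen (Bfun f))"
  by (simp add: fB_def)

lemma fun_carrier: "gen (Bfun f) \<in> carrier BB.F"
  by (rule BB.gen_closed) (simp add: b_gens_def)

lemma fB_closed: "fB m n f \<in> carrier BB.P"
  unfolding fB_eq by (intro BB.cls_closed fun_carrier)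

lemma bB_closed: "I \<in> msubsets m n \<Longrightarrow> bB m n I \<in> carrier BB.P"
  unfolding bB_def by (intro BB.cls_closed BB.gen_closed) (simp add: b_gens_def)

lemma fB_add: "fB m n (f + g) = fB m n f \<oplus>\<^bsub>BB.P\<^esub> fB m n g"
  unfolding fB_eq BB.cls_add[OF fun_carrier fun_carrier, symmetric]
  by (intro BB.cls_rel b_rel.intros BB.F_closed fun_carrier)

lemma fB_one: "fB m n 1 = \<one>\<^bsub>BB.P\<^esub>"
  unfolding fB_eq mero_const_one[symmetric]
  using BB.cls_rel[OF b_rel.intros(3)[of 1] fun_carrier BB.scal_closed] by (simp add: scal_simps BB.cls_one)

lemmas tensor_defs = FoB_def pt_def FRalg_def Balg_def mu_l_def mu_r_def tF_def

lemma pt_closed: "b \<in> carrier BB.P \<Longrightarrow> T.tns (FR.cls x) b \<in> carrier T.AB"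
  by (intro T.tens_closed FR.cls_closed) simp

lemma balance_closed: "balance rel m n \<subseteq> carrier T.AB"
  unfolding balance_def tensor_defs
  by (auto intro!: T.AB.minus_closed T.tens_closed FR.P.m_closed BB.P.m_closed fB_closed)

lemma cC_eq:
  assumes "I \<in> msubsets m n"
  shows "cC \<eta> rel m n I =
    (\<Oplus>\<^bsub>T.AB\<^esub>J\<in>msubsets m n. T.tns (FR.cls (xi I (sorted_list_of_set J))) (bB m n J))"
  unfolding cC_def tensor_defs
  by (rule T.AB.finsum_cong')
     (use card_msubsets[OF assms] in \<open>auto simp: minor_eq card_msubsets intro!: pt_closed bB_closed\<close>)

lemma cC_closed: "I \<in> msubsets m n \<Longrightarrow> cC \<eta> rel m n I \<in> carrier T.AB"
  unfolding cC_eq by (intro T.AB.finsum_closed) (auto intro!: pt_closed bB_closed)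

lemma left_fun_eq: "left_fun rel m n f = T.tns (FR.cls (fl f)) \<one>\<^bsub>BB.P\<^esub>"
  by (simp add: left_fun_def tensor_defs)

lemma left_fun_closed: "left_fun rel m n f \<in> carrier T.AB"
  unfolding left_fun_eq by (intro pt_closed BB.P.one_closed)

lemma tns_cls_mult:
  "b \<in> carrier BB.P \<Longrightarrow> b' \<in> carrier BB.P \<Longrightarrow>
    T.tns (FR.cls (x * y)) (b \<otimes>\<^bsub>BB.P\<^esub> b') = T.tns (FR.cls x) b \<otimes>\<^bsub>T.AB\<^esub> T.tns (FR.cls y) b'"
  by (simp add: FR.cls_mult T.tens_mult)

lemma bB_lprod_closed:
  assumes "set Js \<subseteq> msubsets m n"
  shows "lprod BB.P (map (bB m n) Js) \<in> carrier BB.P"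
proof (rule BB.P.lprod_closed)
  show "set (map (bB m n) Js) \<subseteq> carrier BB.P"
    using assms bB_closed unfolding set_map by blast
qed

text \<open>Distributivity: choosing one \<open>J\<close> in each factor gives a tuple
  \<open>Js\<close>, and factorwise multiplication collects the minors to the left and the
  \<open>b\<close> to the right of the tensor sign.\<close>

lemma lprod_cC:
  assumes "set Is \<subseteq> msubsets m n"
  shows "lprod T.AB (map (cC \<eta> rel m n) Is) =
    (\<Oplus>\<^bsub>T.AB\<^esub>Js\<in>{Js. set Js \<subseteq> msubsets m n \<and> length Js = length Is}.
      T.tns (FR.cls (prod_list (map2 (\<lambda>I J. xi I (sorted_list_of_set J)) Is Js)))
        (lprod BB.P (map (bB m n) Js)))"
  using assms
proof (induction Is)
  case Nil
  have "{Js :: nat set list. set Js \<subseteq> msubsets m n \<and> length Js = 0} = {[]}" by auto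
  then show ?case
    using T.tens_one pt_closed[of "\<one>\<^bsub>BB.P\<^esub>" 1] by (simp add: FR.cls_one)
next
  case (Cons I Is)
  let ?M = "msubsets m n"
  let ?S = "{Js. set Js \<subseteq> ?M \<and> length Js = length Is}"
  let ?S' = "{Js. set Js \<subseteq> ?M \<and> length Js = length (I # Is)}"
  let ?X = "\<lambda>I J. xi I (sorted_list_of_set J)"
  let ?f = "\<lambda>J. T.tns (FR.cls (?X I J)) (bB m n J)"
  let ?g = "\<lambda>Is Js. T.tns (FR.cls (prod_list (map2 ?X Is Js))) (lprod BB.P (map (bB m n) Js))"
  have f: "?f J \<in> carrier T.AB" if "J \<in> ?M" for J
    using that by (intro pt_closed bB_closed)
  have g: "?g Is Js \<in> carrier T.AB" if "set Js \<subseteq> ?M" for Is Js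
    using that by (intro pt_closed bB_lprod_closed)
  have finS: "finite ?S"
    using finite_lists_length_eq[OF finite_msubsets] .
  have G: "finsum T.AB (?g Is) ?S \<in> carrier T.AB"
    by (rule T.AB.finsum_closed) (use g in blast)
  have fg: "?f J \<otimes>\<^bsub>T.AB\<^esub> ?g Is Js \<in> carrier T.AB" if "J \<in> ?M" "Js \<in> ?S" for J Js
    using that f g by (intro T.AB.m_closed) blast+
  have bij: "bij_betw (\<lambda>(J, Js). J # Js) (?M \<times> ?S) ?S'"
    by (rule bij_betw_byWitness[where f' = "\<lambda>Js. (hd Js, tl Js)"])
       (auto simp: length_Suc_conv)
  have "lprod T.AB (map (cC \<eta> rel m n) (I # Is)) =
      finsum T.AB ?f ?M \<otimes>\<^bsub>T.AB\<^esub> finsum T.AB (?g Is) ?S"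
    using Cons by (simp add: cC_eq)
  also have "\<dots> = (\<Oplus>\<^bsub>T.AB\<^esub>J\<in>?M. ?f J \<otimes>\<^bsub>T.AB\<^esub> finsum T.AB (?g Is) ?S)"
    by (rule T.AB.finsum_ldistr[OF finite_msubsets G]) (use f in blast)
  also have "\<dots> = (\<Oplus>\<^bsub>T.AB\<^esub>J\<in>?M. \<Oplus>\<^bsub>T.AB\<^esub>Js\<in>?S. ?f J \<otimes>\<^bsub>T.AB\<^esub> ?g Is Js)"
  proof (rule T.AB.finsum_cong'[OF refl])
    fix J assume J: "J \<in> ?M"
    show "?f J \<otimes>\<^bsub>T.AB\<^esub> finsum T.AB (?g Is) ?S = (\<Oplus>\<^bsub>T.AB\<^esub>Js\<in>?S. ?f J \<otimes>\<^bsub>T.AB\<^esub> ?g Is Js)"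
      by (rule T.AB.finsum_rdistr[OF finS f[OF J]]) (use g in blast)
  next
    show "(\<lambda>J. \<Oplus>\<^bsub>T.AB\<^esub>Js\<in>?S. ?f J \<otimes>\<^bsub>T.AB\<^esub> ?g Is Js) \<in> ?M \<rightarrow> carrier T.AB"
      by (intro funcsetI T.AB.finsum_closed fg)
  qed
  also have "\<dots> = finsum T.AB (\<lambda>(J, Js). ?f J \<otimes>\<^bsub>T.AB\<^esub> ?g Is Js) (?M \<times> ?S)"
    using T.AB.finsum_cartesian[OF finite_msubsets finS,
        of "\<lambda>(J, Js). ?f J \<otimes>\<^bsub>T.AB\<^esub> ?g Is Js"] fg by fastforce
  also have "\<dots> = (\<Oplus>\<^bsub>T.AB\<^esub>z\<in>?M \<times> ?S. ?g (I # Is) ((\<lambda>(J, Js). J # Js) z))"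
  proof (rule T.AB.finsum_cong'[OF refl])
    fix z assume "z \<in> ?M \<times> ?S"
    then obtain J Js where "z = (J, Js)" "J \<in> ?M" "Js \<in> ?S" by blast
    then show "(\<lambda>(J, Js). ?f J \<otimes>\<^bsub>T.AB\<^esub> ?g Is Js) z = ?g (I # Is) ((\<lambda>(J, Js). J # Js) z)"
      using tns_cls_mult[OF bB_closed bB_lprod_closed] by simp
  next
    show "(\<lambda>z. ?g (I # Is) ((\<lambda>(J, Js). J # Js) z)) \<in> ?M \<times> ?S \<rightarrow> carrier T.AB"
      by (intro funcsetI g) auto
  qed
  also have "\<dots> = finsum T.AB (?g (I # Is)) ?S'"
    by (rule T.AB.finsum_reindex_bij_betw[OF bij]) (use g in blast)
  finally show ?case .
qed

text \<open>Exchanging the two sums groups the terms by the column blocks \<open>Js\<close>; the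
  left tensor factor then has the shape expanded in \<open>laplace_blocks\<close>.\<close>

lemma Pf_cC:
  "Pf T.AB (left_fun rel m n) \<eta> m n (cC \<eta> rel m n) =
    (\<Oplus>\<^bsub>T.AB\<^esub>Js\<in>{Js. set Js \<subseteq> msubsets m n \<and> length Js = n}.
      T.tns (FR.cls (\<Sum>Is\<in>ordered_blocks m n {1..m * n}. fl (wt (flat Is)) *
          prod_list (map2 xi Is (map sorted_list_of_set Js))))
        (lprod BB.P (map (bB m n) Js)))"
proof -
  let ?O = "ordered_blocks m n {1..m * n}"
  let ?S = "{Js. set Js \<subseteq> msubsets m n \<and> length Js = n}"
  let ?X = "\<lambda>Is Js. prod_list (map2 xi Is (map sorted_list_of_set Js))"
  let ?b = "\<lambda>Js. lprod BB.P (map (bB m n) Js)"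
  have X: "map2 (\<lambda>I J. xi I (sorted_list_of_set J)) Is Js = map2 xi Is (map sorted_list_of_set Js)"
    for Is Js by (simp add: zip_map2 case_prod_unfold)
  have closed: "T.tns (FR.cls x) (?b Js) \<in> carrier T.AB" if "Js \<in> ?S" for x Js
    using that by (intro pt_closed bB_lprod_closed) simp
  have finS: "finite ?S"
    using finite_lists_length_eq[OF finite_msubsets] .
  have finO: "finite ?O"
    by (rule finite_ordered_blocks) simp
  have "Pf T.AB (left_fun rel m n) \<eta> m n (cC \<eta> rel m n) =
      (\<Oplus>\<^bsub>T.AB\<^esub>Is\<in>?O. left_fun rel m n (wt (flat Is)) \<otimes>\<^bsub>T.AB\<^esub> lprod T.AB (map (cC \<eta> rel m n) Is))"
    by (rule T.AB.Pf_eq_ordered_blocks) (rule left_fun_closed, erule cC_closed)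
  also have "\<dots> = (\<Oplus>\<^bsub>T.AB\<^esub>Is\<in>?O. \<Oplus>\<^bsub>T.AB\<^esub>Js\<in>?S.
      T.tns (FR.cls (fl (wt (flat Is)) * ?X Is Js)) (?b Js))"
  proof (rule T.AB.finsum_cong'[OF refl])
    fix Is assume "Is \<in> ?O"
    then have Is: "set Is \<subseteq> msubsets m n" "length Is = n"
      using ordered_blocks_msubsets by blast+
    have "left_fun rel m n (wt (flat Is)) \<otimes>\<^bsub>T.AB\<^esub> lprod T.AB (map (cC \<eta> rel m n) Is) =
        (\<Oplus>\<^bsub>T.AB\<^esub>Js\<in>?S. left_fun rel m n (wt (flat Is)) \<otimes>\<^bsub>T.AB\<^esub> T.tns (FR.cls (?X Is Js)) (?b Js))"
      unfolding lprod_cC[OF Is(1)] X Is(2)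
      by (rule T.AB.finsum_rdistr[OF finS]) (use closed left_fun_closed in auto)
    also have "\<dots> = (\<Oplus>\<^bsub>T.AB\<^esub>Js\<in>?S. T.tns (FR.cls (fl (wt (flat Is)) * ?X Is Js)) (?b Js))"
    proof (rule T.AB.finsum_cong'[OF refl])
      fix Js assume "Js \<in> ?S"
      then have "?b Js \<in> carrier BB.P" by (intro bB_lprod_closed) simp
      then show "left_fun rel m n (wt (flat Is)) \<otimes>\<^bsub>T.AB\<^esub> T.tns (FR.cls (?X Is Js)) (?b Js) =
          T.tns (FR.cls (fl (wt (flat Is)) * ?X Is Js)) (?b Js)"
        using tns_cls_mult[of "\<one>\<^bsub>BB.P\<^esub>" "?b Js"] by (simp add: left_fun_eq)
    qed (use closed in auto)
    finally show "left_fun rel m n (wt (flat Is)) \<otimes>\<^bsub>T.AB\<^esub> lprod T.AB (map (cC \<eta> rel m n) Is) =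
        (\<Oplus>\<^bsub>T.AB\<^esub>Js\<in>?S. T.tns (FR.cls (fl (wt (flat Is)) * ?X Is Js)) (?b Js))" .
  qed (use closed in \<open>auto intro!: T.AB.finsum_closed\<close>)
  also have "\<dots> = (\<Oplus>\<^bsub>T.AB\<^esub>Js\<in>?S. \<Oplus>\<^bsub>T.AB\<^esub>Is\<in>?O.
      T.tns (FR.cls (fl (wt (flat Is)) * ?X Is Js)) (?b Js))"
    by (rule T.AB.finsum_swap[OF finO finS]) (rule closed)
  also have "\<dots> = (\<Oplus>\<^bsub>T.AB\<^esub>Js\<in>?S.
      T.tns (FR.cls (\<Sum>Is\<in>?O. fl (wt (flat Is)) * ?X Is Js)) (?b Js))"
  proof (rule T.AB.finsum_cong'[OF refl])
    fix Js assume "Js \<in> ?S"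
    then have "?b Js \<in> carrier BB.P" by (intro bB_lprod_closed) simp
    then show "(\<Oplus>\<^bsub>T.AB\<^esub>Is\<in>?O. T.tns (FR.cls (fl (wt (flat Is)) * ?X Is Js)) (?b Js)) =
        T.tns (FR.cls (\<Sum>Is\<in>?O. fl (wt (flat Is)) * ?X Is Js)) (?b Js)"
      by (subst FR.cls_sum(1), simp, subst T.tens_finsum_left) (auto intro!: FR.cls_closed)
  qed (use closed in auto)
  finally show ?thesis .
qed

lemma PfB_eq: "PfB \<eta> m n = (\<Oplus>\<^bsub>BB.P\<^esub>Is\<in>ordered_blocks m n {1..m * n}.
    fB m n (wt (flat Is)) \<otimes>\<^bsub>BB.P\<^esub> lprod BB.P (map (bB m n) Is))"
  unfolding PfB_def Balg_def
  by (rule BB.P.Pf_eq_ordered_blocks) (rule fB_closed, erule bB_closed)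

lemma fB_bB_closed:
  "Is \<in> ordered_blocks m n {1..m * n} \<Longrightarrow>
    fB m n (wt (flat Is)) \<otimes>\<^bsub>BB.P\<^esub> lprod BB.P (map (bB m n) Is) \<in> carrier BB.P"
  using ordered_blocks_msubsets by (intro BB.P.m_closed fB_closed bB_lprod_closed) blast

lemma PfB_closed: "PfB \<eta> m n \<in> carrier BB.P"
  unfolding PfB_eq by (intro BB.P.finsum_closed) (auto intro: fB_bB_closed)

lemma detT_eq: "detT \<eta> rel = FR.cls (xi {1..m * n} [1..<Suc (m * n)])"
proof -
  have "sorted_list_of_set {1..m * n} = [1..<Suc (m * n)]"
    using sorted_list_of_set.idem_if_sorted_distinct[OF sorted_upt distinct_upt, of 1 "Suc (m * n)"]
    by (simp add: atLeastLessThanSuc_atLeastAtMost del: upt_Suc)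
  then show ?thesis
    unfolding detT_def card_N by (subst minor_eq) (auto simp del: upt_Suc)
qed

end

locale dynamical_minor_tensor = dynamical_tensor rel \<eta> m n
  for rel :: "'N::finite fr_rels" and \<eta> m n +
  assumes minor_rel: "minor_rel \<eta> x y \<Longrightarrow> rel x y"
begin

text \<open>Moving \<open>fr\<close> to the left uses the relation for the backward shift of the
  function. The sign in \<open>neg_h\<close> is taken out of the generators by
  \<open>fl_uminus\<close> and \<open>fr_uminus\<close>, after which the column axioms are the
  same-column relation and the 2 by 2 minor relation.\<close>

sublocale DM: dynamical_matrix "rel_ideal UNIV rel" fl fr "\<lambda>i. mero_shift (omega i)"
  "\<lambda>i. mero_shift (- omega i)" "neg_h \<eta>" ft "{1..CARD('N)}"
proof
  fix f g :: "'N mero"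
  show "fl (f * g) \<doteq> fl f * fl g" "fr (f * g) \<doteq> fr f * fr g" "fl f * fr g \<doteq> fr g * fl f"
    by (intro congI fr_rel fr_rel.intros)+
  show "fl 1 \<doteq> (1 :: 'N fr_gen free_alg)" "fr 1 \<doteq> (1 :: 'N fr_gen free_alg)"
    using congI[OF fr_rel[OF fr_rel.l_const[of _ 1]]] congI[OF fr_rel[OF fr_rel.r_const[of _ 1]]]
    by (simp_all add: mero_const_one scal_simps)
next
  fix i j :: nat and f :: "'N mero" assume ij: "i \<in> {1..CARD('N)}" "j \<in> {1..CARD('N)}"
  then show "fl f * ft i j \<doteq> ft i j * fl (mero_shift (omega i) f)"
    by (intro congI fr_rel fr_rel.intros)
  have "fr (mero_shift (- omega j) f) * ft i j \<doteq>
      ft i j * fr (mero_shift (omega j) (mero_shift (- omega j) f))"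
    using ij by (intro congI fr_rel fr_rel.intros)
  from C.cong_sym[OF this]
  show "ft i j * fr f \<doteq> fr (mero_shift (- omega j) f) * ft i j"
    by (simp add: mero_shift_minus_cancel)
next
  fix i j k :: nat
  assume ijk: "i \<in> {1..CARD('N)}" "j \<in> {1..CARD('N)}" "k \<in> {1..CARD('N)}" "i < j"
  have "fl (- hmero \<eta> j i) * ft j k * ft i k \<doteq> - fl (hmero \<eta> j i) * ft j k * ft i k"
    by (intro C.cong_mult_right fl_uminus)
  also have "\<dots> = - 1 * (fl (hmero \<eta> j i) * ft j k * ft i k)"
    by simp
  also have "\<dots> \<doteq> - 1 * (ft i k * ft j k)"
    using ijk by (intro C.cong_mult_left congI fr_rel fr_rel.intros)
  finally have "ft i k * ft j k + fl (- hmero \<eta> j i) * ft j k * ft i k \<doteq>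
      ft i k * ft j k + - 1 * (ft i k * ft j k)"
    by (intro C.cong_add) auto
  then show "ft i k * ft j k + fl (- hmero \<eta> j i) * ft j k * ft i k \<doteq> 0" by simp
next
  fix i j k l :: nat
  assume ijkl: "i \<in> {1..CARD('N)}" "j \<in> {1..CARD('N)}" "k \<in> {1..CARD('N)}" "l \<in> {1..CARD('N)}"
    "i < j" "k < l"
  have Q: "x + fl (- hmero \<eta> j i) * y * z \<doteq> x - fl (hmero \<eta> j i) * y * z" for x y z
  proof -
    have "x + fl (- hmero \<eta> j i) * y * z \<doteq> x + - fl (hmero \<eta> j i) * y * z"
      by (intro C.cong_add C.cong_mult_right fl_uminus) auto
    then show ?thesis by simp
  qed
  have "ft i l * ft j k + fl (- hmero \<eta> j i) * ft j l * ft i k \<doteq>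
      ft i l * ft j k - fl (hmero \<eta> j i) * ft j l * ft i k"
    by (rule Q)
  also have "\<dots> \<doteq> - fr (hmero \<eta> l k) * (ft i k * ft j l - fl (hmero \<eta> j i) * ft j k * ft i l)"
    using ijkl by (intro congI minor_rel minor_rel.intros)
  also have "\<dots> \<doteq> fr (- hmero \<eta> l k) * (ft i k * ft j l + fl (- hmero \<eta> j i) * ft j k * ft i l)"
    by (intro C.cong_mult C.cong_sym[OF fr_uminus] C.cong_sym[OF Q])
  finally show "ft i l * ft j k + fl (- hmero \<eta> j i) * ft j l * ft i k \<doteq>
      fr (- hmero \<eta> l k) * (ft i k * ft j l + fl (- hmero \<eta> j i) * ft j k * ft i l)" .
qed (auto simp: mero_shift_mult mero_shift_one shift_neg_h)

end

lemma (in abelian_group) finsum_mem_subgroup: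
  assumes "subgroup H (add_monoid G)" "\<And>i. i \<in> S \<Longrightarrow> f i \<in> H"
  shows "finsum G f S \<in> H"
proof -
  interpret H: subgroup H "add_monoid G" by fact
  show ?thesis
    using assms(2)
  proof (induction S rule: infinite_finite_induct)
    case (insert i S)
    have "f i \<in> carrier G" "f \<in> S \<rightarrow> carrier G"
      using H.subset insert.prems by auto
    then show ?case
      using insert H.m_closed[of "f i" "finsum G f S"] by simp
  qed (use H.one_closed in simp_all)
qed

lemma (in dynamical_tensor) balance_mem:
  assumes "t \<in> carrier FR.P" "b \<in> carrier BB.P"
  shows "T.tns (mu_r rel f \<otimes>\<^bsub>FR.P\<^esub> t) b \<ominus>\<^bsub>T.AB\<^esub> T.tns t (fB m n f \<otimes>\<^bsub>BB.P\<^esub> b) \<in> balance rel m n"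
  unfolding balance_def FoB_def pt_def FRalg_def Balg_def
  by (rule CollectI, rule exI[of _ f], rule exI[of _ t], rule exI[of _ b]) (simp add: assms)

context dynamical_minor_tensor
begin

text \<open>Row expansion followed by sorting of the columns. The surviving tuples are those with
  distinct columns, that is, the summation set of \<open>Pf(B)\<close>.\<close>

lemma laplace_ordered_blocks:
  assumes "set Js \<subseteq> msubsets m n" "length Js = n"
  shows "(\<Sum>Is\<in>ordered_blocks m n {1..m * n}.
      fl (wt (flat Is)) * prod_list (map2 xi Is (map sorted_list_of_set Js))) \<doteq>
    (if Js \<in> ordered_blocks m n {1..m * n}
     then fr (wt (flat Js)) * xi {1..m * n} [1..<Suc (m * n)] else 0)"
proof -
  have Js: "J \<subseteq> {1..m * n} \<and> finite J \<and> card J = m" if "J \<in> set Js" for J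
    using card_msubsets assms(1) that by blast
  have len: "length (flat Js) = m * n"
  proof -
    have "\<forall>J\<in>set Js. card J = m" using Js by blast
    then have "length (flat Js) = m * length Js" by (induction Js) auto
    then show ?thesis using assms(2) by simp
  qed
  have set_flat: "set (flat Js) \<subseteq> {1..m * n}"
    unfolding flat_def using Js by fastforce
  have expand: "(\<Sum>Is\<in>ordered_blocks m n {1..m * n}.
      fl (wt (flat Is)) * prod_list (map2 xi Is (map sorted_list_of_set Js))) \<doteq>
      xi {1..m * n} (flat Js)"
    unfolding flat_def[of Js]
    by (rule DM.laplace_blocks) (use Js assms(2) card_N in auto)
  have reorder: "if distinct (flat Js)
      then xi {1..m * n} (flat Js) \<doteq> fr (wt (flat Js)) * xi {1..m * n} (sort (flat Js))
      else xi {1..m * n} (flat Js) \<doteq> 0"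
    by (rule DM.xi_sort) (use len set_flat card_N in auto)
  have sort: "sort (flat Js) = [1..<Suc (m * n)]" if "Js \<in> ordered_blocks m n {1..m * n}"
  proof (rule sorted_distinct_set_unique)
    show "set (sort (flat Js)) = set [1..<Suc (m * n)]"
      using that by (simp add: ordered_blocks_iff atLeastLessThanSuc_atLeastAtMost del: upt_Suc)
    show "distinct (sort (flat Js))"
      using that by (simp add: ordered_blocks_iff)
  qed (simp_all del: upt_Suc)
  have "xi {1..m * n} (flat Js) \<doteq> (if Js \<in> ordered_blocks m n {1..m * n}
      then fr (wt (flat Js)) * xi {1..m * n} [1..<Suc (m * n)] else 0)"
  proof (cases "Js \<in> ordered_blocks m n {1..m * n}")
    case True
    then have "xi {1..m * n} (flat Js) \<doteq> fr (wt (flat Js)) * xi {1..m * n} (sort (flat Js))"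
      using reorder ordered_blocks_iff_distinct[OF assms] by simp
    then show ?thesis
      unfolding sort[OF True] using True by (simp del: upt_Suc)
  next
    case False
    then show ?thesis
      using reorder ordered_blocks_iff_distinct[OF assms] by simp
  qed
  from C.cong_trans[OF expand this] show ?thesis .
qed

text \<open>Once the vanishing tuples are dropped, both sides are sums over the same lists of
  blocks. Corresponding terms differ by an element of \<open>balance\<close>, taken for the function
  \<open>wt (flat Js)\<close>, so the two sums lie in one coset.\<close>

lemma span_class_Pf:
  "span_class rel m n (Pf (FoB rel m n) (left_fun rel m n) \<eta> m n (cC \<eta> rel m n)) =
   span_class rel m n (pt rel m n (detT \<eta> rel) (PfB \<eta> m n))"
proof -
  let ?O = "ordered_blocks m n {1..m * n}"
  let ?S = "{Js. set Js \<subseteq> msubsets m n \<and> length Js = n}"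
  let ?D = "xi {1..m * n} [1..<Suc (m * n)]"
  let ?b = "\<lambda>Js. lprod BB.P (map (bB m n) Js)"
  let ?H = "span_rel rel m n"
  let ?x = "\<lambda>Js. T.tns (FR.cls (fr (wt (flat Js)) * ?D)) (?b Js)"
  let ?y = "\<lambda>Js. T.tns (FR.cls ?D) (fB m n (wt (flat Js)) \<otimes>\<^bsub>BB.P\<^esub> ?b Js)"
  have b: "?b Js \<in> carrier BB.P" if "Js \<in> ?S" for Js
    using that by (intro bB_lprod_closed) simp
  have OS: "?O \<subseteq> ?S"
    using ordered_blocks_msubsets by blast
  have x: "?x Js \<in> carrier T.AB" if "Js \<in> ?O" for Js
    using that b OS by (intro pt_closed) blast
  have y: "?y Js \<in> carrier T.AB" if "Js \<in> ?O" for Js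
    by (intro pt_closed fB_bB_closed that)
  have X: "Pf (FoB rel m n) (left_fun rel m n) \<eta> m n (cC \<eta> rel m n) = finsum T.AB ?x ?O"
  proof -
    have "Pf (FoB rel m n) (left_fun rel m n) \<eta> m n (cC \<eta> rel m n) =
      (\<Oplus>\<^bsub>T.AB\<^esub>Js\<in>?S. T.tns (FR.cls (if Js \<in> ?O then fr (wt (flat Js)) * ?D else 0)) (?b Js))"
      unfolding FoB_def FRalg_def Balg_def Pf_cC
    proof (rule T.AB.finsum_cong'[OF refl])
      fix Js assume "Js \<in> ?S"
      then show "T.tns (FR.cls (\<Sum>Is\<in>?O. fl (wt (flat Is)) *
            prod_list (map2 xi Is (map sorted_list_of_set Js)))) (?b Js) =
          T.tns (FR.cls (if Js \<in> ?O then fr (wt (flat Js)) * ?D else 0)) (?b Js)"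
        using cls_cong[OF laplace_ordered_blocks[of Js]] by simp
    qed (intro funcsetI pt_closed b)
    also have "\<dots> = finsum T.AB ?x ?O"
    proof (rule T.AB.add.finprod_mono_neutral_cong_right[OF _ OS])
      show "finite ?S" using finite_lists_length_eq[OF finite_msubsets] .
      show "(\<lambda>Js. T.tns (FR.cls (if Js \<in> ?O then fr (wt (flat Js)) * ?D else 0)) (?b Js))
          \<in> ?S \<rightarrow> carrier T.AB"
        by (intro funcsetI pt_closed b)
      show "T.tns (FR.cls (if Js \<in> ?O then fr (wt (flat Js)) * ?D else 0)) (?b Js) = \<zero>\<^bsub>T.AB\<^esub>"
        if "Js \<in> ?S - ?O" for Js
        using that b[of Js] by (simp add: FR.cls_zero T.tens_zero_left)
    qed auto
    finally show ?thesis .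
  qed
  have Y: "pt rel m n (detT \<eta> rel) (PfB \<eta> m n) = finsum T.AB ?y ?O"
    unfolding tensor_defs detT_eq PfB_eq
    by (rule T.tens_finsum_right) (auto intro: fB_bB_closed)
  interpret H: subgroup ?H "add_monoid T.AB"
    unfolding span_rel_def tensor_defs
    by (rule T.AB.add.generate_is_subgroup) (use balance_closed in \<open>simp add: tensor_defs\<close>)
  have "?x Js \<ominus>\<^bsub>T.AB\<^esub> ?y Js \<in> ?H" if "Js \<in> ?O" for Js
  proof -
    have "?x Js = T.tns (mu_r rel (wt (flat Js)) \<otimes>\<^bsub>FR.P\<^esub> FR.cls ?D) (?b Js)"
      by (simp add: mu_r_def FR.cls_mult)
    moreover have "?b Js \<in> carrier BB.P" "FR.cls ?D \<in> carrier FR.P"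
      using that b OS by auto
    ultimately have "?x Js \<ominus>\<^bsub>T.AB\<^esub> ?y Js \<in> balance rel m n"
      using balance_mem by simp
    then show ?thesis
      unfolding span_rel_def tensor_defs by (rule generate.incl)
  qed
  then have "(\<Oplus>\<^bsub>T.AB\<^esub>Js\<in>?O. ?x Js \<ominus>\<^bsub>T.AB\<^esub> ?y Js) \<in> ?H"
    by (intro T.AB.finsum_mem_subgroup H.subgroup_axioms)
  then have diff: "finsum T.AB ?x ?O \<ominus>\<^bsub>T.AB\<^esub> finsum T.AB ?y ?O \<in> ?H"
    using T.AB.finsum_minus[of ?x ?O ?y] x y by (simp add: Pi_iff)
  have closed: "finsum T.AB ?x ?O \<in> carrier T.AB" "finsum T.AB ?y ?O \<in> carrier T.AB"
    by (intro T.AB.finsum_closed funcsetI x y; assumption)+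
  have "finsum T.AB ?x ?O = (finsum T.AB ?x ?O \<ominus>\<^bsub>T.AB\<^esub> finsum T.AB ?y ?O) \<oplus>\<^bsub>T.AB\<^esub> finsum T.AB ?y ?O"
    using closed by (simp add: a_minus_def T.AB.a_assoc T.AB.l_neg)
  then have "finsum T.AB ?x ?O \<in> ?H +>\<^bsub>T.AB\<^esub> finsum T.AB ?y ?O"
    using diff unfolding a_r_coset_def' by blast
  note coset = T.AB.a_repr_independence[OF this closed(2) H.subgroup_axioms]
  have "span_class rel m n z = ?H +>\<^bsub>T.AB\<^esub> z" for z
    by (simp only: span_class_def FoB_def FRalg_def Balg_def)
  then show ?thesis
    by (simp only: X Y coset)
qed

end

section \<open>Collapse modulo the two-sided ideal\<close>

context dynamical_tensor
begin

sublocale J: ideal "alg_ideal rel m n" T.AB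
  unfolding alg_ideal_def tensor_defs
  by (rule T.AB.genideal_ideal) (use balance_closed in \<open>simp add: tensor_defs\<close>)

abbreviation "Q \<equiv> FtB rel m n"
abbreviation "\<phi> \<equiv> FtB_class rel m n"

lemma Q_eq: "Q = T.AB Quot alg_ideal rel m n"
  by (simp add: FtB_def tensor_defs)

sublocale Q: ring Q
  unfolding Q_eq by (rule J.quotient_is_ring)

lemma \<phi>_hom: "\<phi> \<in> ring_hom T.AB Q"
  using J.rcos_ring_hom unfolding Q_eq FtB_class_def[abs_def] tensor_defs .

lemma \<phi>_closed: "x \<in> carrier T.AB \<Longrightarrow> \<phi> x \<in> carrier Q"
  by (rule ring_hom_closed[OF \<phi>_hom])

lemma \<phi>_zero: "\<phi> \<zero>\<^bsub>T.AB\<^esub> = \<zero>\<^bsub>Q\<^esub>"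
  by (rule ring_hom_zero[OF \<phi>_hom T.AB.ring_axioms Q.ring_axioms])

lemma \<phi>_balance:
  assumes "b \<in> carrier BB.P"
  shows "\<phi> (T.tns (FR.cls (fr f * x)) b) = \<phi> (T.tns (FR.cls x) (fB m n f \<otimes>\<^bsub>BB.P\<^esub> b))"
proof -
  have "T.tns (mu_r rel f \<otimes>\<^bsub>FR.P\<^esub> FR.cls x) b \<ominus>\<^bsub>T.AB\<^esub> T.tns (FR.cls x) (fB m n f \<otimes>\<^bsub>BB.P\<^esub> b)
      \<in> balance rel m n"
    using assms by (intro balance_mem FR.cls_closed) simp
  then have "T.tns (FR.cls (fr f * x)) b \<ominus>\<^bsub>T.AB\<^esub> T.tns (FR.cls x) (fB m n f \<otimes>\<^bsub>BB.P\<^esub> b)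
      \<in> alg_ideal rel m n"
    using T.AB.genideal_self[OF balance_closed]
    by (auto simp: alg_ideal_def tensor_defs FR.cls_mult)
  then show ?thesis
    using T.AB.quotient_eq_iff_same_a_r_cos[OF J.ideal_axioms] assms
    unfolding FtB_class_def tensor_defs by (simp add: pt_closed fB_closed)
qed

lemma \<phi>_tns_mult:
  "b \<in> carrier BB.P \<Longrightarrow> b' \<in> carrier BB.P \<Longrightarrow>
    \<phi> (T.tns (FR.cls (x * y)) (b \<otimes>\<^bsub>BB.P\<^esub> b')) =
    \<phi> (T.tns (FR.cls x) b) \<otimes>\<^bsub>Q\<^esub> \<phi> (T.tns (FR.cls y) b')"
  using ring_hom_mult[OF \<phi>_hom pt_closed pt_closed] by (simp add: tns_cls_mult)

text \<open>The coordinate function \<open>f(\<lambda>) = \<lambda>\<^sub>j\<close> satisfies \<open>f(\<lambda> + \<omega>(j)) = f(\<lambda>) + 1\<close>: moving it around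
  \<open>t\<^sub>i\<^sub>j\<close> shows \<open>t\<^sub>i\<^sub>j \<otimes> f = t\<^sub>i\<^sub>j \<otimes> (f + 1)\<close> modulo the two-sided ideal.\<close>

lemma \<phi>_ft:
  assumes "i \<in> {1..m * n}" "j \<in> {1..m * n}"
  shows "\<phi> (T.tns (FR.cls (ft i j)) \<one>\<^bsub>BB.P\<^esub>) = \<zero>\<^bsub>Q\<^esub>"
proof -
  let ?one = "\<one>\<^bsub>BB.P\<^esub>" and ?t = "FR.cls (ft i j)"
  have closed: "?one \<in> carrier BB.P" "fB m n f \<in> carrier BB.P" for f
    by (auto intro: fB_closed)
  obtain f :: "'N mero" where f: "mero_shift (omega j) f = f + 1"
    using coordinate_mero .
  \<comment> \<open>Here \<open>fr g\<close> stands to the right of \<open>t\<close>: the balancing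
    relation for \<open>fr g\<close> is multiplied by \<open>t \<otimes> 1\<close> from the left,
    which is legitimate because the ideal is two-sided.\<close>
  have right: "\<phi> (T.tns (FR.cls (ft i j * fr g)) ?one) = \<phi> (T.tns ?t (fB m n g))" for g
  proof -
    have "\<phi> (T.tns (FR.cls (ft i j * fr g)) ?one) =
        \<phi> (T.tns ?t ?one) \<otimes>\<^bsub>Q\<^esub> \<phi> (T.tns (FR.cls (fr g)) ?one)"
      using \<phi>_tns_mult[of ?one ?one "ft i j" "fr g"] by simp
    also have "\<phi> (T.tns (FR.cls (fr g)) ?one) = \<phi> (T.tns (FR.cls 1) (fB m n g))"
      using \<phi>_balance[of ?one g 1] closed by simp
    also have "\<phi> (T.tns ?t ?one) \<otimes>\<^bsub>Q\<^esub> \<dots> = \<phi> (T.tns ?t (fB m n g))"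
      using \<phi>_tns_mult[of ?one "fB m n g" "ft i j" 1] closed by simp
    finally show ?thesis .
  qed
  have "\<phi> (T.tns ?t (fB m n f)) = \<phi> (T.tns (FR.cls (fr f * ft i j)) ?one)"
    using \<phi>_balance[of ?one f "ft i j"] closed by simp
  also have "FR.cls (fr f * ft i j) = FR.cls (ft i j * fr (f + 1))"
    unfolding f[symmetric] by (intro cls_cong congI fr_rel fr_rel.intros) (use assms card_N in auto)
  also have "\<phi> (T.tns (FR.cls (ft i j * fr (f + 1))) ?one) = \<phi> (T.tns ?t (fB m n (f + 1)))"
    by (rule right)
  also have "\<dots> = \<phi> (T.tns ?t (fB m n f)) \<oplus>\<^bsub>Q\<^esub> \<phi> (T.tns ?t ?one)"
    using ring_hom_add[OF \<phi>_hom pt_closed pt_closed] closed by (simp add: fB_add fB_one T.tens_add_right)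
  finally show ?thesis
    using Q.add.l_cancel_one'[of "\<phi> (T.tns ?t (fB m n f))" "\<phi> (T.tns ?t ?one)"]
      \<phi>_closed[OF pt_closed] closed by simp
qed

text \<open>Quantifying over all \<open>b\<close> makes the property stable under multiplication
  from both sides.\<close>

definition vanishing :: "'N fr_gen free_alg \<Rightarrow> bool" where
  "vanishing x \<longleftrightarrow> (\<forall>b\<in>carrier BB.P. \<phi> (T.tns (FR.cls x) b) = \<zero>\<^bsub>Q\<^esub>)"

lemma vanishing_mult:
  assumes "vanishing x" shows "vanishing (x * y)" "vanishing (y * x)"
proof -
  have closed: "\<phi> (T.tns (FR.cls z) b) \<in> carrier Q" if "b \<in> carrier BB.P" for z b
    using that by (intro \<phi>_closed pt_closed)
  show "vanishing (x * y)"
    unfolding vanishing_def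
  proof
    fix b assume "b \<in> carrier BB.P"
    then show "\<phi> (T.tns (FR.cls (x * y)) b) = \<zero>\<^bsub>Q\<^esub>"
      using \<phi>_tns_mult[of b "\<one>\<^bsub>BB.P\<^esub>" x y] assms closed by (simp add: vanishing_def)
  qed
  show "vanishing (y * x)"
    unfolding vanishing_def
  proof
    fix b assume "b \<in> carrier BB.P"
    then show "\<phi> (T.tns (FR.cls (y * x)) b) = \<zero>\<^bsub>Q\<^esub>"
      using \<phi>_tns_mult[of "\<one>\<^bsub>BB.P\<^esub>" b y x] assms closed by (simp add: vanishing_def)
  qed
qed

lemma vanishing_sum: "(\<And>i. i \<in> A \<Longrightarrow> vanishing (f i)) \<Longrightarrow> vanishing (sum f A)"
proof (induction A rule: infinite_finite_induct)
  case (insert i A)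
  then have "vanishing (f i)" "vanishing (sum f A)" by auto
  then show ?case
    using insert(1,2) ring_hom_add[OF \<phi>_hom pt_closed pt_closed]
    by (simp add: vanishing_def FR.cls_add T.tens_add_left)
qed (auto simp: vanishing_def FR.cls_zero T.tens_zero_left \<phi>_zero)

text \<open>For a nonempty row set every word begins with some generator \<open>t\<close>, and that
  one factor suffices.\<close>

lemma vanishing_xi:
  assumes "I \<subseteq> {1..m * n}" "set js \<subseteq> {1..m * n}" "length js = card I" "I \<noteq> {}"
  shows "vanishing (xi I js)"
  unfolding qminor_def
proof (intro vanishing_sum vanishing_mult(2))
  fix "is" assume "is \<in> permutations_of_set I"
  then have "set is = I" "length is = length js"
    using assms(3) by (auto simp: permutations_of_set_def distinct_card)
  then obtain i is' j js' where ij: "is = i # is'" "js = j # js'"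
    using assms(4) by (cases "is"; cases js) auto
  then have "\<phi> (T.tns (FR.cls (ft i j)) \<one>\<^bsub>BB.P\<^esub>) = \<zero>\<^bsub>Q\<^esub>"
    using assms(1,2) \<open>set is = I\<close> by (intro \<phi>_ft) auto
  then have "vanishing (ft i j)"
    unfolding vanishing_def
    using \<phi>_tns_mult[of "\<one>\<^bsub>BB.P\<^esub>" _ "ft i j" 1] \<phi>_closed[OF pt_closed] by simp
  then show "vanishing (word_prod ft is js)"
    unfolding ij word_prod_simps by (rule vanishing_mult(1))
qed

lemma \<phi>_cC:
  assumes "I \<in> msubsets m n"
  shows "\<phi> (cC \<eta> rel m n I) = \<zero>\<^bsub>Q\<^esub>"
proof -
  let ?f = "\<lambda>J. T.tns (FR.cls (xi I (sorted_list_of_set J))) (bB m n J)"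
  have f: "?f J \<in> carrier T.AB" if "J \<in> msubsets m n" for J
    using that by (intro pt_closed bB_closed)
  have zero: "\<phi> (?f J) = \<zero>\<^bsub>Q\<^esub>" if "J \<in> msubsets m n" for J
  proof -
    have "vanishing (xi I (sorted_list_of_set J))"
      using card_msubsets[OF assms] card_msubsets[OF that] m_pos by (intro vanishing_xi) auto
    then show ?thesis using bB_closed[OF that] by (simp add: vanishing_def)
  qed
  have "\<phi> (finsum T.AB ?f M) = \<zero>\<^bsub>Q\<^esub>" if "finite M" "M \<subseteq> msubsets m n" for M
    using that
  proof (induction M)
    case (insert J M)
    then have "?f J \<in> carrier T.AB" "?f \<in> M \<rightarrow> carrier T.AB" using f by auto
    then have "\<phi> (finsum T.AB ?f (insert J M)) = \<phi> (?f J) \<oplus>\<^bsub>Q\<^esub> \<phi> (finsum T.AB ?f M)"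
      using insert(1,2) ring_hom_add[OF \<phi>_hom] by simp
    then show ?case using insert zero by simp
  qed (simp add: \<phi>_zero)
  then show ?thesis unfolding cC_eq[OF assms] using finite_msubsets by blast
qed

text \<open>Each term of the Pfaffian has a factor from \<open>C\<close> because
  \<open>n \<ge> 1\<close>, and \<open>det(T)\<close> is a minor of positive size
  \<open>m * n\<close>.\<close>

lemma FtB_Pf:
  "Pf Q (\<lambda>f. \<phi> (left_fun rel m n f)) \<eta> m n (\<lambda>I. \<phi> (cC \<eta> rel m n I)) =
   \<phi> (pt rel m n (detT \<eta> rel) (PfB \<eta> m n))"
proof -
  have "\<phi> (left_fun rel m n f) \<otimes>\<^bsub>Q\<^esub> lprod Q (map (\<lambda>I. \<phi> (cC \<eta> rel m n I)) Is) = \<zero>\<^bsub>Q\<^esub>"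
    if "Is \<in> ordered_blocks m n {1..m * n}" for f Is
  proof -
    have Is: "set Is \<subseteq> msubsets m n" "length Is = n"
      using ordered_blocks_msubsets[OF that] by auto
    then obtain I Is' where I: "Is = I # Is'" using n_pos by (cases Is) auto
    have "lprod Q (map (\<lambda>I. \<phi> (cC \<eta> rel m n I)) Is') \<in> carrier Q"
      using Is(1) I by (intro Q.lprod_closed) (auto intro!: \<phi>_closed cC_closed)
    then show ?thesis
      using Is(1) I \<phi>_cC[of I] \<phi>_closed[OF left_fun_closed] by simp
  qed
  then have "Pf Q (\<lambda>f. \<phi> (left_fun rel m n f)) \<eta> m n (\<lambda>I. \<phi> (cC \<eta> rel m n I)) = \<zero>\<^bsub>Q\<^esub>"
    by (subst Q.Pf_eq_ordered_blocks)
       (auto intro: \<phi>_closed left_fun_closed cC_closed intro!: Q.add.finprod_one_eqI)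
  moreover have "vanishing (xi {1..m * n} [1..<Suc (m * n)])"
    using m_pos n_pos by (intro vanishing_xi) (auto simp del: upt_Suc)
  ultimately show ?thesis
    unfolding tensor_defs detT_eq using PfB_closed by (simp add: vanishing_def)
qed

end

text \<open>The two conjuncts read the dynamical tensor product as an algebra and as a vector space.
  The first follows from the shift relations through the collapse; the second rests on the exchange
  of columns and therefore takes the 2 by 2 minor relations among its relations.\<close>

theorem theorem4p6:
  fixes q \<eta> :: complex and m n :: nat
  assumes "q \<noteq> 0" and "\<forall>k\<ge>1. q ^ k \<noteq> 1" and "exp \<eta> = q"
    and "m \<ge> 1" and "n \<ge> 1" and "CARD('N::finite) = m * n"
  shows
    "Pf (FtB (fr_rel \<eta> :: 'N fr_rels) m n)
        (\<lambda>f. FtB_class (fr_rel \<eta>) m n (left_fun (fr_rel \<eta>) m n f)) \<eta> m n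
        (\<lambda>I. FtB_class (fr_rel \<eta>) m n (cC \<eta> (fr_rel \<eta>) m n I))
      = FtB_class (fr_rel \<eta>) m n (pt (fr_rel \<eta>) m n (detT \<eta> (fr_rel \<eta>)) (PfB \<eta> m n))
     \<and>
     span_class (fr_minor_rel \<eta> :: 'N fr_rels) m n
        (Pf (FoB (fr_minor_rel \<eta>) m n) (left_fun (fr_minor_rel \<eta>) m n) \<eta> m n
          (cC \<eta> (fr_minor_rel \<eta>) m n))
      = span_class (fr_minor_rel \<eta>) m n
          (pt (fr_minor_rel \<eta>) m n (detT \<eta> (fr_minor_rel \<eta>)) (PfB \<eta> m n))"
proof -
  \<comment> \<open>\<open>\<eta> = 0\<close> would give \<open>q = 1\<close>, against the case
    \<open>k = 1\<close> of genericity.\<close>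
  have "\<eta> \<noteq> 0" using assms(2,3) by (auto dest: spec[of _ 1])
  then interpret A: dynamical_tensor "fr_rel \<eta> :: 'N fr_rels" \<eta> m n
    using assms by unfold_locales
  interpret B: dynamical_minor_tensor "fr_minor_rel \<eta> :: 'N fr_rels" \<eta> m n
    using assms \<open>\<eta> \<noteq> 0\<close> by unfold_locales (auto simp: fr_minor_rel_def)
  show ?thesis
    using A.FtB_Pf B.span_class_Pf by blast
qed

end
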